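(* Let $G$ be a connected negative definite plumbing graph (a tree, all genera $0$), let $[k]$ be a class of characteristic elements and let $k_r$ be its distinguished representative. Suppose $\overline{\mathcal J}=\{j_1,\dots,j_\nu\}\subseteq\mathcal J$ is a family of bad vertices of $G$, and let $(\overline L,\overline w[k])$ be the first quadrant $\overline L=(\mathbb Z_{\ge 0})^\nu$ with the weights associated with $\overline{\mathcal J}$ and $k_r$. Then there is a graded $\mathbb Z[U]$-module isomorphism $$\mathbb H^*(G,k_r)\cong \mathbb H^*(\overline L,\overline w[k]).$$
   Context: **Graph and lattice.** $G$ is a finite tree with vertex set $\mathcal J$, vertices decorated by integers $b_j$ (all genera are $0$). $L=\bigoplus_{j\in\mathcal J}\mathbb Z E_j$ carries the intersection form $(E_j,E_j)=b_j$, and for $i\ne j$: $(E_i,E_j)=1$ if $i,j$ are adjacent, $0$ otherwise; it is assumed negative definite. $L'=\{l'\in L\otimes\mathbb Q:(l',L)\subseteq\mathbb Z\}$. $\le$ is the coordinatewise partial order in the basis $\{E_j\}$. $k_{can}\in L'$ is defined by $(k_{can},E_j)=-b_j-2$ for all $j$; the set of characteristic elements is $k_{can}+2L'$, and $[k]=k+2L$. Let $\mathcal S'=\{l'\in L':(l',E_j)\le 0\ \forall j\}$. If $[k]=k_{can}+2(l'+L)$, then $l'_{[k]}$ is the unique minimal element of $(l'+L)\cap\mathcal S'$, and $k_r=k_{can}+2l'_{[k]}$ is the distinguished representative. Put $\chi_k(l)=-\tfrac12(l,l+k)$ for $l\in L$, and $\chi=\chi_{k_{can}}$. **Bad vertices.**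 A negative definite graph is rational if $\chi(l)\ge 1$ for all $l\in L$, $l>0$ (i.e. $l\geq 0,\ l\ne 0$). $\overline{\mathcal J}\subseteq\mathcal J$ is a family of bad vertices if replacing the decorations $b_j$ ($j\in\overline{\mathcal J}$) by some integers $b_j'\le b_j$ turns $G$ into a rational graph. Put $\mathcal J^*=\mathcal J\setminus\overline{\mathcal J}$. **Cycles $x(\mathbf i)$.** For $\mathbf i\in(\mathbb Z_{\ge0})^\nu$, indexed by $\overline{\mathcal J}$, $x(\mathbf i)\in L$ is the unique minimal element among the $x\in L$ such that the $E_j$-coefficient of $x$ is $i_j$ for all $j\in\overline{\mathcal J}$ and $(x+l'_{[k]},E_j)\le 0$ for all $j\in\mathcal J^*$. **Lattice cohomology.** Let $\mathcal T_0^+=\mathbb Z[U,U^{-1}]/U\cdot\mathbb Z[U]$, graded by $\deg U^{-d}=2d$. Let $T\subseteq\mathbb R^s$ be a union of closed cubes of the standard cubical decomposition of $\mathbb R^s$ with vertices in $\mathbb Z^s$; a $q$-cube $(l,I)$ ($l\in \mathbb Z^s$, $|I|=q$) has vertices $l+\sum_{j\in I'}E_j$, $I'\subseteq I$. Given $w_0$ on the lattice points with all sublevel sets $w_0^{-1}((-\infty,n])$ finite, set $w(\square)=\max\{w_0(v):v \text{ a vertex of }\square\}$. Let $\mathcal C_q$ be the free $\mathbb Z$-module on oriented $q$-cubes of $T$, with usual boundary $\partial\square_{q+1}=\sum_k\varepsilon_k\square_q^k$. Set $\mathcal F^q=\mathrm{Hom}_{\mathbb Z}(\mathcal C_q,\mathcal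 T_0^+)$ with the obvious $\mathbb Z[U]$-action; $\phi\in\mathcal F^q$ is homogeneous of degree $2d$ if each nonzero $\phi(\square_q)$ is homogeneous of degree $2d-2w(\square_q)$. The differential is $(\delta_w\phi)(\square_{q+1})=\sum_k\varepsilon_kU^{w(\square_{q+1})-w(\square_q^k)}\phi(\square_q^k)$. $\mathbb H^*(T,w)$ is the cohomology of $(\mathcal F^*,\delta_w)$, a graded $\mathbb Z[U]$-module. $\mathbb H^*(G,k_r)$ is $\mathbb H^*$ for $T=L\otimes\mathbb R$ (lattice $L$ with basis $\{E_j\}$) and $w_0=\chi_{k_r}$. $\mathbb H^*(\overline L,\overline w[k])$ is $\mathbb H^*$ for $T=[0,\infty)^\nu$ and $\overline w_0(\mathbf i)=\chi_{k_r}(x(\mathbf i))$ on $(\mathbb Z_{\ge0})^\nu$. *)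

theory Defs
  imports
    "HOL-Algebra.AbelCoset"
    "HOL-Algebra.Module"
    "HOL-Algebra.Free_Abelian_Groups"
    "HOL-Computational_Algebra.Polynomial"
    "HOL-Library.Function_Algebras"
begin

section \<open>Vectors\<close>

text \<open>
  A coordinate space over a finite index set \<open>S\<close> consists of the functions vanishing off \<open>S\<close>;
  algebraic operations and \<open>\<le>\<close> on functions are pointwise, so \<open>\<le>\<close> is the coordinatewise order.
\<close>

definition coords :: "'v set \<Rightarrow> ('v \<Rightarrow> 'a::zero) set" where
  "coords S = {x. \<forall>v. v \<notin> S \<longrightarrow> x v = 0}"

definition unit_vec :: "'v \<Rightarrow> 'v \<Rightarrow> 'a::zero_neq_one" where
  "unit_vec j = (\<lambda>v. if v = j then 1 else 0)"

definition rat_vec :: "('v \<Rightarrow> int) \<Rightarrow> 'v \<Rightarrow> rat" where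
  "rat_vec l = (\<lambda>v. of_int (l v))"

definition unique_minimal :: "('a::order) set \<Rightarrow> 'a" where
  "unique_minimal A = (THE m. m \<in> A \<and> (\<forall>y\<in>A. y \<le> m \<longrightarrow> y = m))"


section \<open>Plumbing trees and their lattices\<close>

record 'v plumbing_graph =
  verts :: "'v set"
  adj :: "'v \<Rightarrow> 'v \<Rightarrow> bool"
  dec :: "'v \<Rightarrow> int"

definition is_tree :: "'v plumbing_graph \<Rightarrow> bool" where
  "is_tree G \<longleftrightarrow>
     finite (verts G) \<and> verts G \<noteq> {} \<and>
     (\<forall>u v. adj G u v \<longrightarrow> u \<in> verts G \<and> v \<in> verts G \<and> u \<noteq> v \<and> adj G v u) \<and>
     (\<forall>u\<in>verts G. \<forall>v\<in>verts G. (adj G)\<^sup>*\<^sup>* u v) \<and>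
     \<not> (\<exists>c. 3 \<le> length c \<and> distinct c \<and> successively (adj G) c \<and> adj G (last c) (hd c))"

abbreviation int_lattice :: "'v plumbing_graph \<Rightarrow> ('v \<Rightarrow> int) set" where
  "int_lattice G \<equiv> coords (verts G)"

abbreviation rat_lattice :: "'v plumbing_graph \<Rightarrow> ('v \<Rightarrow> rat) set" where
  "rat_lattice G \<equiv> coords (verts G)"

definition form_basis :: "'v plumbing_graph \<Rightarrow> 'v \<Rightarrow> 'v \<Rightarrow> int" where
  "form_basis G i j = (if i = j then dec G i else if adj G i j then 1 else 0)"

text \<open>The intersection form, used both on \<open>L\<close> and on \<open>L \<otimes> \<rat>\<close>.\<close>

definition form ::
    "'v plumbing_graph \<Rightarrow> ('v \<Rightarrow> 'a::comm_ring_1) \<Rightarrow> ('v \<Rightarrow> 'a) \<Rightarrow> 'a" where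
  "form G x y = (\<Sum>i\<in>verts G. \<Sum>j\<in>verts G. x i * y j * of_int (form_basis G i j))"

definition negative_definite :: "'v plumbing_graph \<Rightarrow> bool" where
  "negative_definite G \<longleftrightarrow> (\<forall>l\<in>int_lattice G. l \<noteq> 0 \<longrightarrow> form G l l < 0)"

definition dual_lattice :: "'v plumbing_graph \<Rightarrow> ('v \<Rightarrow> rat) set" where
  "dual_lattice G = {l' \<in> rat_lattice G. \<forall>l\<in>int_lattice G. form G l' (rat_vec l) \<in> \<int>}"

definition k_can :: "'v plumbing_graph \<Rightarrow> 'v \<Rightarrow> rat" where
  "k_can G = (THE k. k \<in> dual_lattice G \<and> (\<forall>j\<in>verts G. form G k (unit_vec j) = of_int (- dec G j - 2)))"

definition characteristic_elements :: "'v plumbing_graph \<Rightarrow> ('v \<Rightarrow> rat) set" where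
  "characteristic_elements G = {\<lambda>v. k_can G v + 2 * l' v |l'. l' \<in> dual_lattice G}"

definition char_class :: "'v plumbing_graph \<Rightarrow> ('v \<Rightarrow> rat) \<Rightarrow> ('v \<Rightarrow> rat) set" where
  "char_class G k = {\<lambda>v. k v + 2 * rat_vec l v |l. l \<in> int_lattice G}"

definition S_cone :: "'v plumbing_graph \<Rightarrow> ('v \<Rightarrow> rat) set" where
  "S_cone G = {l' \<in> dual_lattice G. \<forall>j\<in>verts G. form G l' (unit_vec j) \<le> 0}"

text \<open>
  If \<open>[k] = k_can + 2(l' + L)\<close>, then \<open>m\<close> lies in the coset \<open>l' + L\<close> iff \<open>k_can + 2 m \<in> [k]\<close>; the set
  below is therefore \<open>(l' + L) \<inter> S'\<close>, and its minimal element is \<open>l'\<^bsub>[k]\<^esub>\<close>.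
\<close>

definition l_min :: "'v plumbing_graph \<Rightarrow> ('v \<Rightarrow> rat) \<Rightarrow> 'v \<Rightarrow> rat" where
  "l_min G k = unique_minimal {m \<in> S_cone G. (\<lambda>v. k_can G v + 2 * m v) \<in> char_class G k}"

definition distinguished_rep :: "'v plumbing_graph \<Rightarrow> ('v \<Rightarrow> rat) \<Rightarrow> 'v \<Rightarrow> rat" where
  "distinguished_rep G k = (\<lambda>v. k_can G v + 2 * l_min G k v)"

definition \<chi> :: "'v plumbing_graph \<Rightarrow> ('v \<Rightarrow> rat) \<Rightarrow> ('v \<Rightarrow> int) \<Rightarrow> rat" where
  "\<chi> G k l = - (1 / 2) * form G (rat_vec l) (rat_vec l + k)"

definition rational_graph :: "'v plumbing_graph \<Rightarrow> bool" where
  "rational_graph G \<longleftrightarrow>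
     is_tree G \<and> negative_definite G \<and> (\<forall>l\<in>int_lattice G. 0 < l \<longrightarrow> 1 \<le> \<chi> G (k_can G) l)"

definition bad_vertices :: "'v plumbing_graph \<Rightarrow> 'v set \<Rightarrow> bool" where
  "bad_vertices G B \<longleftrightarrow> B \<subseteq> verts G \<and>
     (\<exists>b'. (\<forall>j\<in>B. b' j \<le> dec G j) \<and> (\<forall>j\<in>verts G - B. b' j = dec G j) \<and>
           rational_graph (G\<lparr>dec := b'\<rparr>))"

definition x_cycle ::
    "'v plumbing_graph \<Rightarrow> 'v set \<Rightarrow> ('v \<Rightarrow> rat) \<Rightarrow> ('v \<Rightarrow> int) \<Rightarrow> 'v \<Rightarrow> int" where
  "x_cycle G B k i = unique_minimal
     {x \<in> int_lattice G. (\<forall>j\<in>B. x j = i j) \<and> (\<forall>j\<in>verts G - B. form G (rat_vec x + l_min G k) (unit_vec j) \<le> 0)}"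


section \<open>The module \<open>T\<^sub>0\<^sup>+ = \<int>[U,U\<^sup>-\<^sup>1] / U \<int>[U]\<close>\<close>

text \<open>Laurent polynomials are finitely supported functions of the exponent of \<open>U\<close>.\<close>

type_synonym laurent = "int \<Rightarrow>\<^sub>0 int"

definition laurent_U :: laurent where
  "laurent_U = Poly_Mapping.single 1 1"

definition laurent_of :: "int poly \<Rightarrow> laurent" where
  "laurent_of p = poly (map_poly of_int p) laurent_U"

definition UZU :: "laurent set" where
  "UZU = {laurent_U * laurent_of p |p. True}"

lemma laurent_of_pCons: "laurent_of (pCons a p) = of_int a + laurent_U * laurent_of p"
  by (simp add: laurent_of_def map_poly_pCons)

lemma laurent_of_0: "laurent_of 0 = 0"
  by (simp add: laurent_of_def)

lemma laurent_of_add: "laurent_of (p + q) = laurent_of p + laurent_of q"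
  by (induction p q rule: poly_induct2)
    (simp_all add: laurent_of_0 laurent_of_pCons algebra_simps)

lemma laurent_of_minus: "laurent_of (- p) = - laurent_of p"
  using laurent_of_add[of p "- p"] by (simp add: laurent_of_0 add_eq_0_iff)

lemma laurent_of_smult: "laurent_of (Polynomial.smult a p) = of_int a * laurent_of p"
  by (induction p) (simp_all add: laurent_of_0 laurent_of_pCons algebra_simps)

lemma laurent_of_mult: "laurent_of (p * q) = laurent_of p * laurent_of q"
  by (induction p)
    (simp_all add: laurent_of_0 laurent_of_pCons laurent_of_add laurent_of_smult algebra_simps)

lemma UZU_0: "0 \<in> UZU"
  unfolding UZU_def by (auto simp: laurent_of_0 intro!: exI[where x = 0])

lemma UZU_add: "f \<in> UZU \<Longrightarrow> g \<in> UZU \<Longrightarrow> f + g \<in> UZU"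
proof -
  assume "f \<in> UZU" "g \<in> UZU"
  then obtain p q where "f = laurent_U * laurent_of p" "g = laurent_U * laurent_of q"
    by (auto simp: UZU_def)
  then have "f + g = laurent_U * laurent_of (p + q)"
    by (simp add: laurent_of_add distrib_left)
  then show ?thesis
    by (auto simp: UZU_def)
qed

lemma UZU_minus: "f \<in> UZU \<Longrightarrow> - f \<in> UZU"
proof -
  assume "f \<in> UZU"
  then obtain p where "f = laurent_U * laurent_of p"
    by (auto simp: UZU_def)
  then have "- f = laurent_U * laurent_of (- p)"
    by (simp add: laurent_of_minus)
  then show ?thesis
    by (auto simp: UZU_def)
qed

lemma UZU_mult: "f \<in> UZU \<Longrightarrow> laurent_of p * f \<in> UZU"
proof -
  assume "f \<in> UZU"
  then obtain q where "f = laurent_U * laurent_of q"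
    by (auto simp: UZU_def)
  then have "laurent_of p * f = laurent_U * laurent_of (p * q)"
    by (simp add: laurent_of_mult mult.left_commute)
  then show ?thesis
    by (auto simp: UZU_def)
qed

quotient_type T0 = laurent / "\<lambda>f g. f - g \<in> UZU"
proof (rule equivpI)
  show "reflp (\<lambda>f g. f - g \<in> UZU)"
    by (simp add: reflp_def UZU_0)
  show "symp (\<lambda>f g. f - g \<in> UZU)"
    unfolding symp_def using UZU_minus minus_diff_eq by metis
  show "transp (\<lambda>f g. f - g \<in> UZU)"
  proof (rule transpI)
    fix f g h assume "f - g \<in> UZU" "g - h \<in> UZU"
    from UZU_add[OF this] show "f - h \<in> UZU" by simp
  qed
qed

instantiation T0 :: ab_group_add
begin

lift_definition zero_T0 :: T0 is 0 .

lift_definition plus_T0 :: "T0 \<Rightarrow> T0 \<Rightarrow> T0" is "(+)"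
  by (simp add: add_diff_add UZU_add)

lift_definition uminus_T0 :: "T0 \<Rightarrow> T0" is uminus
  by (drule UZU_minus) simp

definition minus_T0 :: "T0 \<Rightarrow> T0 \<Rightarrow> T0" where
  "minus_T0 x y = x + - y"

instance
proof
  fix a b c :: T0
  show "a + b + c = a + (b + c)" by transfer (simp add: UZU_0 add.assoc)
  show "a + b = b + a" by transfer (simp add: UZU_0 add.commute)
  show "0 + a = a" by transfer (simp add: UZU_0)
  show "- a + a = 0" by transfer (simp add: UZU_0)
  show "a - b = a + - b" by (rule minus_T0_def)
qed

end

lift_definition T0_scale :: "int poly \<Rightarrow> T0 \<Rightarrow> T0" (infixr "\<cdot>" 75) is "\<lambda>p f. laurent_of p * f"
  by (simp add: right_diff_distrib[symmetric] UZU_mult)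

text \<open>Multiples of (the class of) \<open>U\<^sup>-\<^sup>d\<close> have degree \<open>2 d\<close>; that class is zero for \<open>d < 0\<close>.\<close>

definition T0_homog :: "int \<Rightarrow> T0 set" where
  "T0_homog m = {abs_T0 (Poly_Mapping.single (- d) c) |d c. m = 2 * d}"


section \<open>Graded modules\<close>

text \<open>
  Modules are records over HOL-Algebra's \<open>ring\<close>, whose fields \<open>mult\<close> and \<open>one\<close> play no role
  for a module.
\<close>

record ('r, 'a) graded_module = "('r, 'a) module" +
  homog :: "int \<Rightarrow> 'a set"

definition ZU :: "int poly ring" where
  "ZU = \<lparr>carrier = UNIV, monoid.mult = (*), one = 1, ring.zero = 0, ring.add = (+)\<rparr>"

definition graded_quotient ::
    "('r, 'a) graded_module \<Rightarrow> 'a set \<Rightarrow> ('r, 'a set) graded_module" where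
  "graded_quotient M N =
     \<lparr>carrier = a_rcosets\<^bsub>M\<^esub> N, monoid.mult = undefined, one = undefined,
      ring.zero = N, ring.add = set_add M,
      module.smult = (\<lambda>r X. \<Union>x\<in>X. N +>\<^bsub>M\<^esub> (r \<odot>\<^bsub>M\<^esub> x)),
      homog = (\<lambda>m. (\<lambda>x. N +>\<^bsub>M\<^esub> x) ` homog M m)\<rparr>"

definition graded_module_iso ::
    "'r ring \<Rightarrow> ('r, 'a) graded_module \<Rightarrow> ('r, 'b) graded_module \<Rightarrow> ('a \<Rightarrow> 'b) set" where
  "graded_module_iso R M N =
     {f \<in> iso (add_monoid M) (add_monoid N).
        (\<forall>r\<in>carrier R. \<forall>x\<in>carrier M. f (r \<odot>\<^bsub>M\<^esub> x) = r \<odot>\<^bsub>N\<^esub> f x) \<and>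
        (\<forall>m. f ` homog M m = homog N m)}"

definition graded_isomorphic ::
    "'r ring \<Rightarrow> ('r, 'a) graded_module \<Rightarrow> ('r, 'b) graded_module \<Rightarrow> bool" where
  "graded_isomorphic R M N \<longleftrightarrow> graded_module_iso R M N \<noteq> {}"


section \<open>Lattice cohomology\<close>

text \<open>
  The pair \<open>(l, I)\<close> is the cube with vertices \<open>l + \<Sum>j\<in>I'. unit_vec j\<close>, \<open>I' \<subseteq> I\<close>. Spaces \<open>T \<subseteq> \<real>\<^sup>s\<close> are sets of
  real functions vanishing off an \<open>s\<close>-element set \<open>S\<close>; a cube contained in such a \<open>T\<close> automatically has
  \<open>l\<close> supported in \<open>S\<close> and \<open>I \<subseteq> S\<close>.
\<close>

type_synonym 'v cube = "('v \<Rightarrow> int) \<times> 'v set"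

definition closed_cube :: "'v cube \<Rightarrow> ('v \<Rightarrow> real) set" where
  "closed_cube = (\<lambda>(l, I). {x. \<forall>v. of_int (l v) \<le> x v \<and> x v \<le> of_int (l v) + (if v \<in> I then 1 else 0)})"

definition cubes :: "('v \<Rightarrow> real) set \<Rightarrow> nat \<Rightarrow> 'v cube set" where
  "cubes T q = {(l, I). finite I \<and> card I = q \<and> closed_cube (l, I) \<subseteq> T}"

definition cube_vertices :: "'v cube \<Rightarrow> ('v \<Rightarrow> int) set" where
  "cube_vertices = (\<lambda>(l, I). {l + (\<Sum>j\<in>I'. unit_vec j) |I'. I' \<subseteq> I})"

definition cube_weight :: "(('v \<Rightarrow> int) \<Rightarrow> int) \<Rightarrow> 'v cube \<Rightarrow> int" where
  "cube_weight w\<^sub>0 c = Max (w\<^sub>0 ` cube_vertices c)"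

abbreviation chains :: "('v \<Rightarrow> real) set \<Rightarrow> nat \<Rightarrow> ('v cube \<Rightarrow>\<^sub>0 int) set" where
  "chains T q \<equiv> carrier (free_Abelian_group (cubes T q))"

text \<open>
  Each cube is oriented by listing its directions in increasing order; this is the only use made of
  the linear order on the index type.
\<close>

definition cube_boundary :: "('v::linorder) cube \<Rightarrow> 'v cube \<Rightarrow>\<^sub>0 int" where
  "cube_boundary = (\<lambda>(l, I). \<Sum>j\<in>I. frag_cmul ((- 1) ^ card {i\<in>I. i < j})
     (frag_of (l + unit_vec j, I - {j}) - frag_of (l, I - {j})))"

text \<open>
  \<open>Hom(C\<^sub>q, T\<^sub>0\<^sup>+)\<close>; homomorphisms are extended by zero off the chain group so that equal homomorphisms
  are equal functions.
\<close>

definition cochains :: "('v \<Rightarrow> real) set \<Rightarrow> nat \<Rightarrow> (('v cube \<Rightarrow>\<^sub>0 int) \<Rightarrow> T0) set" where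
  "cochains T q = {\<phi>. (\<forall>c\<in>chains T q. \<forall>d\<in>chains T q. \<phi> (c + d) = \<phi> c + \<phi> d) \<and>
                      (\<forall>c. c \<notin> chains T q \<longrightarrow> \<phi> c = 0)}"

definition cochain_module ::
    "('v \<Rightarrow> real) set \<Rightarrow> (('v \<Rightarrow> int) \<Rightarrow> int) \<Rightarrow> nat
      \<Rightarrow> (int poly, ('v cube \<Rightarrow>\<^sub>0 int) \<Rightarrow> T0) graded_module" where
  "cochain_module T w\<^sub>0 q =
     \<lparr>carrier = cochains T q, monoid.mult = undefined, one = undefined,
      ring.zero = 0, ring.add = (+),
      module.smult = (\<lambda>p \<phi> c. p \<cdot> \<phi> c),
      homog = (\<lambda>m. {\<phi> \<in> cochains T q. \<forall>s\<in>cubes T q. \<phi> (frag_of s) \<noteq> 0 \<longrightarrow>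
                        \<phi> (frag_of s) \<in> T0_homog (m - 2 * cube_weight w\<^sub>0 s)})\<rparr>"

text \<open>
  \<open>(\<delta>\<^sub>w \<phi>)(s) = \<Sum>\<^sub>k \<epsilon>\<^sub>k U\<^bsup>w(s) - w(s\<^sub>k)\<^esup> \<phi>(s\<^sub>k)\<close> when \<open>\<partial>s = \<Sum>\<^sub>k \<epsilon>\<^sub>k s\<^sub>k\<close>, first for a cube \<open>s\<close>, then extended
  linearly to chains.
\<close>

definition delta_cube ::
    "(('v::linorder \<Rightarrow> int) \<Rightarrow> int) \<Rightarrow> (('v cube \<Rightarrow>\<^sub>0 int) \<Rightarrow> T0) \<Rightarrow> 'v cube \<Rightarrow> T0" where
  "delta_cube w\<^sub>0 \<phi> s =
     (\<Sum>f\<in>Poly_Mapping.keys (cube_boundary s).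
        Polynomial.monom (Poly_Mapping.lookup (cube_boundary s) f)
            (nat (cube_weight w\<^sub>0 s - cube_weight w\<^sub>0 f)) \<cdot> \<phi> (frag_of f))"

definition delta ::
    "('v::linorder \<Rightarrow> real) set \<Rightarrow> (('v \<Rightarrow> int) \<Rightarrow> int) \<Rightarrow> nat
      \<Rightarrow> (('v cube \<Rightarrow>\<^sub>0 int) \<Rightarrow> T0) \<Rightarrow> ('v cube \<Rightarrow>\<^sub>0 int) \<Rightarrow> T0" where
  "delta T w\<^sub>0 q \<phi> = (\<lambda>c. if c \<in> chains T (Suc q)
     then \<Sum>s\<in>Poly_Mapping.keys c. [:Poly_Mapping.lookup c s:] \<cdot> delta_cube w\<^sub>0 \<phi> s else 0)"

definition cocycle_module ::
    "('v::linorder \<Rightarrow> real) set \<Rightarrow> (('v \<Rightarrow> int) \<Rightarrow> int) \<Rightarrow> nat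
      \<Rightarrow> (int poly, ('v cube \<Rightarrow>\<^sub>0 int) \<Rightarrow> T0) graded_module" where
  "cocycle_module T w\<^sub>0 q =
     (let Z = {\<phi> \<in> cochains T q. delta T w\<^sub>0 q \<phi> = 0} in
      cochain_module T w\<^sub>0 q
        \<lparr>carrier := Z, homog := \<lambda>m. homog (cochain_module T w\<^sub>0 q) m \<inter> Z\<rparr>)"

definition coboundaries ::
    "('v::linorder \<Rightarrow> real) set \<Rightarrow> (('v \<Rightarrow> int) \<Rightarrow> int) \<Rightarrow> nat
      \<Rightarrow> (('v cube \<Rightarrow>\<^sub>0 int) \<Rightarrow> T0) set" where
  "coboundaries T w\<^sub>0 q = (case q of 0 \<Rightarrow> {0} | Suc p \<Rightarrow> delta T w\<^sub>0 p ` cochains T p)"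

definition lattice_cohomology ::
    "('v::linorder \<Rightarrow> real) set \<Rightarrow> (('v \<Rightarrow> int) \<Rightarrow> int) \<Rightarrow> nat
      \<Rightarrow> (int poly, (('v cube \<Rightarrow>\<^sub>0 int) \<Rightarrow> T0) set) graded_module" where
  "lattice_cohomology T w\<^sub>0 q = graded_quotient (cocycle_module T w\<^sub>0 q) (coboundaries T w\<^sub>0 q)"

text \<open>
  For a characteristic element \<open>k\<close> the rational number \<open>\<chi>\<^sub>k(l)\<close> is an integer, since
  \<open>(l, l + k_can) \<equiv> \<Sum>\<^sub>j b\<^sub>j l\<^sub>j (l\<^sub>j - 1) \<equiv> 0\<close> modulo 2 and \<open>k - k_can \<in> 2L'\<close>; the floor below only changes
  its type.
\<close>

definition graph_lattice_cohomology ::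
    "('v::linorder) plumbing_graph \<Rightarrow> ('v \<Rightarrow> rat) \<Rightarrow> nat
      \<Rightarrow> (int poly, (('v cube \<Rightarrow>\<^sub>0 int) \<Rightarrow> T0) set) graded_module" where
  "graph_lattice_cohomology G k = lattice_cohomology (coords (verts G)) (\<lambda>l. \<lfloor>\<chi> G k l\<rfloor>)"

definition first_quadrant :: "'v set \<Rightarrow> ('v \<Rightarrow> real) set" where
  "first_quadrant B = {x \<in> coords B. \<forall>v. 0 \<le> x v}"

definition reduced_weight ::
    "'v plumbing_graph \<Rightarrow> 'v set \<Rightarrow> ('v \<Rightarrow> rat) \<Rightarrow> ('v \<Rightarrow> int) \<Rightarrow> int" where
  "reduced_weight G B k i = \<lfloor>\<chi> G (distinguished_rep G k) (x_cycle G B k i)\<rfloor>"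

definition reduced_lattice_cohomology ::
    "('v::linorder) plumbing_graph \<Rightarrow> 'v set \<Rightarrow> ('v \<Rightarrow> rat) \<Rightarrow> nat
      \<Rightarrow> (int poly, (('v cube \<Rightarrow>\<^sub>0 int) \<Rightarrow> T0) set) graded_module" where
  "reduced_lattice_cohomology G B k = lattice_cohomology (first_quadrant B) (reduced_weight G B k)"

end

theory Submission
  imports Defs
begin

text \<open>
  Let \<open>\<pi>\<close> be the map \<open>L \<rightarrow> (\<int>\<^sub>\<ge>\<^sub>0)\<^sup>\<nu>\<close> taking the positive part of the coordinates in the bad vertices. On cubical
  chains, \<open>\<pi>\<close> does not increase weights, because \<open>\<chi>(x(\<pi> x)) \<le> \<chi>(x)\<close>. For a cube \<open>c\<close> of the quadrant and
  \<open>n\<close> at least its weight, the full cubical complex on \<open>{x. \<pi> x \<in> c, \<chi> x \<le> n}\<close> is acyclic: it collapses to a point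
  by removing extremal lattice points one at a time. Raising coordinates follows Laufer's algorithm;
  lowering them is possible because the graph with decreased decorations is rational, and only
  elements with coordinates 0 or 1 in the bad vertices occur there, for which \<open>\<chi>\<close> does not see the
  decorations of these vertices. Acyclic carriers then provide a weight-nonincreasing chain homotopy
  inverse of \<open>\<pi>\<close>, and weight-nonincreasing chain maps and homotopies dualize to the graded
  \<open>\<int>[U]\<close>-cochain complexes.
\<close>

section \<open>Cubical chains\<close>

text \<open>Acyclicity is required for every \<open>n\<close> at or above the weight of a quadrant
  cube, not only for that weight itself: the homotopy on a lattice cube \<open>s\<close> is carried
  by the points over its projection whose weight is at most that of \<open>s\<close>, and
  \<open>s\<close> may be heavier than its image. The composite from the quadrant to the lattice and
  back is the identity on the nose, since a cube contained in a cube of the same dimension equals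
  it; only the other composite needs a homotopy. The collapses have different sources. Negative bad
  coordinates can be raised because \<open>l_min G k\<close> is minimal, and points below
  \<open>x(i)\<close> because \<open>x(i)\<close> is minimal. An excess over \<open>x(i)\<close> can
  be lowered when \<open>(x(i) + l_min G k, E_b) \<le> 0\<close> for all directions \<open>b\<close>
  of the cube; if this fails for some \<open>b\<close>, the fibre is pushed up to the opposite face
  instead, and induction on the dimension continues there. Each of the collapses behind
  \<chi>(x(\<pi> x)) \<le> \<chi>(x) preserves nonemptiness, and taking the level \<open>n\<close>
  to be \<chi>(x) then yields this inequality.\<close>

definition ind :: "'v set \<Rightarrow> 'v \<Rightarrow> int" where
  "ind J = (\<lambda>v. if v \<in> J then 1 else 0)"

lemma sum_unit_vec: "finite J \<Longrightarrow> (\<Sum>j\<in>J. unit_vec j) = ind J"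
  by (induction J rule: finite_induct) (auto simp: ind_def unit_vec_def fun_eq_iff)

lemma ind_empty [simp]: "ind {} = 0"
  by (auto simp: ind_def fun_eq_iff)

lemma ind_insert: "j \<notin> J \<Longrightarrow> ind (insert j J) = unit_vec j + ind J"
  by (auto simp: ind_def unit_vec_def fun_eq_iff)

lemma ind_remove: "j \<in> J \<Longrightarrow> ind (J - {j}) = ind J - unit_vec j"
  by (auto simp: ind_def unit_vec_def fun_eq_iff)

definition face_sign :: "'v::linorder set \<Rightarrow> 'v \<Rightarrow> int" where
  "face_sign I j = (- 1) ^ card {i\<in>I. i < j}"

lemma face_sign_cases: "face_sign I j = 1 \<or> face_sign I j = - 1"
  by (auto simp: face_sign_def minus_one_power_iff)

lemma face_sign_nonzero [simp]: "face_sign I j \<noteq> 0"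
  using face_sign_cases[of I j] by auto

lemma face_sign_remove:
  assumes "finite I" "k \<in> I"
  shows "face_sign (I - {k}) j = (if k < j then - face_sign I j else face_sign I j)"
proof (cases "k < j")
  case True
  then have "{i\<in>I. i < j} = insert k {i\<in>I - {k}. i < j}" using assms by auto
  then have "card {i\<in>I. i < j} = Suc (card {i\<in>I - {k}. i < j})" using assms by simp
  then show ?thesis using True by (simp add: face_sign_def)
next
  case False
  then have "{i\<in>I. i < j} = {i\<in>I - {k}. i < j}" by auto
  then show ?thesis using False by (simp add: face_sign_def)
qed

text \<open>Deleting the smaller of two directions flips the sign of the larger one, deleting the
  larger leaves the smaller one alone; exactly one of the two products therefore changes
  sign.\<close>

lemma face_sign_antisym:
  assumes "finite I" "j \<in> I" "k \<in> I" "j \<noteq> k"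
  shows "face_sign I j * face_sign (I - {j}) k = - (face_sign I k * face_sign (I - {k}) j)"
  using assms by (auto simp: face_sign_remove not_less_iff_gr_or_eq)

lemma cube_boundary_eq:
  "cube_boundary (l, I) = (\<Sum>j\<in>I. frag_cmul (face_sign I j)
     (frag_of (l + unit_vec j, I - {j}) - frag_of (l, I - {j})))"
  by (simp add: cube_boundary_def face_sign_def)

lemma lookup_cube_boundary:
  "poly_mapping.lookup (cube_boundary (l, I)) f =
    (\<Sum>j\<in>I. face_sign I j * ((if f = (l + unit_vec j, I - {j}) then 1 else 0)
       - (if f = (l, I - {j}) then 1 else 0)))"
  by (simp add: cube_boundary_eq lookup_sum lookup_minus)

lemma keys_cube_boundary:
  assumes "f \<in> Poly_Mapping.keys (cube_boundary (l, I))"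
  obtains j where "j \<in> I" "f = (l, I - {j}) \<or> f = (l + unit_vec j, I - {j})"
proof -
  from assms have "(\<Sum>j\<in>I. face_sign I j * ((if f = (l + unit_vec j, I - {j}) then 1 else 0)
       - (if f = (l, I - {j}) then 1 else 0))) \<noteq> 0"
    by (simp add: in_keys_iff lookup_cube_boundary)
  then obtain j where "j \<in> I" "face_sign I j * ((if f = (l + unit_vec j, I - {j}) then 1 else 0)
       - (if f = (l, I - {j}) then 1 else 0)) \<noteq> 0"
    by (meson sum.neutral)
  then show thesis by (intro that[of j]) (auto split: if_splits)
qed

abbreviation bd :: "('v::linorder cube \<Rightarrow>\<^sub>0 int) \<Rightarrow> 'v cube \<Rightarrow>\<^sub>0 int" where
  "bd \<equiv> frag_extend cube_boundary"

text \<open>The double boundary is a sum over ordered pairs of distinct directions. The combination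
  \<open>X j k\<close> of the four faces of codimension two is symmetric in the pair while the sign
  is antisymmetric, so the sum equals its own negative, and the chain group has no
  2-torsion.\<close>

lemma bd_cube_boundary:
  assumes "finite I"
  shows "bd (cube_boundary (l, I)) = 0"
proof -
  define X where "X = (\<lambda>j k. frag_of (l + unit_vec j + unit_vec k, I - {j} - {k})
     - frag_of (l + unit_vec j, I - {j} - {k})
     - frag_of (l + unit_vec k, I - {j} - {k}) + frag_of (l, I - {j} - {k}))"
  define a where "a = (\<lambda>(j, k). frag_cmul (face_sign I j * face_sign (I - {j}) k) (X j k))"
  define P where "P = (SIGMA j:I. I - {j})"
  have X_sym: "X j k = X k j" for j k
    by (simp add: X_def Diff_insert2[symmetric] insert_commute add.assoc add.commute[of "unit_vec j"])
  have "frag_cmul (face_sign I j) (cube_boundary (l + unit_vec j, I - {j}) - cube_boundary (l, I - {j})) =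
      (\<Sum>k\<in>I - {j}. a (j, k))" for j
    unfolding cube_boundary_eq sum_subtractf[symmetric] frag_cmul_sum
    by (rule sum.cong[OF refl], rule poly_mapping_eqI)
      (simp add: a_def X_def lookup_minus lookup_add algebra_simps del: lookup_frag_of)
  then have "bd (cube_boundary (l, I)) = (\<Sum>j\<in>I. \<Sum>k\<in>I - {j}. a (j, k))"
    unfolding cube_boundary_eq[of l I]
    by (simp add: frag_extend_sum assms frag_extend_cmul frag_extend_diff)
  also have "\<dots> = sum a P"
    using assms by (simp add: P_def sum.Sigma)
  finally have 1: "bd (cube_boundary (l, I)) = sum a P" .
  have "sum a P = (\<Sum>p\<in>P. a (prod.swap p))"
    by (rule sum.reindex_bij_witness[of _ prod.swap prod.swap]) (auto simp: P_def)
  also have "\<dots> = (\<Sum>p\<in>P. - a p)"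
  proof (rule sum.cong[OF refl])
    fix p assume "p \<in> P"
    then obtain j k where p: "p = (j, k)" "j \<in> I" "k \<in> I" "j \<noteq> k" by (auto simp: P_def)
    then have "face_sign I k * face_sign (I - {k}) j = - (face_sign I j * face_sign (I - {j}) k)"
      using face_sign_antisym[OF assms, of k j] by auto
    then show "a (prod.swap p) = - a p"
      unfolding p(1) a_def by (simp add: X_sym[of k j])
  qed
  finally have "sum a P = - sum a P" by (simp add: sum_negf)
  then have "poly_mapping.lookup (sum a P) x = - poly_mapping.lookup (sum a P) x" for x
    by (metis lookup_uminus)
  then have "sum a P = 0" by (intro poly_mapping_eqI) (simp add: eq_neg_iff_add_eq_0)
  with 1 show ?thesis by simp
qed

section \<open>Linear extension and supports of chains\<close>

lemma frag_extend_frag_extend: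
  "frag_extend f (frag_extend g c) = frag_extend (\<lambda>s. frag_extend f (g s)) c"
  by (simp add: frag_extend_def[of g] frag_extend_def[of "\<lambda>s. frag_extend f (g s)"]
    frag_extend_sum frag_extend_cmul)

lemma lookup_frag_extend:
  "poly_mapping.lookup (frag_extend f c) x =
    (\<Sum>s\<in>Poly_Mapping.keys c. poly_mapping.lookup c s * poly_mapping.lookup (f s) x)"
  by (simp add: frag_extend_def lookup_sum)

lemma keys_frag_extend_subset:
  "(\<And>s. s \<in> Poly_Mapping.keys c \<Longrightarrow> Poly_Mapping.keys (f s) \<subseteq> K) \<Longrightarrow>
    Poly_Mapping.keys (frag_extend f c) \<subseteq> K"
  using keys_frag_extend[of f c] by blast

lemma keys_diff_subset:
  "Poly_Mapping.keys c \<subseteq> K \<Longrightarrow> Poly_Mapping.keys d \<subseteq> K \<Longrightarrow> Poly_Mapping.keys (c - d :: 'a \<Rightarrow>\<^sub>0 int) \<subseteq> K"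
  using keys_diff[of c d] by blast

lemma keys_add_subset:
  "Poly_Mapping.keys c \<subseteq> K \<Longrightarrow> Poly_Mapping.keys d \<subseteq> K \<Longrightarrow> Poly_Mapping.keys (c + d :: 'a \<Rightarrow>\<^sub>0 int) \<subseteq> K"
  using Poly_Mapping.keys_add[of c d] by blast

text \<open>The cubical complex induced by a set of lattice points. Describing cubes by their
  vertices fits sublevel sets, since the weight of a cube is the maximum over its vertices, and
  makes a collapse the removal of a point.\<close>

definition full_cubes :: "('v \<Rightarrow> int) set \<Rightarrow> nat \<Rightarrow> 'v cube set" where
  "full_cubes V q = {(l, I). finite I \<and> card I = q \<and> (\<forall>J\<subseteq>I. l + ind J \<in> V)}"

lemma full_cubes_mono: "V \<subseteq> W \<Longrightarrow> full_cubes V q \<subseteq> full_cubes W q"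
  by (auto simp: full_cubes_def)

lemma full_cubes_face:
  assumes "(l, I) \<in> full_cubes V q" "f \<in> Poly_Mapping.keys (cube_boundary (l, I))"
  shows "f \<in> full_cubes V (q - 1)" "0 < q"
proof -
  obtain j where j: "j \<in> I" "f = (l, I - {j}) \<or> f = (l + unit_vec j, I - {j})"
    using keys_cube_boundary[OF assms(2)] by metis
  have fin: "finite I" "card I = q" and V: "\<And>J. J \<subseteq> I \<Longrightarrow> l + ind J \<in> V"
    using assms(1) by (auto simp: full_cubes_def)
  show "0 < q" using fin j(1) card_gt_0_iff by blast
  have "l + unit_vec j + ind J \<in> V" if "J \<subseteq> I - {j}" for J
  proof -
    have "j \<notin> J" using that by auto
    with V[of "insert j J"] that j(1) show ?thesis
      by (auto simp: ind_insert add.assoc)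
  qed
  then show "f \<in> full_cubes V (q - 1)"
    using j fin V by (auto simp: full_cubes_def)
qed

lemma keys_bd:
  assumes "Poly_Mapping.keys c \<subseteq> full_cubes V q"
  shows "Poly_Mapping.keys (bd c) \<subseteq> full_cubes V (q - 1)"
proof (rule keys_frag_extend_subset)
  fix s assume "s \<in> Poly_Mapping.keys c"
  then show "Poly_Mapping.keys (cube_boundary s) \<subseteq> full_cubes V (q - 1)"
    using assms full_cubes_face(1)[of "fst s" "snd s" V q] by auto
qed

lemma bd_bd:
  assumes "Poly_Mapping.keys c \<subseteq> full_cubes V q"
  shows "bd (bd c) = 0"
  unfolding frag_extend_frag_extend
  by (rule frag_extend_eq_0) (use assms in \<open>auto simp: full_cubes_def intro!: bd_cube_boundary\<close>)

text \<open>The augmentation takes values in the free group on one generator instead of the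
  integers, so that the calculus of \<open>frag_extend\<close> covers it too.\<close>

definition aug :: "('a \<Rightarrow>\<^sub>0 int) \<Rightarrow> unit \<Rightarrow>\<^sub>0 int" where
  "aug = frag_extend (\<lambda>_. frag_of ())"

lemma aug_cube_boundary: "finite I \<Longrightarrow> aug (cube_boundary (l, I)) = 0"
  by (auto simp: aug_def cube_boundary_eq frag_extend_sum frag_extend_cmul frag_extend_diff)

lemma aug_bd:
  assumes "Poly_Mapping.keys c \<subseteq> full_cubes V q"
  shows "aug (bd c) = 0"
  unfolding aug_def frag_extend_frag_extend
  by (rule frag_extend_eq_0)
    (use assms in \<open>auto simp: full_cubes_def simp flip: aug_def intro!: aug_cube_boundary\<close>)

text \<open>In degree 0 the boundary vanishes automatically and the augmentation is the actual
  condition.\<close>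

definition reduced_cycle :: "('v::linorder \<Rightarrow> int) set \<Rightarrow> nat \<Rightarrow> ('v cube \<Rightarrow>\<^sub>0 int) \<Rightarrow> bool" where
  "reduced_cycle V q z \<longleftrightarrow>
     Poly_Mapping.keys z \<subseteq> full_cubes V q \<and> bd z = 0 \<and> (q = 0 \<longrightarrow> aug z = 0)"

text \<open>Nonemptiness stands for vanishing reduced homology in degree -1; it supplies the
  starting vertex for maps built on acyclic carriers.\<close>

definition acyclic_set :: "('v::linorder \<Rightarrow> int) set \<Rightarrow> bool" where
  "acyclic_set V \<longleftrightarrow> V \<noteq> {} \<and>
     (\<forall>q z. reduced_cycle V q z \<longrightarrow> (\<exists>c. Poly_Mapping.keys c \<subseteq> full_cubes V (Suc q) \<and> bd c = z))"

lemma acyclic_set_singleton: "acyclic_set {x}"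
proof -
  have K: "full_cubes {x} q = (if q = 0 then {(x, {})} else {})" for q
  proof -
    have I: "I = {}" if "\<forall>J\<subseteq>I. l + ind J = x" for l :: "'a \<Rightarrow> int" and I
    proof (rule ccontr)
      assume "I \<noteq> {}"
      then obtain j where j: "j \<in> I" by auto
      from that have "l + ind {j} = x" "l + ind {} = x" using j by blast+
      then have "ind {j} j = (0::int)" by (auto simp: fun_eq_iff)
      then show False by (simp add: ind_def)
    qed
    have "s \<in> full_cubes {x} q \<longleftrightarrow> q = 0 \<and> s = (x, {})" for s
    proof (cases s)
      case (Pair l I)
      then show ?thesis using I[of I l] by (auto simp: full_cubes_def)
    qed
    then show ?thesis by auto
  qed
  have "z = 0" if "reduced_cycle {x} q z" for q z
  proof (cases "q = 0")
    case True
    with that have z: "Poly_Mapping.keys z \<subseteq> {(x, {})}" "aug z = 0"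
      by (auto simp: reduced_cycle_def K)
    show ?thesis
    proof (rule ccontr)
      assume "z \<noteq> 0"
      then have k: "Poly_Mapping.keys z = {(x, {})}" using z(1) by (metis keys_eq_empty subset_singletonD)
      have "poly_mapping.lookup (aug z) () = poly_mapping.lookup z (x, {})"
        by (simp add: aug_def lookup_frag_extend k)
      with z(2) k show False by (metis in_keys_iff insertI1 lookup_zero)
    qed
  next
    case False
    with that show ?thesis by (auto simp: reduced_cycle_def K)
  qed
  then show ?thesis
    by (auto simp: acyclic_set_def intro!: exI[of _ 0])
qed

text \<open>
  The cubes having \<open>x\<close> as their lowest (\<open>a = 0\<close>) or highest (\<open>a = 1\<close>) vertex are the \<open>corner_cube a x I\<close>.
\<close>

definition corner_cube :: "int \<Rightarrow> ('v \<Rightarrow> int) \<Rightarrow> 'v set \<Rightarrow> 'v cube" where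
  "corner_cube a x I = (\<lambda>v. x v - a * ind I v, I)"

text \<open>A face without the direction \<open>j\<close> can only arise by deleting
  \<open>j\<close>. Of the two opposite faces obtained this way exactly one still has its corner at
  \<open>x\<close>: the lower one for \<open>a = 0\<close>, with negative sign, and the upper one
  for \<open>a = 1\<close>. The factor \<open>2 * a - 1\<close> records this sign.\<close>

lemma lookup_boundary_corner:
  assumes "finite I" "j \<in> I" "j \<notin> J" "a = 0 \<or> a = 1"
  shows "poly_mapping.lookup (cube_boundary (corner_cube a x I)) (corner_cube a x J) =
    (if J = I - {j} then (2 * a - 1) * face_sign I j else 0)"
proof -
  have *: "(\<lambda>v. x v - a * ind J v) \<noteq> (\<lambda>v. x v - a * ind I v) + (if a = 0 then unit_vec j else 0)"
    "(\<lambda>v. x v - a * ind (I - {j}) v) = (\<lambda>v. x v - a * ind I v) + (if a = 0 then 0 else unit_vec j)"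
    using assms by (auto simp: fun_eq_iff ind_def unit_vec_def intro!: exI[of _ j])
  have "poly_mapping.lookup (cube_boundary (corner_cube a x I)) (corner_cube a x J) =
     (\<Sum>i\<in>{j}. face_sign I i * ((if corner_cube a x J = ((\<lambda>v. x v - a * ind I v) + unit_vec i, I - {i}) then 1 else 0)
       - (if corner_cube a x J = ((\<lambda>v. x v - a * ind I v), I - {i}) then 1 else 0)))"
    unfolding corner_cube_def lookup_cube_boundary
    by (rule sum.mono_neutral_right) (use assms in auto)
  also have "\<dots> = (if J = I - {j} then (2 * a - 1) * face_sign I j else 0)"
    using assms(4) * by (auto simp: corner_cube_def)
  finally show ?thesis .
qed

text \<open>
  An elementary collapse: cancelling each cube at \<open>x\<close> not containing the direction \<open>j\<close> against the one
  with \<open>j\<close> added pushes every cycle off the star of \<open>x\<close>.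
\<close>

lemma acyclic_set_remove:
  assumes a: "a = 0 \<or> a = 1" and x: "x \<in> V"
    and star: "\<And>l I J. finite I \<Longrightarrow> (\<forall>J\<subseteq>I. l + ind J \<in> V) \<Longrightarrow> J \<subseteq> I \<Longrightarrow> l + ind J = x \<Longrightarrow>
                 (l, I) = corner_cube a x I"
    and cone: "\<And>I q. corner_cube a x I \<in> full_cubes V q \<Longrightarrow> j \<notin> I \<Longrightarrow>
                 corner_cube a x (insert j I) \<in> full_cubes V (Suc q)"
    and acyc: "acyclic_set (V - {x})"
  shows "acyclic_set V"
proof -
  let ?C = "corner_cube a x"
  define V' where "V' = V - {x}"
  have corner_in: "x \<in> (\<lambda>J. l + ind J) ` Pow I" if "(l, I) = ?C I" for l I
  proof -
    have "l + ind (if a = 0 then {} else I) = x"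
      using that a by (auto simp: corner_cube_def fun_eq_iff)
    then show ?thesis by (intro image_eqI[of _ _ "if a = 0 then {} else I"]) auto
  qed
  have full_split: "s \<in> full_cubes V' q \<or> (\<exists>I. s = ?C I \<and> finite I)" if s: "s \<in> full_cubes V q" for s q
  proof -
    obtain l I where lI: "s = (l, I)" by (cases s)
    from s lI have fin: "finite I" "card I = q" and V: "\<And>J. J \<subseteq> I \<Longrightarrow> l + ind J \<in> V"
      by (auto simp: full_cubes_def)
    show ?thesis
    proof (cases "\<exists>J\<subseteq>I. l + ind J = x")
      case True
      then show ?thesis using star[of I l] fin V lI by blast
    next
      case False
      then show ?thesis using fin V lI by (auto simp: full_cubes_def V'_def)
    qed
  qed
  have corner_notin: "?C I \<notin> full_cubes V' q" for I q
  proof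
    assume c: "?C I \<in> full_cubes V' q"
    have "x \<in> (\<lambda>J. fst (?C I) + ind J) ` Pow I"
      by (rule corner_in) (simp add: corner_cube_def)
    then obtain J where J: "J \<subseteq> I" "fst (?C I) + ind J = x" by auto
    have "fst (?C I) + ind J \<in> V'"
      using c J(1) by (auto simp: full_cubes_def corner_cube_def)
    then show False using J(2) by (simp add: V'_def)
  qed
  have C_inj: "?C I = ?C J \<Longrightarrow> I = J" for I J by (simp add: corner_cube_def)
  have "\<exists>c. Poly_Mapping.keys c \<subseteq> full_cubes V (Suc q) \<and> bd c = z" if z: "reduced_cycle V q z" for q z
  proof -
    have zk: "Poly_Mapping.keys z \<subseteq> full_cubes V q" and bz: "bd z = 0" and az: "q = 0 \<Longrightarrow> aug z = 0"
      using z by (auto simp: reduced_cycle_def)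
    define N where "N = {I. ?C I \<in> Poly_Mapping.keys z \<and> j \<notin> I}"
    have "finite (?C ` N)" by (rule finite_subset[of _ "Poly_Mapping.keys z"]) (auto simp: N_def)
    then have finN: "finite N" by (rule finite_imageD) (auto simp: inj_on_def dest: C_inj)
    \<comment> \<open>The cube with \<open>j\<close> added has the cube without \<open>j\<close> in
      its boundary with coefficient \<open>(2 * a - 1) * face_sign (insert j I) j\<close>. This is a
      unit of square 1, so multiplying by it again cancels exactly the coefficient of
      \<open>z\<close>.\<close>
    define coef where "coef = (\<lambda>I. (2 * a - 1) * face_sign (insert j I) j * poly_mapping.lookup z (?C I))"
    define c where "c = (\<Sum>I\<in>N. frag_cmul (coef I) (frag_of (?C (insert j I))))"
    have finI: "finite I" if "I \<in> N" for I
      using that zk by (auto simp: N_def full_cubes_def corner_cube_def)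
    have ck: "Poly_Mapping.keys c \<subseteq> full_cubes V (Suc q)"
      unfolding c_def
    proof (rule order.trans[OF keys_sum], rule UN_least)
      fix I assume I: "I \<in> N"
      then have "?C I \<in> full_cubes V q" "j \<notin> I" using zk by (auto simp: N_def)
      then have "?C (insert j I) \<in> full_cubes V (Suc q)" by (rule cone)
      then show "Poly_Mapping.keys (frag_cmul (coef I) (frag_of (?C (insert j I)))) \<subseteq> full_cubes V (Suc q)"
        using keys_cmul[of "coef I" "frag_of (?C (insert j I))"] by (auto simp del: keys_cmul_iff)
    qed
    define z' where "z' = z - bd c"
    have z'k: "Poly_Mapping.keys z' \<subseteq> full_cubes V q"
      unfolding z'_def using keys_bd[OF ck] zk by (simp add: keys_diff_subset)
    have bz': "bd z' = 0" using bd_bd[OF ck] bz by (simp add: z'_def frag_extend_diff)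
    have az': "q = 0 \<Longrightarrow> aug z' = 0"
      using aug_bd[OF ck] az by (simp add: z'_def aug_def frag_extend_diff)
    have bdc: "bd c = (\<Sum>I\<in>N. frag_cmul (coef I) (cube_boundary (?C (insert j I))))"
      unfolding c_def by (simp add: frag_extend_sum finN frag_extend_cmul)
    have no_j: "poly_mapping.lookup z' (?C J) = 0" if "j \<notin> J" for J
    proof -
      have "poly_mapping.lookup (bd c) (?C J) =
        (\<Sum>I\<in>N. coef I * poly_mapping.lookup (cube_boundary (?C (insert j I))) (?C J))"
        unfolding bdc by (simp add: lookup_sum)
      also have "\<dots> = (\<Sum>I\<in>N. if J = I then poly_mapping.lookup z (?C J) else 0)"
      proof (rule sum.cong[OF refl])
        fix I assume I: "I \<in> N"
        then have "insert j I - {j} = I" by (auto simp: N_def)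
        then have "poly_mapping.lookup (cube_boundary (?C (insert j I))) (?C J) =
          (if J = I then (2 * a - 1) * face_sign (insert j I) j else 0)"
          using lookup_boundary_corner[of "insert j I" j J a x] that finI[OF I] a by simp
        moreover have "(2 * a - 1) * face_sign (insert j I) j * ((2 * a - 1) * face_sign (insert j I) j) = 1"
          using a face_sign_cases[of "insert j I" j] by auto
        ultimately show "coef I * poly_mapping.lookup (cube_boundary (?C (insert j I))) (?C J) =
            (if J = I then poly_mapping.lookup z (?C J) else 0)"
          by (auto simp: coef_def)
      qed
      also have "\<dots> = poly_mapping.lookup z (?C J)"
        using finN that by (simp add: N_def in_keys_iff)
      finally show ?thesis by (simp add: z'_def lookup_minus)
    qed
    \<comment> \<open>Compare coefficients of the corner cube on \<open>J - {j}\<close> in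
      \<open>bd z' = 0\<close>. Cubes off the star of \<open>x\<close> do not have it as a face, and
      by \<open>no_j\<close> the remaining cubes of \<open>z'\<close> all contain \<open>j\<close>;
      among these only the one on \<open>J\<close> contributes.\<close>
    have no_C: "poly_mapping.lookup z' (?C J) = 0" if jJ: "j \<in> J" for J
    proof (cases "finite J")
      case False
      then have "?C J \<notin> Poly_Mapping.keys z'" using z'k by (auto simp: full_cubes_def corner_cube_def)
      then show ?thesis by (simp add: in_keys_iff)
    next
      case True
      have "0 = poly_mapping.lookup (bd z') (?C (J - {j}))" using bz' by simp
      also have "\<dots> = (\<Sum>s\<in>Poly_Mapping.keys z'. poly_mapping.lookup z' s *
          poly_mapping.lookup (cube_boundary s) (?C (J - {j})))"
        by (rule lookup_frag_extend)
      also have "\<dots> = (\<Sum>s\<in>Poly_Mapping.keys z'. if s = ?C J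
          then poly_mapping.lookup z' s * ((2 * a - 1) * face_sign J j) else 0)"
      proof (rule sum.cong[OF refl])
        fix s assume s: "s \<in> Poly_Mapping.keys z'"
        show "poly_mapping.lookup z' s * poly_mapping.lookup (cube_boundary s) (?C (J - {j})) =
          (if s = ?C J then poly_mapping.lookup z' s * ((2 * a - 1) * face_sign J j) else 0)"
        proof (cases "s \<in> full_cubes V' q")
          case True
          then have "?C (J - {j}) \<notin> Poly_Mapping.keys (cube_boundary s)"
            using full_cubes_face(1)[of "fst s" "snd s" V' q] corner_notin
            unfolding prod.collapse by blast
          moreover have "s \<noteq> ?C J" using True corner_notin by auto
          ultimately show ?thesis by (simp add: in_keys_iff)
        next
          case False
          then obtain I where I: "s = ?C I" "finite I" using s z'k full_split by blast
          have jI: "j \<in> I" using s I no_j by (auto simp: in_keys_iff)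
          have eq: "J - {j} = I - {j} \<longleftrightarrow> I = J" using jI jJ by auto
          show ?thesis
            using lookup_boundary_corner[of I j "J - {j}" a x] I jI a C_inj[of I J] eq by auto
        qed
      qed
      also have "\<dots> = poly_mapping.lookup z' (?C J) * ((2 * a - 1) * face_sign J j)"
        by (simp add: in_keys_iff)
      finally have "poly_mapping.lookup z' (?C J) * ((2 * a - 1) * face_sign J j) = 0" by simp
      moreover have "(2 * a - 1) * face_sign J j \<noteq> 0" using a by auto
      ultimately show ?thesis by (metis mult_eq_0_iff)
    qed
    have "Poly_Mapping.keys z' \<subseteq> full_cubes V' q"
    proof
      fix s assume s: "s \<in> Poly_Mapping.keys z'"
      then have "s \<noteq> ?C I" for I using no_j no_C by (metis in_keys_iff)
      then show "s \<in> full_cubes V' q" using s z'k full_split by blast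
    qed
    then have "reduced_cycle V' q z'" using bz' az' by (simp add: reduced_cycle_def)
    then obtain c' where c': "Poly_Mapping.keys c' \<subseteq> full_cubes V' (Suc q)" "bd c' = z'"
      using acyc by (auto simp: acyclic_set_def V'_def)
    have "Poly_Mapping.keys (c + c') \<subseteq> full_cubes V (Suc q)"
      using c'(1) ck full_cubes_mono[of V' V "Suc q"] by (intro keys_add_subset) (auto simp: V'_def)
    moreover have "bd (c + c') = z" using c'(2) by (simp add: frag_extend_add z'_def)
    ultimately show ?thesis by blast
  qed
  then show ?thesis using x by (auto simp: acyclic_set_def)
qed

section \<open>Collapses of finite sets of lattice points\<close>

text \<open>Points of \<open>D\<close> are removed starting with a minimal one \<open>x\<close>.
  Since \<open>D\<close> is a lower set of \<open>V\<close>, such an \<open>x\<close> is minimal in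
  \<open>V\<close> and hence the lowest vertex of every cube through it, and the direction from
  \<open>dir\<close> makes its star a cone. The condition \<open>dir\<close> survives the removal,
  because a point above another point of \<open>D\<close> is never \<open>x\<close>. The neighbour
  of \<open>x\<close> in that direction stays behind, which gives the claim on nonemptiness.\<close>

lemma collapse_below:
  assumes "finite V" "D \<subseteq> V"
    and lower: "\<And>x y. x \<in> D \<Longrightarrow> y \<in> V \<Longrightarrow> y \<le> x \<Longrightarrow> y \<in> D"
    and dir: "\<And>x. x \<in> D \<Longrightarrow> \<exists>j. \<forall>J. finite J \<longrightarrow> j \<notin> J \<longrightarrow> x + ind J \<in> V \<longrightarrow> x + ind J + unit_vec j \<in> V"
  shows "(acyclic_set (V - D) \<longrightarrow> acyclic_set V) \<and> (V \<noteq> {} \<longrightarrow> V - D \<noteq> {})"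
  using assms
proof (induction "card D" arbitrary: D V)
  case 0
  have "D = {}" using finite_subset[OF 0(3,2)] 0(1) by simp
  then show ?case by simp
next
  case (Suc n)
  have finD: "finite D" using Suc.prems(1,2) finite_subset by blast
  have "D \<noteq> {}" using Suc.hyps(2) by auto
  then obtain x where x: "x \<in> D" "\<And>y. y \<in> D \<Longrightarrow> y \<le> x \<Longrightarrow> y = x"
    using finite_has_minimal[OF finD] by metis
  have xmin: "y = x" if "y \<in> V" "y \<le> x" for y
    using Suc.prems(3)[OF x(1) that] x(2) that by blast
  obtain j where j: "\<And>J. finite J \<Longrightarrow> j \<notin> J \<Longrightarrow> x + ind J \<in> V \<Longrightarrow> x + ind J + unit_vec j \<in> V"
    using Suc.prems(4)[OF x(1)] by blast
  have step: "acyclic_set V" if "acyclic_set (V - {x})"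
  proof (rule acyclic_set_remove[of 0 x V j])
    show "x \<in> V" using x(1) Suc.prems(2) by auto
    show "(l, I) = corner_cube 0 x I"
      if "finite I" "\<forall>J\<subseteq>I. l + ind J \<in> V" "J \<subseteq> I" "l + ind J = x" for l I J
    proof -
      have "l + ind {} \<in> V" using that(2) by blast
      moreover have "l \<le> x" using that(4) by (auto simp: le_fun_def ind_def)
      ultimately have "l = x" using xmin by simp
      then show ?thesis by (simp add: corner_cube_def)
    qed
    show "corner_cube 0 x (insert j I) \<in> full_cubes V (Suc q)"
      if I: "corner_cube 0 x I \<in> full_cubes V q" "j \<notin> I" for I q
    proof -
      have fin: "finite I" "card I = q" and V: "\<And>J. J \<subseteq> I \<Longrightarrow> x + ind J \<in> V"
        using I(1) by (auto simp: full_cubes_def corner_cube_def)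
      have "x + ind J \<in> V" if J: "J \<subseteq> insert j I" for J
      proof (cases "j \<in> J")
        case False
        then show ?thesis using V J by blast
      next
        case True
        have "x + ind (J - {j}) + unit_vec j \<in> V"
          using J fin(1) by (intro j V) (auto intro: finite_subset)
        then show ?thesis using True by (simp add: ind_remove)
      qed
      then show ?thesis using fin I(2) by (auto simp: full_cubes_def corner_cube_def)
    qed
  qed (use that in auto)
  have "card (D - {x}) = n" using x(1) finD Suc.hyps(2) by simp
  moreover have "\<exists>j. \<forall>J. finite J \<longrightarrow> j \<notin> J \<longrightarrow> y + ind J \<in> V - {x} \<longrightarrow> y + ind J + unit_vec j \<in> V - {x}"
    if y: "y \<in> D - {x}" for y
  proof -
    obtain i where i: "\<forall>J. finite J \<longrightarrow> i \<notin> J \<longrightarrow> y + ind J \<in> V \<longrightarrow> y + ind J + unit_vec i \<in> V"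
      using Suc.prems(4)[of y] y by blast
    have "y + ind J + unit_vec i \<noteq> x" for J
    proof
      assume "y + ind J + unit_vec i = x"
      then have "y \<le> x" by (auto simp: le_fun_def ind_def unit_vec_def)
      then show False using x(2) y by auto
    qed
    then show ?thesis using i by blast
  qed
  ultimately have IH: "(acyclic_set (V - {x} - (D - {x})) \<longrightarrow> acyclic_set (V - {x})) \<and>
      (V - {x} \<noteq> {} \<longrightarrow> V - {x} - (D - {x}) \<noteq> {})"
    using Suc.prems by (intro Suc.hyps(1)) auto
  have eq: "V - {x} - (D - {x}) = V - D" using x(1) by auto
  have "x + ind {} + unit_vec j \<in> V" using x(1) Suc.prems(2) by (intro j) auto
  moreover have "x + ind {} + unit_vec j \<noteq> x" by (auto simp: unit_vec_def fun_eq_iff)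
  ultimately have "V - {x} \<noteq> {}" by blast
  then show ?case using IH step unfolding eq by blast
qed

text \<open>The order-reversed collapse: a maximal point of the upper set \<open>D\<close> is the
  highest vertex of every cube through it, so the corner parameter is 1 and the cone direction
  points downwards.\<close>

lemma collapse_above:
  assumes "finite V" "D \<subseteq> V"
    and upper: "\<And>x y. x \<in> D \<Longrightarrow> y \<in> V \<Longrightarrow> x \<le> y \<Longrightarrow> y \<in> D"
    and dir: "\<And>x. x \<in> D \<Longrightarrow> \<exists>j. \<forall>J. finite J \<longrightarrow> j \<notin> J \<longrightarrow> x - ind J \<in> V \<longrightarrow> x - ind J - unit_vec j \<in> V"
  shows "(acyclic_set (V - D) \<longrightarrow> acyclic_set V) \<and> (V \<noteq> {} \<longrightarrow> V - D \<noteq> {})"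
  using assms
proof (induction "card D" arbitrary: D V)
  case 0
  have "D = {}" using finite_subset[OF 0(3,2)] 0(1) by simp
  then show ?case by simp
next
  case (Suc n)
  have finD: "finite D" using Suc.prems(1,2) finite_subset by blast
  have "D \<noteq> {}" using Suc.hyps(2) by auto
  then obtain x where x: "x \<in> D" "\<And>y. y \<in> D \<Longrightarrow> x \<le> y \<Longrightarrow> y = x"
    using finite_has_maximal[OF finD] by metis
  have xmax: "y = x" if "y \<in> V" "x \<le> y" for y
    using Suc.prems(3)[OF x(1) that] x(2) that by blast
  obtain j where j: "\<And>J. finite J \<Longrightarrow> j \<notin> J \<Longrightarrow> x - ind J \<in> V \<Longrightarrow> x - ind J - unit_vec j \<in> V"
    using Suc.prems(4)[OF x(1)] by blast
  have corner: "corner_cube 1 x I = (x - ind I, I)" for I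
    by (auto simp: corner_cube_def fun_eq_iff)
  have step: "acyclic_set V" if "acyclic_set (V - {x})"
  proof (rule acyclic_set_remove[of 1 x V j])
    show "x \<in> V" using x(1) Suc.prems(2) by auto
    show "(l, I) = corner_cube 1 x I"
      if "finite I" "\<forall>J\<subseteq>I. l + ind J \<in> V" "J \<subseteq> I" "l + ind J = x" for l I J
    proof -
      have "l + ind I \<in> V" using that(2) by blast
      moreover have "x \<le> l + ind I" using that(3,4) by (auto simp: le_fun_def ind_def)
      ultimately have "l + ind I = x" using xmax by simp
      then show ?thesis unfolding corner by auto
    qed
    show "corner_cube 1 x (insert j I) \<in> full_cubes V (Suc q)"
      if I: "corner_cube 1 x I \<in> full_cubes V q" "j \<notin> I" for I q
    proof -
      have fin: "finite I" "card I = q" and V: "\<And>J. J \<subseteq> I \<Longrightarrow> x - ind I + ind J \<in> V"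
        using I(1) unfolding corner by (auto simp: full_cubes_def)
      \<comment> \<open>The vertices of the cube are read from the top: passing to the complement of
        \<open>J\<close> in \<open>I\<close> exchanges adding to the lowest vertex with subtracting
        from \<open>x\<close>.\<close>
      have V': "x - ind J \<in> V" if "J \<subseteq> I" for J
      proof -
        have "x - ind I + ind (I - J) = x - ind J" using that by (auto simp: ind_def fun_eq_iff)
        then show ?thesis using V[OF Diff_subset, of J] by metis
      qed
      have "x - ind (insert j I) + ind J \<in> V" if J: "J \<subseteq> insert j I" for J
      proof (cases "j \<in> J")
        case True
        then have "x - ind (insert j I) + ind J = x - ind (insert j I - J)"
          using J by (auto simp: ind_def fun_eq_iff)
        moreover have "insert j I - J \<subseteq> I" using True by auto
        ultimately show ?thesis using V' by metis
      next
        case False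
        then have "x - ind (insert j I) + ind J = x - ind (I - J) - unit_vec j"
          using J I(2) by (auto simp: ind_def fun_eq_iff unit_vec_def)
        moreover have "x - ind (I - J) - unit_vec j \<in> V"
          using I(2) fin(1) by (intro j V') auto
        ultimately show ?thesis by metis
      qed
      then show ?thesis unfolding corner using fin I(2) by (auto simp: full_cubes_def)
    qed
  qed (use that in auto)
  have "card (D - {x}) = n" using x(1) finD Suc.hyps(2) by simp
  moreover have "\<exists>j. \<forall>J. finite J \<longrightarrow> j \<notin> J \<longrightarrow> y - ind J \<in> V - {x} \<longrightarrow> y - ind J - unit_vec j \<in> V - {x}"
    if y: "y \<in> D - {x}" for y
  proof -
    obtain i where i: "\<forall>J. finite J \<longrightarrow> i \<notin> J \<longrightarrow> y - ind J \<in> V \<longrightarrow> y - ind J - unit_vec i \<in> V"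
      using Suc.prems(4)[of y] y by blast
    have "y - ind J - unit_vec i \<noteq> x" for J
    proof
      assume "y - ind J - unit_vec i = x"
      then have "x \<le> y" by (auto simp: le_fun_def ind_def unit_vec_def)
      then show False using x(2) y by auto
    qed
    then show ?thesis using i by blast
  qed
  ultimately have IH: "(acyclic_set (V - {x} - (D - {x})) \<longrightarrow> acyclic_set (V - {x})) \<and>
      (V - {x} \<noteq> {} \<longrightarrow> V - {x} - (D - {x}) \<noteq> {})"
    using Suc.prems by (intro Suc.hyps(1)) auto
  have eq: "V - {x} - (D - {x}) = V - D" using x(1) by auto
  have "x - ind {} - unit_vec j \<in> V" using x(1) Suc.prems(2) by (intro j) auto
  moreover have "x - ind {} - unit_vec j \<noteq> x" by (auto simp: unit_vec_def fun_eq_iff)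
  ultimately have "V - {x} \<noteq> {}" by blast
  then show ?case using IH step unfolding eq by blast
qed

section \<open>Duals of weight-nonincreasing chain maps\<close>

lemma T0_scale_add_right: "p \<cdot> (x + y) = p \<cdot> x + p \<cdot> y"
  by transfer (simp add: algebra_simps UZU_0)

lemma T0_scale_add_left: "(p + q) \<cdot> x = p \<cdot> x + q \<cdot> x"
  by transfer (simp add: algebra_simps UZU_0 laurent_of_add)

lemma T0_scale_scale: "p \<cdot> q \<cdot> x = (p * q) \<cdot> x"
  by transfer (simp add: laurent_of_mult mult.assoc UZU_0)

lemma T0_scale_zero_left [simp]: "0 \<cdot> x = 0"
  using T0_scale_add_left[of 0 0 x] by simp

lemma T0_scale_zero_right [simp]: "p \<cdot> 0 = 0"
  using T0_scale_add_right[of p 0 0] by simp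

lemma T0_scale_one [simp]: "1 \<cdot> x = x"
  by transfer (simp add: laurent_of_def UZU_0)

lemma T0_scale_one' [simp]: "[:1:] \<cdot> x = x"
  by (simp flip: one_pCons)

lemma T0_scale_sum: "p \<cdot> (\<Sum>i\<in>A. f i) = (\<Sum>i\<in>A. p \<cdot> f i)"
  by (induction A rule: infinite_finite_induct) (simp_all add: T0_scale_add_right)

lemma laurent_of_monom: "laurent_of (Polynomial.monom a e) = Poly_Mapping.single (int e) a"
proof (induction e)
  case 0
  then show ?case by (simp add: monom_0 laurent_of_pCons laurent_of_0 single_of_int[symmetric])
next
  case (Suc e)
  then show ?case by (simp add: monom_Suc laurent_of_pCons laurent_U_def mult_single)
qed

text \<open>\<open>T0_homog m\<close> is empty for odd \<open>m\<close> and then lacks 0. Adjoining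
  0 gives a set closed under sums and absorbs the clause on nonzero values in the degree of a
  cochain.\<close>

definition T0_homog0 :: "int \<Rightarrow> T0 set" where
  "T0_homog0 m = insert 0 (T0_homog m)"

lemma T0_homog0_add:
  assumes "x \<in> T0_homog0 m" "y \<in> T0_homog0 m"
  shows "x + y \<in> T0_homog0 m"
proof (cases "x = 0 \<or> y = 0")
  case True
  then show ?thesis using assms by auto
next
  case False
  then obtain c d e where "m = 2 * d" "x = abs_T0 (Poly_Mapping.single (- d) c)"
      "y = abs_T0 (Poly_Mapping.single (- d) e)"
    using assms by (auto simp: T0_homog0_def T0_homog_def)
  then show ?thesis
    by (auto simp: T0_homog0_def T0_homog_def plus_T0.abs_eq single_add[symmetric])
qed

lemma T0_homog0_sum:
  "(\<And>i. i \<in> A \<Longrightarrow> f i \<in> T0_homog0 m) \<Longrightarrow> sum f A \<in> T0_homog0 m"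
proof (induction A rule: infinite_finite_induct)
  case (insert i A)
  then show ?case by (simp add: T0_homog0_add)
qed (simp_all add: T0_homog0_def)

text \<open>Multiplication by the \<open>e\<close>-th power of \<open>U\<close> replaces the
  exponent \<open>- d\<close> by \<open>e - d\<close>. When this becomes positive the class is zero,
  and \<open>T0_homog\<close> covers that case because its \<open>d\<close> may be negative.\<close>

lemma T0_homog0_monom:
  assumes "x \<in> T0_homog0 m"
  shows "Polynomial.monom a e \<cdot> x \<in> T0_homog0 (m - 2 * int e)"
proof (cases "x = 0")
  case True
  then show ?thesis by (simp add: T0_homog0_def)
next
  case False
  then obtain c d where "m = 2 * d" "x = abs_T0 (Poly_Mapping.single (- d) c)"
    using assms by (auto simp: T0_homog0_def T0_homog_def)
  then have "Polynomial.monom a e \<cdot> x = abs_T0 (Poly_Mapping.single (- (d - int e)) (a * c))"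
      "m - 2 * int e = 2 * (d - int e)"
    by (auto simp: T0_scale.abs_eq laurent_of_monom mult_single)
  then show ?thesis unfolding T0_homog0_def T0_homog_def by blast
qed

text \<open>Evaluation of \<psi> on a chain at level \<open>n\<close>, each cube being shifted by
  the power of \<open>U\<close> that makes up for its weight. The truncation by \<open>nat\<close>
  is harmless for cubes of weight at most \<open>n\<close>; with \<open>w\<close> and
  \<open>n\<close> zero this is plain linear extension.\<close>

definition weighted_eval :: "('a \<Rightarrow> T0) \<Rightarrow> ('a \<Rightarrow> int) \<Rightarrow> int \<Rightarrow> ('a \<Rightarrow>\<^sub>0 int) \<Rightarrow> T0" where
  "weighted_eval \<psi> w n c = (\<Sum>f\<in>Poly_Mapping.keys c.
     Polynomial.monom (poly_mapping.lookup c f) (nat (n - w f)) \<cdot> \<psi> f)"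

lemma weighted_eval_superset:
  assumes "finite A" "Poly_Mapping.keys c \<subseteq> A"
  shows "weighted_eval \<psi> w n c = (\<Sum>f\<in>A. Polynomial.monom (poly_mapping.lookup c f) (nat (n - w f)) \<cdot> \<psi> f)"
  unfolding weighted_eval_def
  by (rule sum.mono_neutral_left) (use assms in \<open>auto simp: in_keys_iff\<close>)

lemma weighted_eval_zero [simp]: "weighted_eval \<psi> w n 0 = 0"
  by (simp add: weighted_eval_def)

lemma weighted_eval_of: "weighted_eval \<psi> w n (frag_of f) = Polynomial.monom 1 (nat (n - w f)) \<cdot> \<psi> f"
  by (simp add: weighted_eval_def)

lemma weighted_eval_add: "weighted_eval \<psi> w n (c + d) = weighted_eval \<psi> w n c + weighted_eval \<psi> w n d"
proof -
  let ?A = "Poly_Mapping.keys c \<union> Poly_Mapping.keys d"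
  have k: "Poly_Mapping.keys (c + d) \<subseteq> ?A" by (rule Poly_Mapping.keys_add)
  show ?thesis
    using k by (simp add: weighted_eval_superset[of ?A] lookup_add add_monom[symmetric]
      T0_scale_add_left sum.distrib)
qed

lemma weighted_eval_minus: "weighted_eval \<psi> w n (- c) = - weighted_eval \<psi> w n c"
  using weighted_eval_add[of \<psi> w n c "- c"] by (simp add: eq_neg_iff_add_eq_0 add.commute)

lemma weighted_eval_diff: "weighted_eval \<psi> w n (c - d) = weighted_eval \<psi> w n c - weighted_eval \<psi> w n d"
  using weighted_eval_add[of \<psi> w n c "- d"] by (simp add: weighted_eval_minus)

text \<open>The exponents telescope, \<open>(n - w f) + (w f - v h) = n - v h\<close>. Both
  differences must be nonnegative to survive \<open>nat\<close>, and this is where weights not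
  increasing along \<open>F\<close> enters the dualization.\<close>

lemma weighted_eval_frag_extend:
  assumes "\<And>f. f \<in> Poly_Mapping.keys c \<Longrightarrow> w f \<le> n"
    and "\<And>f h. f \<in> Poly_Mapping.keys c \<Longrightarrow> h \<in> Poly_Mapping.keys (F f) \<Longrightarrow> v h \<le> w f"
  shows "weighted_eval (\<lambda>f. weighted_eval \<psi> v (w f) (F f)) w n c = weighted_eval \<psi> v n (frag_extend F c)"
proof -
  \<comment> \<open>Cancellation can shrink the support of \<open>frag_extend F c\<close>, so all
    sums run over this common superset of supports.\<close>
  define A where "A = (\<Union>f\<in>Poly_Mapping.keys c. Poly_Mapping.keys (F f))"
  have finA: "finite A" by (simp add: A_def)
  have "weighted_eval (\<lambda>f. weighted_eval \<psi> v (w f) (F f)) w n c =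
     (\<Sum>f\<in>Poly_Mapping.keys c. \<Sum>h\<in>A.
       Polynomial.monom (poly_mapping.lookup c f * poly_mapping.lookup (F f) h) (nat (n - v h)) \<cdot> \<psi> h)"
    unfolding weighted_eval_def[of _ w]
  proof (rule sum.cong[OF refl])
    fix f assume f: "f \<in> Poly_Mapping.keys c"
    have "Polynomial.monom (poly_mapping.lookup c f) (nat (n - w f)) \<cdot>
        Polynomial.monom (poly_mapping.lookup (F f) h) (nat (w f - v h)) \<cdot> \<psi> h =
       Polynomial.monom (poly_mapping.lookup c f * poly_mapping.lookup (F f) h) (nat (n - v h)) \<cdot> \<psi> h" for h
    proof (cases "h \<in> Poly_Mapping.keys (F f)")
      case True
      then have "nat (n - w f) + nat (w f - v h) = nat (n - v h)"
        using assms(1)[OF f] assms(2)[OF f True] by simp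
      then show ?thesis by (simp add: T0_scale_scale mult_monom)
    next
      case False
      then show ?thesis by (simp add: in_keys_iff)
    qed
    moreover have "weighted_eval \<psi> v (w f) (F f) =
        (\<Sum>h\<in>A. Polynomial.monom (poly_mapping.lookup (F f) h) (nat (w f - v h)) \<cdot> \<psi> h)"
      by (rule weighted_eval_superset[OF finA]) (use f in \<open>auto simp: A_def\<close>)
    ultimately show "Polynomial.monom (poly_mapping.lookup c f) (nat (n - w f)) \<cdot> weighted_eval \<psi> v (w f) (F f) =
      (\<Sum>h\<in>A. Polynomial.monom (poly_mapping.lookup c f * poly_mapping.lookup (F f) h) (nat (n - v h)) \<cdot> \<psi> h)"
      by (simp add: T0_scale_sum)
  qed
  also have "\<dots> = (\<Sum>h\<in>A. \<Sum>f\<in>Poly_Mapping.keys c.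
       Polynomial.monom (poly_mapping.lookup c f * poly_mapping.lookup (F f) h) (nat (n - v h)) \<cdot> \<psi> h)"
    by (rule sum.swap)
  also have "\<dots> = (\<Sum>h\<in>A. Polynomial.monom (poly_mapping.lookup (frag_extend F c) h) (nat (n - v h)) \<cdot> \<psi> h)"
  proof (rule sum.cong[OF refl])
    fix h
    have "(\<Sum>f\<in>S. Polynomial.monom (k f) e \<cdot> x) = Polynomial.monom (\<Sum>f\<in>S. k f) e \<cdot> x"
      for S :: "'a set" and k e x
      by (induction S rule: infinite_finite_induct) (simp_all add: add_monom[symmetric] T0_scale_add_left)
    then show "(\<Sum>f\<in>Poly_Mapping.keys c.
       Polynomial.monom (poly_mapping.lookup c f * poly_mapping.lookup (F f) h) (nat (n - v h)) \<cdot> \<psi> h) =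
      Polynomial.monom (poly_mapping.lookup (frag_extend F c) h) (nat (n - v h)) \<cdot> \<psi> h"
      by (simp add: lookup_frag_extend)
  qed
  also have "\<dots> = weighted_eval \<psi> v n (frag_extend F c)"
    by (rule weighted_eval_superset[symmetric, OF finA])
      (use keys_frag_extend[of F c] in \<open>auto simp: A_def\<close>)
  finally show ?thesis .
qed

lemma weighted_eval_cong:
  "(\<And>f. f \<in> Poly_Mapping.keys c \<Longrightarrow> \<psi> f = \<psi>' f) \<Longrightarrow> weighted_eval \<psi> w n c = weighted_eval \<psi>' w n c"
  by (simp add: weighted_eval_def)

lemma weighted_eval_add_fun:
  "weighted_eval (\<lambda>f. \<psi> f + \<psi>' f) w n c = weighted_eval \<psi> w n c + weighted_eval \<psi>' w n c"
  by (simp add: weighted_eval_def T0_scale_add_right sum.distrib)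

lemma weighted_eval_zero_fun [simp]: "weighted_eval (\<lambda>f. 0) w n c = 0"
  by (simp add: weighted_eval_def)

lemma weighted_eval_scale:
  "weighted_eval (\<lambda>f. p \<cdot> \<psi> f) w n c = p \<cdot> weighted_eval \<psi> w n c"
  by (simp add: weighted_eval_def T0_scale_sum T0_scale_scale mult.commute)

lemma weighted_eval_homog:
  assumes "\<And>f. f \<in> Poly_Mapping.keys c \<Longrightarrow> w f \<le> n"
    and "\<And>f. f \<in> Poly_Mapping.keys c \<Longrightarrow> \<psi> f \<in> T0_homog0 (m - 2 * w f)"
  shows "weighted_eval \<psi> w n c \<in> T0_homog0 (m - 2 * n)"
  unfolding weighted_eval_def
proof (rule T0_homog0_sum)
  fix f assume f: "f \<in> Poly_Mapping.keys c"
  have "m - 2 * w f - 2 * int (nat (n - w f)) = m - 2 * n" using assms(1)[OF f] by simp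
  then show "Polynomial.monom (poly_mapping.lookup c f) (nat (n - w f)) \<cdot> \<psi> f \<in> T0_homog0 (m - 2 * n)"
    using T0_homog0_monom[OF assms(2)[OF f]] by metis
qed

section \<open>Cochains as functions on cubes, and duals of chain maps\<close>

lemma chains_iff: "c \<in> chains T q \<longleftrightarrow> Poly_Mapping.keys c \<subseteq> cubes T q"
  by (simp add: free_Abelian_group_def)

definition cochain_of :: "('v \<Rightarrow> real) set \<Rightarrow> nat \<Rightarrow> ('v cube \<Rightarrow> T0) \<Rightarrow> ('v cube \<Rightarrow>\<^sub>0 int) \<Rightarrow> T0" where
  "cochain_of T q \<psi> = (\<lambda>c. if c \<in> chains T q then weighted_eval \<psi> (\<lambda>_. 0) 0 c else 0)"

lemma cochain_of_frag_of: "s \<in> cubes T q \<Longrightarrow> cochain_of T q \<psi> (frag_of s) = \<psi> s"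
  by (simp add: cochain_of_def chains_iff weighted_eval_of monom_0)

lemma cochain_of_in: "cochain_of T q \<psi> \<in> cochains T q"
  using Poly_Mapping.keys_add
  by (fastforce simp: cochains_def cochain_of_def chains_iff weighted_eval_add)

lemma cochain_of_cong: "(\<And>s. s \<in> cubes T q \<Longrightarrow> \<psi> s = \<psi>' s) \<Longrightarrow> cochain_of T q \<psi> = cochain_of T q \<psi>'"
  by (auto simp: cochain_of_def chains_iff fun_eq_iff intro!: weighted_eval_cong)

lemma cochain_of_eval:
  assumes "\<phi> \<in> cochains T q"
  shows "cochain_of T q (\<lambda>s. \<phi> (frag_of s)) = \<phi>"
proof
  fix c
  have add: "\<phi> (a + b) = \<phi> a + \<phi> b" if "Poly_Mapping.keys a \<subseteq> cubes T q" "Poly_Mapping.keys b \<subseteq> cubes T q" for a b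
    using assms that by (auto simp: cochains_def chains_iff)
  have zero: "\<phi> 0 = 0" using add[of 0 0] by simp
  have diff: "\<phi> (a - b) = \<phi> a - \<phi> b" if "Poly_Mapping.keys a \<subseteq> cubes T q" "Poly_Mapping.keys b \<subseteq> cubes T q" for a b
    using add[of "a - b" b] keys_diff_subset[OF that] that by simp
  show "cochain_of T q (\<lambda>s. \<phi> (frag_of s)) c = \<phi> c"
  proof (cases "c \<in> chains T q")
    case False
    then show ?thesis using assms by (auto simp: cochain_of_def cochains_def)
  next
    case True
    then have "Poly_Mapping.keys c \<subseteq> cubes T q" by (simp add: chains_iff)
    then have "Poly_Mapping.keys c \<subseteq> cubes T q \<and> weighted_eval (\<lambda>s. \<phi> (frag_of s)) (\<lambda>_. 0) 0 c = \<phi> c"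
    proof (induction c rule: frag_induction)
      case (diff a b)
      then show ?case by (simp add: weighted_eval_diff \<open>\<And>b a. _ \<Longrightarrow> _ \<Longrightarrow> \<phi> (a - b) = _\<close> keys_diff_subset)
    qed (auto simp: zero weighted_eval_of monom_0)
    then show ?thesis using True by (simp add: cochain_of_def)
  qed
qed

text \<open>The cochain map dual to the chain map sending a cube \<open>s\<close> to \<open>F s\<close>; the cubes of its source are weighted by \<open>w\<close>, those of its target by \<open>v\<close>.\<close>

definition pullback :: "('v \<Rightarrow> real) set \<Rightarrow> nat \<Rightarrow> ('v cube \<Rightarrow> int) \<Rightarrow> ('v cube \<Rightarrow> int) \<Rightarrow>
    ('v cube \<Rightarrow> 'v cube \<Rightarrow>\<^sub>0 int) \<Rightarrow> (('v cube \<Rightarrow>\<^sub>0 int) \<Rightarrow> T0) \<Rightarrow> ('v cube \<Rightarrow>\<^sub>0 int) \<Rightarrow> T0" where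
  "pullback T q w v F \<phi> = cochain_of T q (\<lambda>s. weighted_eval (\<lambda>t. \<phi> (frag_of t)) v (w s) (F s))"

text \<open>Viewing the differential as the dual of the boundary lets one composition rule serve for
  \<open>delta\<close> squaring to zero, for compatibility with chain maps and for
  homotopies.\<close>

lemma delta_eq_pullback:
  "delta T w\<^sub>0 q = pullback T (Suc q) (cube_weight w\<^sub>0) (cube_weight w\<^sub>0) cube_boundary"
  by (auto simp: delta_def pullback_def cochain_of_def delta_cube_def weighted_eval_def monom_0 fun_eq_iff)

lemma pullback_in: "pullback T q w v F \<phi> \<in> cochains T q"
  by (simp add: pullback_def cochain_of_in)

lemma pullback_cong:
  "(\<And>s. s \<in> cubes T q \<Longrightarrow> F s = F' s) \<Longrightarrow> pullback T q w v F \<phi> = pullback T q w v F' \<phi>"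
  unfolding pullback_def by (rule cochain_of_cong) simp

lemma pullback_add: "pullback T q w v F (\<phi> + \<phi>') = pullback T q w v F \<phi> + pullback T q w v F \<phi>'"
  by (auto simp: pullback_def cochain_of_def weighted_eval_add_fun fun_eq_iff)

lemma pullback_scale: "pullback T q w v F (\<lambda>c. p \<cdot> \<phi> c) = (\<lambda>c. p \<cdot> pullback T q w v F \<phi> c)"
  by (auto simp: pullback_def cochain_of_def weighted_eval_scale fun_eq_iff)

lemma pullback_zero: "pullback T q w v F 0 = 0"
  by (auto simp: pullback_def cochain_of_def fun_eq_iff)

lemma pullback_add_chain:
  "pullback T q w v (\<lambda>s. F s + F' s) \<phi> = pullback T q w v F \<phi> + pullback T q w v F' \<phi>"
  by (auto simp: pullback_def cochain_of_def weighted_eval_add_fun weighted_eval_add fun_eq_iff)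

lemma pullback_zero_chain: "pullback T q w v (\<lambda>s. 0) \<phi> = 0"
  by (auto simp: pullback_def cochain_of_def fun_eq_iff)

lemma pullback_frag_of:
  "\<phi> \<in> cochains T q \<Longrightarrow> pullback T q w w frag_of \<phi> = \<phi>"
  by (simp add: pullback_def weighted_eval_of monom_0 cochain_of_eval)

text \<open>Contravariant functoriality; the weight bounds are those that make the exponents of
  \<open>U\<close> telescope.\<close>

lemma pullback_pullback:
  assumes "\<And>s. s \<in> cubes T q \<Longrightarrow> Poly_Mapping.keys (F s) \<subseteq> cubes T' q'"
    and "\<And>s t. s \<in> cubes T q \<Longrightarrow> t \<in> Poly_Mapping.keys (F s) \<Longrightarrow> w' t \<le> w s"
    and "\<And>s t. s \<in> cubes T' q' \<Longrightarrow> t \<in> Poly_Mapping.keys (G s) \<Longrightarrow> w'' t \<le> w' s"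
  shows "pullback T q w w' F (pullback T' q' w' w'' G \<phi>) =
    pullback T q w w'' (\<lambda>s. frag_extend G (F s)) \<phi>"
  unfolding pullback_def
proof (rule cochain_of_cong)
  fix s assume s: "s \<in> cubes T q"
  let ?\<psi> = "\<lambda>t. weighted_eval (\<lambda>t. \<phi> (frag_of t)) w'' (w' t) (G t)"
  have "weighted_eval (\<lambda>t. cochain_of T' q' ?\<psi> (frag_of t)) w' (w s) (F s) = weighted_eval ?\<psi> w' (w s) (F s)"
    by (rule weighted_eval_cong) (use assms(1)[OF s] in \<open>auto intro!: cochain_of_frag_of\<close>)
  also have "\<dots> = weighted_eval (\<lambda>t. \<phi> (frag_of t)) w'' (w s) (frag_extend G (F s))"
    using assms(1)[OF s] by (intro weighted_eval_frag_extend assms(2)[OF s] assms(3)) auto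
  finally show "weighted_eval (\<lambda>t. cochain_of T' q' ?\<psi> (frag_of t)) w' (w s) (F s) =
    weighted_eval (\<lambda>t. \<phi> (frag_of t)) w'' (w s) (frag_extend G (F s))" .
qed

lemma homog_cochain_module:
  "\<phi> \<in> homog (cochain_module T w\<^sub>0 q) m \<longleftrightarrow> \<phi> \<in> cochains T q \<and>
     (\<forall>s\<in>cubes T q. \<phi> (frag_of s) \<in> T0_homog0 (m - 2 * cube_weight w\<^sub>0 s))"
  by (auto simp: cochain_module_def T0_homog0_def)

text \<open>The power of \<open>U\<close> attached to a target cube compensates exactly for the
  difference between the degree shifts of the two cubes, so the dual preserves degrees.\<close>

lemma pullback_homog:
  assumes "\<And>s. s \<in> cubes T q \<Longrightarrow> Poly_Mapping.keys (F s) \<subseteq> cubes T' q'"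
    and "\<And>s t. s \<in> cubes T q \<Longrightarrow> t \<in> Poly_Mapping.keys (F s) \<Longrightarrow> cube_weight w' t \<le> cube_weight w s"
    and "\<phi> \<in> homog (cochain_module T' w' q') m"
  shows "pullback T q (cube_weight w) (cube_weight w') F \<phi> \<in> homog (cochain_module T w q) m"
  unfolding homog_cochain_module
proof (intro conjI ballI pullback_in)
  fix s assume s: "s \<in> cubes T q"
  show "pullback T q (cube_weight w) (cube_weight w') F \<phi> (frag_of s) \<in> T0_homog0 (m - 2 * cube_weight w s)"
    unfolding pullback_def cochain_of_frag_of[OF s]
    using assms(1)[OF s] assms(3)
    by (intro weighted_eval_homog assms(2)[OF s]) (auto simp: homog_cochain_module)
qed

text \<open>The map induced by \<open>a\<close> is inverted by \<open>b\<close>. Surjectivity, also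
  on each homogeneous part, comes from the strict identity \<open>a (b y) = y\<close>. For
  injectivity, \<open>b\<close> sends \<open>a x - a y\<close> into \<open>N\<close>, and
  \<open>b (a x)\<close> differs from \<open>x\<close> by an element of \<open>N\<close>. Addition
  being \<open>(+)\<close>, cosets are ordinary translates.\<close>

lemma graded_quotient_isomorphic:
  fixes M :: "('r, 'a::ab_group_add) graded_module" and M' :: "('r, 'b::ab_group_add) graded_module"
  assumes add: "ring.add M = (+)" "ring.add M' = (+)"
    and Z: "\<And>x y. x \<in> carrier M \<Longrightarrow> y \<in> carrier M \<Longrightarrow> x + y \<in> carrier M"
    and N: "N \<subseteq> carrier M" "0 \<in> N" "\<And>x y. x \<in> N \<Longrightarrow> y \<in> N \<Longrightarrow> x - y \<in> N"
    and N': "0 \<in> N'" "\<And>x y. x \<in> N' \<Longrightarrow> y \<in> N' \<Longrightarrow> x - y \<in> N'"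
    and sm: "\<And>p x. p \<in> carrier R \<Longrightarrow> x \<in> carrier M \<Longrightarrow> p \<odot>\<^bsub>M\<^esub> x \<in> carrier M"
       "\<And>p x. x \<in> N \<Longrightarrow> p \<odot>\<^bsub>M\<^esub> x \<in> N" "\<And>p x y. p \<odot>\<^bsub>M\<^esub> (x + y) = p \<odot>\<^bsub>M\<^esub> x + p \<odot>\<^bsub>M\<^esub> y"
       "\<And>p x. x \<in> N' \<Longrightarrow> p \<odot>\<^bsub>M'\<^esub> x \<in> N'" "\<And>p x y. p \<odot>\<^bsub>M'\<^esub> (x + y) = p \<odot>\<^bsub>M'\<^esub> x + p \<odot>\<^bsub>M'\<^esub> y"
    and a: "\<And>x. x \<in> carrier M \<Longrightarrow> a x \<in> carrier M'" "\<And>x y. a (x + y) = a x + a y"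
       "\<And>x. x \<in> N \<Longrightarrow> a x \<in> N'" "\<And>p x. a (p \<odot>\<^bsub>M\<^esub> x) = p \<odot>\<^bsub>M'\<^esub> a x"
       "\<And>m x. x \<in> homog M m \<Longrightarrow> a x \<in> homog M' m"
    and b: "\<And>x. x \<in> carrier M' \<Longrightarrow> b x \<in> carrier M" "\<And>x y. b (x + y) = b x + b y"
       "\<And>x. x \<in> N' \<Longrightarrow> b x \<in> N" "\<And>m x. x \<in> homog M' m \<Longrightarrow> b x \<in> homog M m"
    and ab: "\<And>y. y \<in> carrier M' \<Longrightarrow> a (b y) = y" and ba: "\<And>x. x \<in> carrier M \<Longrightarrow> b (a x) - x \<in> N"
    and hom: "\<And>m. homog M m \<subseteq> carrier M" "\<And>m. homog M' m \<subseteq> carrier M'"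
  shows "graded_isomorphic R (graded_quotient M N) (graded_quotient M' N')"
proof -
  let ?C = "\<lambda>x. N +>\<^bsub>M\<^esub> x" and ?C' = "\<lambda>x. N' +>\<^bsub>M'\<^esub> x"
  have C: "?C x = (\<lambda>h. h + x) ` N" for x by (auto simp: a_r_coset_def r_coset_def add)
  have C': "?C' x = (\<lambda>h. h + x) ` N'" for x by (auto simp: a_r_coset_def r_coset_def add)
  have eqI: "(\<lambda>h. h + x) ` N = (\<lambda>h. h + y) ` N \<longleftrightarrow> x - y \<in> N"
    if zero: "0 \<in> N" and diff: "\<And>x y. x \<in> N \<Longrightarrow> y \<in> N \<Longrightarrow> x - y \<in> N" for N :: "'c::ab_group_add set" and x y
  proof
    assume "(\<lambda>h. h + x) ` N = (\<lambda>h. h + y) ` N"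
    then have "0 + x \<in> (\<lambda>h. h + y) ` N" using zero by blast
    then show "x - y \<in> N" by auto
  next
    have sub: "(\<lambda>h. h + x) ` N \<subseteq> (\<lambda>h. h + y) ` N" if d: "x - y \<in> N" for x y
    proof
      fix z assume "z \<in> (\<lambda>h. h + x) ` N"
      then obtain h where h: "h \<in> N" "z = h + x" by auto
      have "h - (0 - (x - y)) \<in> N" by (intro diff h(1) zero d)
      moreover have "z = (h - (0 - (x - y))) + y" using h(2) by (simp add: algebra_simps)
      ultimately show "z \<in> (\<lambda>h. h + y) ` N" by blast
    qed
    assume d: "x - y \<in> N"
    then have "0 - (x - y) \<in> N" by (rule diff[OF zero])
    then show "(\<lambda>h. h + x) ` N = (\<lambda>h. h + y) ` N" using sub[of x y] sub[of y x] d by auto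
  qed
  have Ceq: "?C x = ?C y \<longleftrightarrow> x - y \<in> N" for x y unfolding C by (rule eqI) (use N in auto)
  have C'eq: "?C' x = ?C' y \<longleftrightarrow> x - y \<in> N'" for x y unfolding C' by (rule eqI) (use N' in auto)
  define \<Phi> where "\<Phi> X = (\<Union>x\<in>X. ?C' (a x))" for X
  have \<Phi>: "\<Phi> (?C x) = ?C' (a x)" for x
  proof -
    have "?C' (a y) = ?C' (a x)" if "y \<in> ?C x" for y
      unfolding C'eq using that a(2,3) by (auto simp: C)
    moreover have "x \<in> ?C x" using N(2) unfolding C by force
    ultimately show ?thesis unfolding \<Phi>_def by blast
  qed
  have car: "carrier (graded_quotient M N) = ?C ` carrier M"
      "carrier (graded_quotient M' N') = ?C' ` carrier M'"
    by (auto simp: graded_quotient_def A_RCOSETS_def RCOSETS_def a_r_coset_def)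
  have set_add_eq: "(\<Union>h\<in>(\<lambda>h. h + x) ` N. \<Union>k\<in>(\<lambda>h. h + y) ` N. {h + k}) = (\<lambda>h. h + (x + y)) ` N" (is "?L = ?R")
    if "0 \<in> N" "\<And>x y. x \<in> N \<Longrightarrow> y \<in> N \<Longrightarrow> x - y \<in> N" for N :: "'c::ab_group_add set" and x y
  proof
    show "?L \<subseteq> ?R"
    proof
      fix z assume "z \<in> ?L"
      then obtain h k where hk: "h \<in> N" "k \<in> N" "z = h + x + (k + y)" by auto
      have "h - (0 - k) \<in> N" using hk that by blast
      moreover have "z = h - (0 - k) + (x + y)" using hk by (simp add: algebra_simps)
      ultimately show "z \<in> ?R" by blast
    qed
    show "?R \<subseteq> ?L"
    proof
      fix z assume "z \<in> ?R"
      then obtain h where "h \<in> N" "z = (h + x) + (0 + y)" by (auto simp: algebra_simps)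
      then show "z \<in> ?L" using \<open>0 \<in> N\<close> by blast
    qed
  qed
  have Cadd: "?C x \<oplus>\<^bsub>graded_quotient M N\<^esub> ?C y = ?C (x + y)" for x y
  proof -
    have "?C x \<oplus>\<^bsub>graded_quotient M N\<^esub> ?C y = (\<Union>h\<in>?C x. \<Union>k\<in>?C y. {h + k})"
      by (simp add: graded_quotient_def set_add_def set_mult_def add)
    then show ?thesis unfolding C by (simp only: set_add_eq[OF N(2,3)])
  qed
  have C'add: "?C' x \<oplus>\<^bsub>graded_quotient M' N'\<^esub> ?C' y = ?C' (x + y)" for x y
  proof -
    have "?C' x \<oplus>\<^bsub>graded_quotient M' N'\<^esub> ?C' y = (\<Union>h\<in>?C' x. \<Union>k\<in>?C' y. {h + k})"
      by (simp add: graded_quotient_def set_add_def set_mult_def add)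
    then show ?thesis unfolding C' by (simp only: set_add_eq[OF N'])
  qed
  have Csm: "p \<odot>\<^bsub>graded_quotient M N\<^esub> ?C x = ?C (p \<odot>\<^bsub>M\<^esub> x)" for p x
  proof -
    have "?C (p \<odot>\<^bsub>M\<^esub> y) = ?C (p \<odot>\<^bsub>M\<^esub> x)" if "y \<in> ?C x" for y
      unfolding Ceq using that sm(2,3) by (auto simp: C)
    moreover have "x \<in> ?C x" using N(2) unfolding C by force
    moreover have "p \<odot>\<^bsub>graded_quotient M N\<^esub> ?C x = (\<Union>y\<in>?C x. ?C (p \<odot>\<^bsub>M\<^esub> y))"
      by (simp add: graded_quotient_def)
    ultimately show ?thesis by blast
  qed
  have C'sm: "p \<odot>\<^bsub>graded_quotient M' N'\<^esub> ?C' x = ?C' (p \<odot>\<^bsub>M'\<^esub> x)" for p x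
  proof -
    have "?C' (p \<odot>\<^bsub>M'\<^esub> y) = ?C' (p \<odot>\<^bsub>M'\<^esub> x)" if "y \<in> ?C' x" for y
      unfolding C'eq using that sm(4,5) by (auto simp: C')
    moreover have "x \<in> ?C' x" using N'(1) unfolding C' by force
    moreover have "p \<odot>\<^bsub>graded_quotient M' N'\<^esub> ?C' x = (\<Union>y\<in>?C' x. ?C' (p \<odot>\<^bsub>M'\<^esub> y))"
      by (simp add: graded_quotient_def)
    ultimately show ?thesis by blast
  qed
  have homogq: "homog (graded_quotient M N) m = ?C ` homog M m"
      "homog (graded_quotient M' N') m = ?C' ` homog M' m" for m
    by (simp_all add: graded_quotient_def)
  have bdiff: "b (x - y) = b x - b y" for x y
    using b(2)[of "x - y" y] by simp
  have inj: "inj_on \<Phi> (?C ` carrier M)"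
  proof (rule inj_onI, clarsimp simp: \<Phi> C'eq Ceq)
    fix x y assume xy: "x \<in> carrier M" "y \<in> carrier M" "a x - a y \<in> N'"
    have "b (a x) - b (a y) \<in> N" using b(3)[OF xy(3)] by (simp add: bdiff)
    then have "b (a x) - b (a y) - ((b (a x) - x) - (b (a y) - y)) \<in> N"
      using N(3) ba xy(1,2) by blast
    then show "x - y \<in> N" by simp
  qed
  have surj: "\<Phi> ` ?C ` carrier M = ?C' ` carrier M'"
  proof
    show "\<Phi> ` ?C ` carrier M \<subseteq> ?C' ` carrier M'" using a(1) by (auto simp: \<Phi>)
    show "?C' ` carrier M' \<subseteq> \<Phi> ` ?C ` carrier M"
    proof
      fix Y assume "Y \<in> ?C' ` carrier M'"
      then obtain y where y: "y \<in> carrier M'" "Y = ?C' y" by auto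
      then have "Y = \<Phi> (?C (b y))" using ab by (simp add: \<Phi>)
      then show "Y \<in> \<Phi> ` ?C ` carrier M" using b(1)[OF y(1)] by blast
    qed
  qed
  have "\<Phi> \<in> iso (add_monoid (graded_quotient M N)) (add_monoid (graded_quotient M' N'))"
    unfolding iso_def hom_def bij_betw_def
    using inj surj by (auto simp: car Cadd C'add \<Phi> a(1,2) Pi_iff)
  moreover have "\<Phi> (r \<odot>\<^bsub>graded_quotient M N\<^esub> x) = r \<odot>\<^bsub>graded_quotient M' N'\<^esub> \<Phi> x"
    if "x \<in> carrier (graded_quotient M N)" for r x
    using that by (auto simp: car Csm C'sm \<Phi> a(4))
  moreover have "\<Phi> ` homog (graded_quotient M N) m = homog (graded_quotient M' N') m" for m
  proof
    show "\<Phi> ` homog (graded_quotient M N) m \<subseteq> homog (graded_quotient M' N') m"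
      using a(5) by (auto simp: homogq \<Phi>)
    show "homog (graded_quotient M' N') m \<subseteq> \<Phi> ` homog (graded_quotient M N) m"
    proof
      fix Y assume "Y \<in> homog (graded_quotient M' N') m"
      then obtain y where y: "y \<in> homog M' m" "Y = ?C' y" by (auto simp: homogq)
      then have "y \<in> carrier M'" using hom(2) by blast
      then have "Y = \<Phi> (?C (b y))" using ab y(2) by (simp add: \<Phi>)
      then show "Y \<in> \<Phi> ` homog (graded_quotient M N) m" using b(4)[OF y(1)] by (auto simp: homogq)
    qed
  qed
  ultimately show ?thesis by (auto simp: graded_isomorphic_def graded_module_iso_def)
qed

text \<open>Dualizing reverses arrows: \<open>a\<close> is the dual of \<open>g\<close> and
  \<open>b\<close> the dual of \<open>f\<close>, so \<open>f g = id\<close> becomes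
  \<open>a b = id\<close>. The homotopy splits \<open>b a - id\<close> into the duals of
  \<open>bd H\<close> and of \<open>H bd\<close>; on a cocycle the first factors through
  \<open>delta\<close> and vanishes, the second is a coboundary.\<close>

lemma homotopy_equivalence_imp_isomorphic:
  fixes T T' :: "('v::linorder \<Rightarrow> real) set"
  assumes faces: "\<And>q s. s \<in> cubes T (Suc q) \<Longrightarrow> Poly_Mapping.keys (cube_boundary s) \<subseteq> cubes T q"
      "\<And>q s. s \<in> cubes T' (Suc q) \<Longrightarrow> Poly_Mapping.keys (cube_boundary s) \<subseteq> cubes T' q"
    and face_weight: "\<And>q s t. s \<in> cubes T q \<Longrightarrow> t \<in> Poly_Mapping.keys (cube_boundary s) \<Longrightarrow> cube_weight w t \<le> cube_weight w s"
      "\<And>q s t. s \<in> cubes T' q \<Longrightarrow> t \<in> Poly_Mapping.keys (cube_boundary s) \<Longrightarrow> cube_weight w' t \<le> cube_weight w' s"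
    and f: "\<And>q s. s \<in> cubes T q \<Longrightarrow> Poly_Mapping.keys (f s) \<subseteq> cubes T' q"
      "\<And>q s t. s \<in> cubes T q \<Longrightarrow> t \<in> Poly_Mapping.keys (f s) \<Longrightarrow> cube_weight w' t \<le> cube_weight w s"
      "\<And>q s. s \<in> cubes T q \<Longrightarrow> bd (f s) = frag_extend f (cube_boundary s)"
    and g: "\<And>q s. s \<in> cubes T' q \<Longrightarrow> Poly_Mapping.keys (g s) \<subseteq> cubes T q"
      "\<And>q s t. s \<in> cubes T' q \<Longrightarrow> t \<in> Poly_Mapping.keys (g s) \<Longrightarrow> cube_weight w t \<le> cube_weight w' s"
      "\<And>q s. s \<in> cubes T' q \<Longrightarrow> bd (g s) = frag_extend g (cube_boundary s)"
    and H: "\<And>q s. s \<in> cubes T q \<Longrightarrow> Poly_Mapping.keys (H s) \<subseteq> cubes T (Suc q)"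
      "\<And>q s t. s \<in> cubes T q \<Longrightarrow> t \<in> Poly_Mapping.keys (H s) \<Longrightarrow> cube_weight w t \<le> cube_weight w s"
      "\<And>q s. s \<in> cubes T q \<Longrightarrow>
         bd (H s) = frag_extend g (f s) - frag_of s - frag_extend H (cube_boundary s)"
    and fg: "\<And>q s. s \<in> cubes T' q \<Longrightarrow> frag_extend f (g s) = frag_of s"
  shows "graded_isomorphic ZU (lattice_cohomology T w q) (lattice_cohomology T' w' q)"
proof -
  let ?W = "cube_weight w" and ?W' = "cube_weight w'"
  define a where "a q = pullback T' q ?W' ?W g" for q
  define b where "b q = pullback T q ?W ?W' f" for q
  have a_delta: "a (Suc q) (delta T w q \<phi>) = delta T' w' q (a q \<phi>)" for q \<phi>
  proof -
    have "a (Suc q) (delta T w q \<phi>) = pullback T' (Suc q) ?W' ?W (\<lambda>s. bd (g s)) \<phi>"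
      unfolding a_def delta_eq_pullback
      by (rule pullback_pullback) (auto dest: g(1,2) face_weight(1))
    also have "\<dots> = pullback T' (Suc q) ?W' ?W (\<lambda>s. frag_extend g (cube_boundary s)) \<phi>"
      by (rule pullback_cong) (rule g(3))
    also have "\<dots> = delta T' w' q (a q \<phi>)"
      unfolding a_def delta_eq_pullback
      by (rule pullback_pullback[symmetric]) (use faces face_weight g(2) in blast)+
    finally show ?thesis .
  qed
  have b_delta: "b (Suc q) (delta T' w' q \<phi>) = delta T w q (b q \<phi>)" for q \<phi>
  proof -
    have "b (Suc q) (delta T' w' q \<phi>) = pullback T (Suc q) ?W ?W' (\<lambda>s. bd (f s)) \<phi>"
      unfolding b_def delta_eq_pullback
      by (rule pullback_pullback) (use f(1,2) face_weight(2) in blast)+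
    also have "\<dots> = pullback T (Suc q) ?W ?W' (\<lambda>s. frag_extend f (cube_boundary s)) \<phi>"
      by (rule pullback_cong) (rule f(3))
    also have "\<dots> = delta T w q (b q \<phi>)"
      unfolding b_def delta_eq_pullback
      by (rule pullback_pullback[symmetric]) (use faces face_weight f(2) in blast)+
    finally show ?thesis .
  qed
  have ab: "a q (b q \<phi>) = \<phi>" if "\<phi> \<in> cochains T' q" for \<phi>
  proof -
    have "a q (b q \<phi>) = pullback T' q ?W' ?W' (\<lambda>s. frag_extend f (g s)) \<phi>"
      unfolding a_def b_def
      by (rule pullback_pullback) (use g(1,2) f(2) in blast)+
    also have "\<dots> = pullback T' q ?W' ?W' frag_of \<phi>"
      by (rule pullback_cong) (rule fg)
    finally show ?thesis using pullback_frag_of[OF that] by simp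
  qed
  have ba: "b q (a q \<phi>) - \<phi> \<in> coboundaries T w q"
    if \<phi>: "\<phi> \<in> cochains T q" and cyc: "delta T w q \<phi> = 0" for \<phi>
  proof -
    have "b q (a q \<phi>) = pullback T q ?W ?W (\<lambda>s. frag_extend g (f s)) \<phi>"
      unfolding a_def b_def
      by (rule pullback_pullback) (use f(1,2) g(2) in blast)+
    also have "\<dots> = pullback T q ?W ?W (\<lambda>s. bd (H s) + (frag_of s + frag_extend H (cube_boundary s))) \<phi>"
      by (rule pullback_cong) (simp add: H(3))
    also have "\<dots> = pullback T q ?W ?W (\<lambda>s. bd (H s)) \<phi> + (\<phi> +
        pullback T q ?W ?W (\<lambda>s. frag_extend H (cube_boundary s)) \<phi>)"
      by (simp add: pullback_add_chain pullback_frag_of[OF \<phi>])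
    also have "pullback T q ?W ?W (\<lambda>s. bd (H s)) \<phi> = pullback T q ?W ?W H (delta T w q \<phi>)"
      unfolding delta_eq_pullback
      by (rule pullback_pullback[symmetric]) (use H(1,2) face_weight(1) in blast)+
    also have "\<dots> = 0" by (simp add: cyc pullback_zero)
    finally have eq: "b q (a q \<phi>) - \<phi> = pullback T q ?W ?W (\<lambda>s. frag_extend H (cube_boundary s)) \<phi>"
      by (simp add: fun_eq_iff)
    show ?thesis
    proof (cases q)
      \<comment> \<open>The only coboundary in degree 0 is 0; the remaining term vanishes because a
        vertex has empty boundary.\<close>
      case 0
      have "pullback T q ?W ?W (\<lambda>s. frag_extend H (cube_boundary s)) \<phi> = pullback T q ?W ?W (\<lambda>s. 0) \<phi>"
        by (rule pullback_cong) (auto simp: 0 cubes_def cube_boundary_def)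
      then show ?thesis using eq by (simp add: coboundaries_def 0 pullback_zero_chain)
    next
      case (Suc p)
      have "pullback T q ?W ?W (\<lambda>s. frag_extend H (cube_boundary s)) \<phi> = delta T w p (pullback T p ?W ?W H \<phi>)"
        unfolding Suc delta_eq_pullback
        by (rule pullback_pullback[symmetric]) (use faces face_weight(1) H(2) in blast)+
      then show ?thesis using eq by (simp add: coboundaries_def Suc pullback_in)
    qed
  qed
  have delta_delta: "delta T w (Suc q) (delta T w q \<phi>) = 0"
      if "\<And>q s. s \<in> cubes T (Suc q) \<Longrightarrow> Poly_Mapping.keys (cube_boundary s) \<subseteq> cubes T q"
        "\<And>q s t. s \<in> cubes T q \<Longrightarrow> t \<in> Poly_Mapping.keys (cube_boundary s) \<Longrightarrow> cube_weight w t \<le> cube_weight w s"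
      for T :: "('v \<Rightarrow> real) set" and w q \<phi>
  proof -
    have "delta T w (Suc q) (delta T w q \<phi>) =
       pullback T (Suc (Suc q)) (cube_weight w) (cube_weight w) (\<lambda>s. bd (cube_boundary s)) \<phi>"
      unfolding delta_eq_pullback by (rule pullback_pullback) (use that in blast)+
    also have "\<dots> = pullback T (Suc (Suc q)) (cube_weight w) (cube_weight w) (\<lambda>s. 0) \<phi>"
      by (rule pullback_cong) (auto simp: cubes_def bd_cube_boundary)
    finally show ?thesis by (simp add: pullback_zero_chain)
  qed
  have coch_add: "\<phi> + \<psi> \<in> cochains T q" if "\<phi> \<in> cochains T q" "\<psi> \<in> cochains T q"
    for T :: "('v \<Rightarrow> real) set" and q \<phi> \<psi>
    using that by (auto simp: cochains_def algebra_simps)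
  have coch_minus: "- \<phi> \<in> cochains T q" if "\<phi> \<in> cochains T q"
    for T :: "('v \<Rightarrow> real) set" and q \<phi>
    using that by (auto simp: cochains_def)
  have coch_scale: "(\<lambda>c. p \<cdot> \<phi> c) \<in> cochains T q" if "\<phi> \<in> cochains T q"
    for T :: "('v \<Rightarrow> real) set" and q \<phi> p
    using that by (auto simp: cochains_def T0_scale_add_right)
  have coch_zero: "0 \<in> cochains T q" for T :: "('v \<Rightarrow> real) set" and q
    by (auto simp: cochains_def)
  have delta_add: "delta T w q (\<phi> + \<psi>) = delta T w q \<phi> + delta T w q \<psi>"
    for T :: "('v \<Rightarrow> real) set" and q w \<phi> \<psi>
    by (simp add: delta_eq_pullback pullback_add)
  have delta_zero: "delta T w q 0 = 0" for T :: "('v \<Rightarrow> real) set" and q w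
    by (simp add: delta_eq_pullback pullback_zero)
  have delta_diff: "delta T w q (\<phi> - \<psi>) = delta T w q \<phi> - delta T w q \<psi>"
    for T :: "('v \<Rightarrow> real) set" and q w \<phi> \<psi>
    using delta_add[of T w q "\<phi> - \<psi>" \<psi>] by simp
  have delta_scale: "delta T w q (\<lambda>c. p \<cdot> \<phi> c) = (\<lambda>c. p \<cdot> delta T w q \<phi> c)"
    for T :: "('v \<Rightarrow> real) set" and q w \<phi> p
    by (simp add: delta_eq_pullback pullback_scale)
  have cob0: "0 \<in> coboundaries T w q" for T :: "('v \<Rightarrow> real) set" and q w
  proof (cases q)
    case (Suc p)
    then show ?thesis using delta_zero[of T w p] coch_zero[of T p]
      by (auto simp: coboundaries_def intro!: image_eqI[of _ _ 0])
  qed (simp add: coboundaries_def)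
  have cobd: "\<phi> - \<psi> \<in> coboundaries T w q" if cob: "\<phi> \<in> coboundaries T w q" "\<psi> \<in> coboundaries T w q"
    for T :: "('v \<Rightarrow> real) set" and q w \<phi> \<psi>
  proof (cases q)
    case (Suc p)
    then obtain \<phi>' \<psi>' where *: "\<phi>' \<in> cochains T p" "\<psi>' \<in> cochains T p" "\<phi> = delta T w p \<phi>'" "\<psi> = delta T w p \<psi>'"
      using cob by (auto simp: coboundaries_def Suc)
    then have "\<phi>' - \<psi>' \<in> cochains T p" using coch_add[of \<phi>' T p "- \<psi>'"] coch_minus by simp
    then have "delta T w p (\<phi>' - \<psi>') \<in> coboundaries T w q" by (simp add: coboundaries_def Suc)
    then show ?thesis using * delta_diff[of T w p \<phi>' \<psi>'] by simp
  qed (use cob in \<open>simp add: coboundaries_def\<close>)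
  have cobs: "(\<lambda>c. p \<cdot> \<phi> c) \<in> coboundaries T w q" if cob: "\<phi> \<in> coboundaries T w q"
    for T :: "('v \<Rightarrow> real) set" and q w \<phi> p
  proof (cases q)
    case 0
    then show ?thesis using cob by (auto simp: coboundaries_def fun_eq_iff)
  next
    case (Suc r)
    then obtain \<phi>' where *: "\<phi>' \<in> cochains T r" "\<phi> = delta T w r \<phi>'"
      using cob by (auto simp: coboundaries_def Suc)
    then have "delta T w r (\<lambda>c. p \<cdot> \<phi>' c) \<in> coboundaries T w q"
      using coch_scale[of \<phi>' T r p] by (simp add: coboundaries_def Suc)
    then show ?thesis using delta_scale[of T w r p \<phi>'] * by simp
  qed
  have a0: "a q 0 = 0" and b0: "b q 0 = 0" for q by (simp_all add: a_def b_def pullback_zero)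
  have a_cob: "a q \<phi> \<in> coboundaries T' w' q" if cob: "\<phi> \<in> coboundaries T w q" for \<phi>
  proof (cases q)
    case 0
    then show ?thesis using cob a0 by (auto simp: coboundaries_def)
  next
    case (Suc p)
    then obtain \<phi>' where "\<phi> = delta T w p \<phi>'" using cob by (auto simp: coboundaries_def Suc)
    then show ?thesis using a_delta[of p \<phi>']
      by (simp add: coboundaries_def Suc a_def pullback_in)
  qed
  have b_cob: "b q \<phi> \<in> coboundaries T w q" if cob: "\<phi> \<in> coboundaries T' w' q" for \<phi>
  proof (cases q)
    case 0
    then show ?thesis using cob b0 by (auto simp: coboundaries_def)
  next
    case (Suc p)
    then obtain \<phi>' where "\<phi> = delta T' w' p \<phi>'" using cob by (auto simp: coboundaries_def Suc)
    then show ?thesis using b_delta[of p \<phi>']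
      by (simp add: coboundaries_def Suc b_def pullback_in)
  qed
  let ?M = "cocycle_module T w q" and ?M' = "cocycle_module T' w' q"
  have carM: "carrier (cocycle_module T w q) = {\<phi> \<in> cochains T q. delta T w q \<phi> = 0}"
    and addM: "ring.add (cocycle_module T w q) = (+)"
    and smM: "module.smult (cocycle_module T w q) = (\<lambda>p \<phi> c. p \<cdot> \<phi> c)"
    and homM: "homog (cocycle_module T w q) m = homog (cochain_module T w q) m \<inter> {\<phi> \<in> cochains T q. delta T w q \<phi> = 0}"
    for T :: "('v \<Rightarrow> real) set" and w q m
    by (simp_all add: cocycle_module_def Let_def cochain_module_def)
  show ?thesis
    unfolding lattice_cohomology_def
  proof (rule graded_quotient_isomorphic[where a = "a q" and b = "b q"])
    show "coboundaries T w q \<subseteq> carrier ?M"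
    proof (cases q)
      case 0
      then show ?thesis using coch_zero delta_zero by (auto simp: coboundaries_def carM)
    next
      case (Suc p)
      then show ?thesis using delta_delta[OF faces(1) face_weight(1)]
        by (auto simp: coboundaries_def carM delta_eq_pullback pullback_in)
    qed
    show "a q x \<in> carrier ?M'" if "x \<in> carrier ?M" for x
      using that a_delta[of q x] a0 by (auto simp: carM a_def pullback_in)
    show "b q x \<in> carrier ?M" if "x \<in> carrier ?M'" for x
      using that b_delta[of q x] b0 by (auto simp: carM b_def pullback_in)
    show "a q x \<in> homog ?M' m" if "x \<in> homog ?M m" for x m
      using that a_delta[of q x] a0 pullback_homog[of T' q g T q w w' x m] g(1,2)
      by (auto simp: homM a_def pullback_in)
    show "b q x \<in> homog ?M m" if "x \<in> homog ?M' m" for x m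
      using that b_delta[of q x] b0 pullback_homog[of T q f T' q w' w x m] f(1,2)
      by (auto simp: homM b_def pullback_in)
    show "x + y \<in> carrier ?M" if "x \<in> carrier ?M" "y \<in> carrier ?M" for x y
      using that by (simp add: carM coch_add delta_add)
    show "p \<odot>\<^bsub>?M\<^esub> x \<in> carrier ?M" if "x \<in> carrier ?M" for p x
      using that by (simp add: carM smM coch_scale delta_scale) (simp add: fun_eq_iff)
    show "p \<odot>\<^bsub>?M\<^esub> x \<in> coboundaries T w q" if "x \<in> coboundaries T w q" for p x
      using cobs[OF that] by (simp add: smM)
    show "p \<odot>\<^bsub>?M'\<^esub> x \<in> coboundaries T' w' q" if "x \<in> coboundaries T' w' q" for p x
      using cobs[OF that] by (simp add: smM)
    show "p \<odot>\<^bsub>?M\<^esub> (x + y) = p \<odot>\<^bsub>?M\<^esub> x + p \<odot>\<^bsub>?M\<^esub> y" for p x y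
      by (simp add: smM T0_scale_add_right fun_eq_iff)
    show "p \<odot>\<^bsub>?M'\<^esub> (x + y) = p \<odot>\<^bsub>?M'\<^esub> x + p \<odot>\<^bsub>?M'\<^esub> y" for p x y
      by (simp add: smM T0_scale_add_right fun_eq_iff)
    show "a q (p \<odot>\<^bsub>?M\<^esub> x) = p \<odot>\<^bsub>?M'\<^esub> a q x" for p x
      by (simp add: smM a_def pullback_scale)
    show "a q (x + y) = a q x + a q y" for x y
      by (simp add: a_def pullback_add)
    show "b q (x + y) = b q x + b q y" for x y
      by (simp add: b_def pullback_add)
    show "a q (b q y) = y" if "y \<in> carrier ?M'" for y
      using that by (simp add: carM ab)
    show "b q (a q x) - x \<in> coboundaries T w q" if "x \<in> carrier ?M" for x
      using that by (simp add: carM ba)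
    show "homog ?M m \<subseteq> carrier ?M" "homog ?M' m \<subseteq> carrier ?M'" for m
      by (simp_all add: carM homM)
  qed (fact addM cob0 cobd a_cob b_cob)+
qed

section \<open>Acyclic carriers and the projection\<close>

lemma cube_vertices_eq: "finite I \<Longrightarrow> cube_vertices (l, I) = (\<lambda>J. l + ind J) ` Pow I"
proof -
  assume fin: "finite I"
  have eq: "(\<Sum>j\<in>J. unit_vec j) = ind J" if "J \<subseteq> I" for J
    using that fin finite_subset sum_unit_vec by blast
  have "cube_vertices (l, I) = (\<lambda>J. l + (\<Sum>j\<in>J. unit_vec j)) ` Pow I"
    by (auto simp: cube_vertices_def)
  also have "\<dots> = (\<lambda>J. l + ind J) ` Pow I"
    by (rule image_cong) (simp_all add: eq)
  finally show ?thesis .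
qed

lemma full_cubes_iff:
  "s \<in> full_cubes V q \<longleftrightarrow> finite (snd s) \<and> card (snd s) = q \<and> cube_vertices s \<subseteq> V"
proof (cases s)
  case (Pair l I)
  then show ?thesis
    by (cases "finite I") (auto simp: full_cubes_def cube_vertices_eq)
qed

lemma finite_cube_vertices: "finite (snd s) \<Longrightarrow> finite (cube_vertices s)"
  by (cases s) (simp add: cube_vertices_eq)

lemma cube_vertices_nonempty: "finite (snd s) \<Longrightarrow> cube_vertices s \<noteq> {}"
  by (cases s) (auto simp: cube_vertices_eq)

lemma cube_weight_le_iff:
  "finite (snd s) \<Longrightarrow> cube_weight w s \<le> n \<longleftrightarrow> (\<forall>v\<in>cube_vertices s. w v \<le> n)"
  by (simp add: cube_weight_def Max_le_iff finite_cube_vertices cube_vertices_nonempty)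

lemma cube_weight_mono:
  assumes "finite (snd s)" "finite (snd t)" "cube_vertices t \<subseteq> cube_vertices s"
  shows "cube_weight w t \<le> cube_weight w s"
  using assms cube_weight_le_iff[OF assms(1), of w "cube_weight w s"]
  by (auto simp: cube_weight_le_iff)

lemma face_vertices:
  assumes "finite (snd s)" "t \<in> Poly_Mapping.keys (cube_boundary s)"
  shows "finite (snd t)" "cube_vertices t \<subseteq> cube_vertices s"
proof -
  have "s \<in> full_cubes (cube_vertices s) (card (snd s))"
    using assms(1) by (simp add: full_cubes_iff)
  then have "t \<in> full_cubes (cube_vertices s) (card (snd s) - 1)"
    using full_cubes_face(1)[of "fst s" "snd s"] assms(2) by simp
  then show "finite (snd t)" "cube_vertices t \<subseteq> cube_vertices s"
    by (simp_all add: full_cubes_iff)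
qed

text \<open>If \<open>l = i + ind J\<close>, then a step from \<open>l\<close> in a direction
  \<open>j\<close> of \<open>I\<close> stays in the larger cube only when \<open>j\<close> lies in
  \<open>K - J\<close>. Hence \<open>I\<close> is contained in \<open>K - J\<close>, and equal
  cardinality forces \<open>I = K\<close> and \<open>J = {}\<close>.\<close>

lemma cube_eqI:
  assumes "finite I" "finite K" "card I = card K" "cube_vertices (l, I) \<subseteq> cube_vertices (i, K)"
  shows "(l, I) = (i, K)"
proof -
  have v: "\<exists>J\<subseteq>K. l + ind M = i + ind J" if "M \<subseteq> I" for M
    using assms(4) that unfolding cube_vertices_eq[OF assms(1)] cube_vertices_eq[OF assms(2)] by blast
  obtain J where J: "J \<subseteq> K" "l = i + ind J" using v[of "{}"] by auto
  have *: "j \<in> K - J" if j: "j \<in> I" for j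
  proof -
    obtain J1 where J1: "J1 \<subseteq> K" "l + ind {j} = i + ind J1" using v[of "{j}"] j by auto
    then have "ind J j + ind {j} j = ind J1 j" using J(2) by (auto simp: fun_eq_iff add.assoc)
    then show ?thesis using J1(1) by (auto simp: ind_def split: if_splits)
  qed
  then have "I = K" using card_subset_eq[OF assms(2), of I] assms(3) by blast
  moreover from this have "J = {}" using * J(1) by blast
  ultimately show ?thesis using J(2) by simp
qed

lemma frag_extend_diff_fun:
  "frag_extend (\<lambda>s. f s - g s) c = frag_extend f c - frag_extend g c"
  by (rule poly_mapping_eqI)
    (simp add: lookup_frag_extend lookup_minus right_diff_distrib sum_subtractf)

lemma acyclic_set_bounds:
  assumes "acyclic_set V" "reduced_cycle V q z"
  obtains c where "Poly_Mapping.keys c \<subseteq> full_cubes V (Suc q)" "bd c = z"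
  using assms unfolding acyclic_set_def by blast

text \<open>Construction by recursion on the dimension: the image of the boundary of
  \<open>s\<close> is already defined, is a reduced cycle and lies in the carrier of
  \<open>s\<close> by monotonicity, so it can be filled there. Normalizing the augmentation on
  vertices makes the cycle reduced when \<open>s\<close> is an edge.\<close>

lemma carrier_map_exists:
  fixes V :: "('v::linorder \<Rightarrow> int) set" and \<Phi> :: "'v cube \<Rightarrow> ('v \<Rightarrow> int) set"
  assumes acyc: "\<And>q s. s \<in> full_cubes V q \<Longrightarrow> acyclic_set (\<Phi> s)"
    and mono: "\<And>q s t. s \<in> full_cubes V q \<Longrightarrow> t \<in> Poly_Mapping.keys (cube_boundary s) \<Longrightarrow> \<Phi> t \<subseteq> \<Phi> s"
  shows "\<exists>g. \<forall>q s. s \<in> full_cubes V q \<longrightarrow> Poly_Mapping.keys (g s) \<subseteq> full_cubes (\<Phi> s) q \<and>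
    bd (g s) = frag_extend g (cube_boundary s) \<and> (q = 0 \<longrightarrow> aug (g s) = frag_of ())"
proof -
  let ?R = "measure (\<lambda>s :: 'v cube. card (snd s))"
  let ?P = "\<lambda>g s r. \<forall>q. s \<in> full_cubes V q \<longrightarrow> Poly_Mapping.keys r \<subseteq> full_cubes (\<Phi> s) q \<and>
    bd r = frag_extend g (cube_boundary s) \<and> (q = 0 \<longrightarrow> aug r = frag_of ())"
  have face: "t \<in> full_cubes V (q - 1) \<and> 0 < q \<and> (t, s) \<in> ?R"
    if "s \<in> full_cubes V q" "t \<in> Poly_Mapping.keys (cube_boundary s)" for s t q
    using full_cubes_face[of "fst s" "snd s" V q t] that by (auto simp: full_cubes_iff)
  have "\<exists>g. \<forall>s. ?P g s (g s)"
  proof (rule dependent_wf_choice[of ?R])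
    show "wf ?R" by simp
  next
    fix g h :: "'v cube \<Rightarrow> 'v cube \<Rightarrow>\<^sub>0 int" and s r assume eq: "\<And>z. (z, s) \<in> ?R \<Longrightarrow> g z = h z"
    have "frag_extend g (cube_boundary s) = frag_extend h (cube_boundary s)"
      if "s \<in> full_cubes V q" for q
      by (rule frag_extend_eq) (use face that eq in blast)
    then show "?P g s r = ?P h s r" by simp
  next
    fix s g assume IH: "\<And>t. (t, s) \<in> ?R \<Longrightarrow> ?P g t (g t)"
    show "\<exists>r. ?P g s r"
    proof (cases "\<exists>q. s \<in> full_cubes V q")
      case False
      then show ?thesis by blast
    next
      case True
      then obtain q where s: "s \<in> full_cubes V q" by blast
      have q: "p = q" if "s \<in> full_cubes V p" for p using s that by (simp add: full_cubes_iff)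
      have g: "Poly_Mapping.keys (g t) \<subseteq> full_cubes (\<Phi> t) (q - 1)"
          "bd (g t) = frag_extend g (cube_boundary t)" "q = 1 \<Longrightarrow> aug (g t) = frag_of ()"
        if "t \<in> Poly_Mapping.keys (cube_boundary s)" for t
        using IH[of t] face[OF s that] by auto
      show ?thesis
      proof (cases "q = 0")
        case True
        obtain x where x: "x \<in> \<Phi> s" using acyc[OF s] by (auto simp: acyclic_set_def)
        have "snd s = {}" using s True by (auto simp: full_cubes_iff)
        then have "cube_boundary s = 0" by (cases s) (simp add: cube_boundary_eq)
        moreover have "cube_boundary (x, {}) = 0" by (simp add: cube_boundary_eq)
        ultimately show ?thesis using q True x
          by (intro exI[of _ "frag_of (x, {})"]) (auto simp: full_cubes_def aug_def)
      next
        case False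
        let ?z = "frag_extend g (cube_boundary s)"
        have "reduced_cycle (\<Phi> s) (q - 1) ?z"
          unfolding reduced_cycle_def
        proof (intro conjI impI)
          show "Poly_Mapping.keys ?z \<subseteq> full_cubes (\<Phi> s) (q - 1)"
            using g(1) full_cubes_mono[OF mono[OF s]] by (intro keys_frag_extend_subset) blast
          have "bd ?z = frag_extend (\<lambda>t. frag_extend g (cube_boundary t)) (cube_boundary s)"
            unfolding frag_extend_frag_extend by (rule frag_extend_eq) (rule g(2))
          also have "\<dots> = frag_extend g (bd (cube_boundary s))"
            by (simp add: frag_extend_frag_extend)
          also have "\<dots> = 0" using s by (cases s) (simp add: full_cubes_iff bd_cube_boundary)
          finally show "bd ?z = 0" .
          assume "q - 1 = 0"
          then have "q = 1" using False by simp
          then have "aug ?z = aug (cube_boundary s)"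
            unfolding aug_def frag_extend_frag_extend by (intro frag_extend_eq) (simp add: g(3) flip: aug_def)
          also have "\<dots> = 0" using s by (cases s) (simp add: full_cubes_iff aug_cube_boundary)
          finally show "aug ?z = 0" .
        qed
        then obtain c where "Poly_Mapping.keys c \<subseteq> full_cubes (\<Phi> s) (Suc (q - 1))" "bd c = ?z"
          using acyclic_set_bounds[OF acyc[OF s]] by blast
        then show ?thesis using q False by (intro exI[of _ c]) auto
      qed
    qed
  qed
  then show ?thesis by blast
qed

text \<open>A chain map of augmentation zero that respects an acyclic carrier is null-homotopic
  within it: \<open>h s\<close> fills the cycle \<open>u s - h (bd s)\<close>. It serves for
  \<open>u\<close> the difference of a composite and the identity.\<close>

lemma carrier_homotopy_exists:
  fixes V :: "('v::linorder \<Rightarrow> int) set" and \<Phi> :: "'v cube \<Rightarrow> ('v \<Rightarrow> int) set"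
  assumes acyc: "\<And>q s. s \<in> full_cubes V q \<Longrightarrow> acyclic_set (\<Phi> s)"
    and mono: "\<And>q s t. s \<in> full_cubes V q \<Longrightarrow> t \<in> Poly_Mapping.keys (cube_boundary s) \<Longrightarrow> \<Phi> t \<subseteq> \<Phi> s"
    and u: "\<And>q s. s \<in> full_cubes V q \<Longrightarrow> Poly_Mapping.keys (u s) \<subseteq> full_cubes (\<Phi> s) q"
      "\<And>q s. s \<in> full_cubes V q \<Longrightarrow> bd (u s) = frag_extend u (cube_boundary s)"
      "\<And>s. s \<in> full_cubes V 0 \<Longrightarrow> aug (u s) = 0"
  shows "\<exists>h. \<forall>q s. s \<in> full_cubes V q \<longrightarrow> Poly_Mapping.keys (h s) \<subseteq> full_cubes (\<Phi> s) (Suc q) \<and>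
    bd (h s) = u s - frag_extend h (cube_boundary s)"
proof -
  let ?R = "measure (\<lambda>s :: 'v cube. card (snd s))"
  let ?P = "\<lambda>h s r. \<forall>q. s \<in> full_cubes V q \<longrightarrow> Poly_Mapping.keys r \<subseteq> full_cubes (\<Phi> s) (Suc q) \<and>
    bd r = u s - frag_extend h (cube_boundary s)"
  have face: "t \<in> full_cubes V (q - 1) \<and> 0 < q \<and> (t, s) \<in> ?R"
    if "s \<in> full_cubes V q" "t \<in> Poly_Mapping.keys (cube_boundary s)" for s t q
    using full_cubes_face[of "fst s" "snd s" V q t] that by (auto simp: full_cubes_iff)
  have "\<exists>h. \<forall>s. ?P h s (h s)"
  proof (rule dependent_wf_choice[of ?R])
    show "wf ?R" by simp
  next
    fix g h :: "'v cube \<Rightarrow> 'v cube \<Rightarrow>\<^sub>0 int" and s r assume eq: "\<And>z. (z, s) \<in> ?R \<Longrightarrow> g z = h z"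
    have "frag_extend g (cube_boundary s) = frag_extend h (cube_boundary s)"
      if "s \<in> full_cubes V q" for q
      by (rule frag_extend_eq) (use face that eq in blast)
    then show "?P g s r = ?P h s r" by simp
  next
    fix s h assume IH: "\<And>t. (t, s) \<in> ?R \<Longrightarrow> ?P h t (h t)"
    show "\<exists>r. ?P h s r"
    proof (cases "\<exists>q. s \<in> full_cubes V q")
      case False
      then show ?thesis by blast
    next
      case True
      then obtain q where s: "s \<in> full_cubes V q" by blast
      have q: "p = q" if "s \<in> full_cubes V p" for p using s that by (simp add: full_cubes_iff)
      have h: "Poly_Mapping.keys (h t) \<subseteq> full_cubes (\<Phi> t) q"
          "bd (h t) = u t - frag_extend h (cube_boundary t)"
        if t: "t \<in> Poly_Mapping.keys (cube_boundary s)" for t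
      proof -
        have "t \<in> full_cubes V (q - 1)" "Suc (q - 1) = q" using face[OF s t] by auto
        then show "Poly_Mapping.keys (h t) \<subseteq> full_cubes (\<Phi> t) q"
          "bd (h t) = u t - frag_extend h (cube_boundary t)"
          using IH[of t] face[OF s t] by metis+
      qed
      let ?z = "u s - frag_extend h (cube_boundary s)"
      have "reduced_cycle (\<Phi> s) q ?z"
        unfolding reduced_cycle_def
      proof (intro conjI impI keys_diff_subset u(1)[OF s])
        show "Poly_Mapping.keys (frag_extend h (cube_boundary s)) \<subseteq> full_cubes (\<Phi> s) q"
          using h(1) full_cubes_mono[OF mono[OF s]] by (intro keys_frag_extend_subset) blast
        have "bd (frag_extend h (cube_boundary s)) =
            frag_extend (\<lambda>t. u t - frag_extend h (cube_boundary t)) (cube_boundary s)"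
          unfolding frag_extend_frag_extend by (rule frag_extend_eq) (rule h(2))
        also have "\<dots> = frag_extend u (cube_boundary s) - frag_extend h (bd (cube_boundary s))"
          by (simp add: frag_extend_frag_extend frag_extend_diff_fun)
        also have "bd (cube_boundary s) = 0"
          using s by (cases s) (simp add: full_cubes_iff bd_cube_boundary)
        finally show "bd ?z = 0" by (simp add: frag_extend_diff u(2)[OF s])
        assume "q = 0"
        then have "snd s = {}" using s by (auto simp: full_cubes_iff)
        then have "cube_boundary s = 0" by (cases s) (simp add: cube_boundary_eq)
        then show "aug ?z = 0" using u(3)[of s] s \<open>q = 0\<close> by simp
      qed
      then obtain c where "Poly_Mapping.keys c \<subseteq> full_cubes (\<Phi> s) (Suc q)" "bd c = ?z"
        using acyclic_set_bounds[OF acyc[OF s]] by blast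
      then show ?thesis using q by (intro exI[of _ c]) auto
    qed
  qed
  then show ?thesis by blast
qed

section \<open>The projection to the quadrant on cubes and chains\<close>

definition project :: "'v set \<Rightarrow> ('v \<Rightarrow> int) \<Rightarrow> 'v \<Rightarrow> int" where
  "project B x = (\<lambda>v. if v \<in> B then max 0 (x v) else 0)"

text \<open>An edge starting at coordinate -1 ends at 0, so both its ends project to 0; a direction
  therefore survives only from \<open>0 \<le> l j\<close> on.\<close>

definition project_cube :: "'v set \<Rightarrow> 'v cube \<Rightarrow> 'v cube" where
  "project_cube B = (\<lambda>(l, I). (project B l, {j\<in>I. j \<in> B \<and> 0 \<le> l j}))"

lemma project_add_ind:
  "project B (l + ind J) = project B l + ind {j\<in>J. j \<in> B \<and> 0 \<le> l j}"
  by (auto simp: project_def ind_def fun_eq_iff)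

lemma vertices_project_cube:
  assumes "finite (snd s)"
  shows "cube_vertices (project_cube B s) = project B ` cube_vertices s"
proof (cases s)
  case (Pair l I)
  let ?g = "\<lambda>J. {j\<in>J. j \<in> B \<and> 0 \<le> l j}"
  have fin: "finite I" using assms Pair by simp
  have "cube_vertices (project_cube B s) = (\<lambda>J. project B l + ind J) ` Pow (?g I)"
    unfolding Pair project_cube_def prod.case by (rule cube_vertices_eq) (use fin in simp)
  also have "Pow (?g I) = ?g ` Pow I" by (auto intro!: image_eqI)
  also have "(\<lambda>J. project B l + ind J) ` ?g ` Pow I = (\<lambda>J. project B (l + ind J)) ` Pow I"
    unfolding image_image project_add_ind ..
  finally show ?thesis
    by (simp only: Pair cube_vertices_eq[OF fin] image_image)
qed

lemma project_cube_in:
  assumes "finite (snd s)"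
  shows "project_cube B s \<in> full_cubes {i \<in> coords B. 0 \<le> i} (card (snd (project_cube B s)))"
proof -
  have "finite (snd (project_cube B s))" using assms by (cases s) (simp add: project_cube_def)
  moreover have "cube_vertices (project_cube B s) \<subseteq> {i \<in> coords B. 0 \<le> i}"
    unfolding vertices_project_cube[OF assms] by (auto simp: project_def coords_def le_fun_def)
  ultimately show ?thesis by (simp add: full_cubes_iff)
qed

definition project_map :: "'v set \<Rightarrow> 'v cube \<Rightarrow> 'v cube \<Rightarrow>\<^sub>0 int" where
  "project_map B s = (if snd (project_cube B s) = snd s then frag_of (project_cube B s) else 0)"

text \<open>If no direction is lost, faces correspond to faces. If a direction \<open>i\<close> is
  lost, each pair of opposite faces cancels: faces in a surviving direction still contain
  \<open>i\<close> and map to 0, while the two faces in a lost direction have the same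
  image.\<close>

lemma project_map_boundary:
  assumes "finite (snd s)"
  shows "bd (project_map B s) = frag_extend (project_map B) (cube_boundary s)"
proof (cases s)
  case (Pair l I)
  have fin: "finite I" using assms Pair by simp
  let ?good = "\<lambda>j. j \<in> B \<and> 0 \<le> l j"
  let ?f = "project_map B"
  have expand: "frag_extend ?f (cube_boundary s) = (\<Sum>j\<in>I. frag_cmul (face_sign I j)
      (?f (l + unit_vec j, I - {j}) - ?f (l, I - {j})))"
    by (simp add: Pair cube_boundary_eq frag_extend_sum fin frag_extend_cmul frag_extend_diff)
  have others: "{i \<in> I - {j}. i \<in> B \<and> 0 \<le> (l + unit_vec j) i} = {i \<in> I - {j}. ?good i}" for j
    by (auto simp: unit_vec_def)
  show ?thesis
  proof (cases "\<forall>j\<in>I. ?good j")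
    case True
    have p: "project B (l + unit_vec j) = project B l + unit_vec j" if "j \<in> I" for j
      using True that by (auto simp: project_def unit_vec_def fun_eq_iff)
    have good: "{i \<in> I - {j}. ?good i} = I - {j}" "{i \<in> I. ?good i} = I" for j
      using True by auto
    have "?f s = frag_of (project B l, I)"
      by (simp add: project_map_def project_cube_def Pair good)
    then have "bd (?f s) = (\<Sum>j\<in>I. frag_cmul (face_sign I j)
       (frag_of (project B l + unit_vec j, I - {j}) - frag_of (project B l, I - {j})))"
      by (simp add: cube_boundary_eq)
    also have "\<dots> = (\<Sum>j\<in>I. frag_cmul (face_sign I j)
      (?f (l + unit_vec j, I - {j}) - ?f (l, I - {j})))"
    proof (rule sum.cong[OF refl])
      fix j assume j: "j \<in> I"
      have "?f (l + unit_vec j, I - {j}) = frag_of (project B l + unit_vec j, I - {j})"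
        unfolding project_map_def project_cube_def prod.case others good p[OF j] by simp
      moreover have "?f (l, I - {j}) = frag_of (project B l, I - {j})"
        unfolding project_map_def project_cube_def prod.case good by simp
      ultimately show "frag_cmul (face_sign I j)
         (frag_of (project B l + unit_vec j, I - {j}) - frag_of (project B l, I - {j})) =
        frag_cmul (face_sign I j) (?f (l + unit_vec j, I - {j}) - ?f (l, I - {j}))" by simp
    qed
    finally show ?thesis using expand by simp
  next
    case False
    then obtain i where i: "i \<in> I" "\<not> ?good i" by blast
    have "?f s = 0" using i by (auto simp: project_map_def project_cube_def Pair)
    moreover have "?f (l + unit_vec j, I - {j}) = ?f (l, I - {j})" if j: "j \<in> I" for j
    proof (cases "?good j")
      case True
      then have "i \<in> I - {j}" using i by auto
      then have "{i \<in> I - {j}. ?good i} \<noteq> I - {j}" using i by blast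
      then show ?thesis unfolding project_map_def project_cube_def prod.case others by simp
    next
      case False
      then have "project B (l + unit_vec j) = project B l"
        by (auto simp: project_def unit_vec_def fun_eq_iff)
      then show ?thesis unfolding project_map_def project_cube_def prod.case others by simp
    qed
    ultimately show ?thesis using expand by simp
  qed
qed

text \<open>The set \<open>A c n\<close> of points over \<open>c\<close> of weight at most
  \<open>n\<close> serves as carrier twice: with \<open>n\<close> the weight of the quadrant cube
  \<open>c\<close> for the section \<open>g\<close>, and over the projection of a lattice cube
  \<open>s\<close>, with \<open>n\<close> the weight of \<open>s\<close>, for the homotopy. The
  second carrier contains both \<open>s\<close> and the image of \<open>s\<close> under
  \<open>g f\<close>, because projecting does not raise weights.\<close>

lemma projection_isomorphism:
  fixes T T' :: "('v::linorder \<Rightarrow> real) set" and w w' :: "('v \<Rightarrow> int) \<Rightarrow> int" and B :: "'v set"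
  defines "\<Lambda>' \<equiv> {i \<in> coords B. 0 \<le> i}"
  assumes T: "\<And>q. cubes T q = full_cubes \<Lambda> q" and T': "\<And>q. cubes T' q = full_cubes \<Lambda>' q"
    and weight: "\<And>x. x \<in> \<Lambda> \<Longrightarrow> w' (project B x) \<le> w x"
    and acyc: "\<And>i I n. finite I \<Longrightarrow> cube_vertices (i, I) \<subseteq> \<Lambda>' \<Longrightarrow>
       (\<And>v. v \<in> cube_vertices (i, I) \<Longrightarrow> w' v \<le> n) \<Longrightarrow>
       acyclic_set {x \<in> \<Lambda>. project B x \<in> cube_vertices (i, I) \<and> w x \<le> n}"
  shows "graded_isomorphic ZU (lattice_cohomology T w q) (lattice_cohomology T' w' q)"
proof -
  let ?W = "cube_weight w" and ?W' = "cube_weight w'"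
  define A where "A c n = {x \<in> \<Lambda>. project B x \<in> cube_vertices c \<and> w x \<le> n}" for c n
  have A_mono: "A c m \<subseteq> A d n" if "cube_vertices c \<subseteq> cube_vertices d" "m \<le> n" for c d m n
    using that by (auto simp: A_def)
  have A_acyc: "acyclic_set (A c n)" if "c \<in> full_cubes \<Lambda>' q" "?W' c \<le> n" for c n q
    using that acyc[of "snd c" "fst c" n] cube_weight_le_iff[of c w' n]
    by (auto simp: A_def full_cubes_iff)
  have fin: "finite (snd s)" if "s \<in> full_cubes V q" for s V q
    using that by (simp add: full_cubes_iff)
  have A_weight: "?W t \<le> n" if "t \<in> full_cubes (A c n) q" for t c n q
    using that by (auto simp: full_cubes_iff cube_weight_le_iff A_def)
  have A_sub: "full_cubes (A c n) q \<subseteq> full_cubes \<Lambda> q" for c n q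
    by (rule full_cubes_mono) (auto simp: A_def)
  have face_w: "cube_weight v t \<le> cube_weight v s"
    if "s \<in> full_cubes V q" "t \<in> Poly_Mapping.keys (cube_boundary s)" for s t V q v
    using face_vertices[OF fin[OF that(1)] that(2)] fin[OF that(1)] by (intro cube_weight_mono)
  have proj_in: "project_cube B s \<in> full_cubes \<Lambda>' (card (snd (project_cube B s)))"
    if "s \<in> full_cubes \<Lambda> q" for s q
    unfolding \<Lambda>'_def by (rule project_cube_in) (rule fin[OF that])
  have proj_w: "?W' (project_cube B s) \<le> ?W s" if s: "s \<in> full_cubes \<Lambda> q" for s q
    unfolding cube_weight_le_iff[OF fin[OF proj_in[OF s]]] vertices_project_cube[OF fin[OF s]]
  proof (safe)
    fix v assume v: "v \<in> cube_vertices s"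
    have "w v \<le> ?W s" using cube_weight_le_iff[OF fin[OF s], of w "?W s"] v by blast
    moreover have "w' (project B v) \<le> w v" using weight s v by (auto simp: full_cubes_iff)
    ultimately show "w' (project B v) \<le> ?W s" by linarith
  qed
  define f where "f = project_map B"
  have f_cases: "f s = 0 \<or> (f s = frag_of (project_cube B s) \<and> project_cube B s \<in> full_cubes \<Lambda>' q)"
    if "s \<in> full_cubes \<Lambda> q" for s q
    using proj_in[OF that] that by (auto simp: f_def project_map_def full_cubes_iff)
  have f_bd: "bd (f s) = frag_extend f (cube_boundary s)" if "s \<in> full_cubes \<Lambda> q" for s q
    unfolding f_def by (rule project_map_boundary) (rule fin[OF that])

  have "\<exists>g. \<forall>q s. s \<in> full_cubes \<Lambda>' q \<longrightarrow> Poly_Mapping.keys (g s) \<subseteq> full_cubes (A s (?W' s)) q \<and>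
    bd (g s) = frag_extend g (cube_boundary s) \<and> (q = 0 \<longrightarrow> aug (g s) = frag_of ())"
  proof (rule carrier_map_exists)
    fix q s t assume s: "s \<in> full_cubes \<Lambda>' q"
    then show "acyclic_set (A s (?W' s))" by (rule A_acyc) simp
    assume t: "t \<in> Poly_Mapping.keys (cube_boundary s)"
    show "A t (?W' t) \<subseteq> A s (?W' s)"
      using face_vertices(2)[OF fin[OF s] t] face_w[OF s t] by (rule A_mono)
  qed
  then obtain g where g: "\<And>q s. s \<in> full_cubes \<Lambda>' q \<Longrightarrow> Poly_Mapping.keys (g s) \<subseteq> full_cubes (A s (?W' s)) q"
      "\<And>q s. s \<in> full_cubes \<Lambda>' q \<Longrightarrow> bd (g s) = frag_extend g (cube_boundary s)"
      "\<And>s. s \<in> full_cubes \<Lambda>' 0 \<Longrightarrow> aug (g s) = frag_of ()" by blast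

  \<comment> \<open>Every cube of \<open>g s\<close> projects into \<open>s\<close>, so its image
    under \<open>f\<close> is 0 or, by equality of dimensions, \<open>s\<close> itself. Thus
    \<open>f (g s)\<close> is a multiple of \<open>s\<close>; the factor is found from the
    augmentation in dimension 0 and from the boundary, by induction, above.\<close>
  have fg: "frag_extend f (g s) = frag_of s" if "s \<in> full_cubes \<Lambda>' q" for s q
    using that
  proof (induction q arbitrary: s rule: less_induct)
    case (less q)
    note s = less.prems
    let ?c = "poly_mapping.lookup (frag_extend f (g s)) s"
    have gL: "t \<in> full_cubes \<Lambda> q" if "t \<in> Poly_Mapping.keys (g s)" for t
      using g(1)[OF s] A_sub that by blast
    have f_gs: "f t = 0 \<or> f t = frag_of s" if t: "t \<in> Poly_Mapping.keys (g s)" for t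
    proof (cases "f t = 0")
      case False
      then have p: "f t = frag_of (project_cube B t)" "project_cube B t \<in> full_cubes \<Lambda>' q"
        using f_cases[OF gL[OF t]] by auto
      have "t \<in> full_cubes (A s (?W' s)) q" using g(1)[OF s] t by blast
      then have "cube_vertices (project_cube B t) \<subseteq> cube_vertices s"
        unfolding vertices_project_cube[OF fin[OF gL[OF t]]] by (auto simp: full_cubes_iff A_def)
      then have "project_cube B t = s"
        using cube_eqI[of "snd (project_cube B t)" "snd s" "fst (project_cube B t)" "fst s"] p(2) s
        by (simp add: full_cubes_iff)
      then show ?thesis using p(1) by simp
    qed simp
    have "Poly_Mapping.keys (frag_extend f (g s)) \<subseteq> {s}"
      by (rule keys_frag_extend_subset) (use f_gs in force)
    then have eq: "frag_extend f (g s) = frag_cmul ?c (frag_of s)"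
      by (intro poly_mapping_eqI) (auto simp: in_keys_iff)
    have "?c = 1"
    proof (cases q)
      case 0
      have "frag_cmul ?c (frag_of ()) = aug (frag_extend f (g s))"
        by (subst (2) eq) (simp add: aug_def frag_extend_cmul)
      also have "\<dots> = aug (g s)"
        unfolding aug_def frag_extend_frag_extend
      proof (rule frag_extend_eq)
        fix t assume t: "t \<in> Poly_Mapping.keys (g s)"
        have "snd t = {}" using gL[OF t] 0 by (auto simp: full_cubes_iff)
        then have "f t = frag_of (project_cube B t)"
          by (cases t) (auto simp: f_def project_map_def project_cube_def)
        then show "frag_extend (\<lambda>_. frag_of ()) (f t) = frag_of ()" by simp
      qed
      also have "\<dots> = frag_of ()" using g(3) s 0 by simp
      finally have "poly_mapping.lookup (frag_cmul ?c (frag_of ())) () = 1" by simp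
      then show ?thesis by simp
    next
      case (Suc p)
      have "frag_cmul ?c (cube_boundary s) = bd (frag_extend f (g s))"
        by (subst (2) eq) (simp add: frag_extend_cmul)
      also have "\<dots> = frag_extend (\<lambda>t. frag_extend f (cube_boundary t)) (g s)"
        unfolding frag_extend_frag_extend by (rule frag_extend_eq) (rule f_bd[OF gL])
      also have "\<dots> = frag_extend f (bd (g s))" by (simp add: frag_extend_frag_extend)
      also have "\<dots> = frag_extend (\<lambda>t. frag_extend f (g t)) (cube_boundary s)"
        by (simp add: g(2)[OF s] frag_extend_frag_extend)
      also have "\<dots> = frag_extend frag_of (cube_boundary s)"
      proof (rule frag_extend_eq)
        fix t assume "t \<in> Poly_Mapping.keys (cube_boundary s)"
        then have "t \<in> full_cubes \<Lambda>' p"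
          using full_cubes_face(1)[of "fst s" "snd s" \<Lambda>' q t] s Suc by simp
        then show "frag_extend f (g t) = frag_of t" using less.IH Suc by blast
      qed
      also have "\<dots> = cube_boundary s" by (rule frag_expansion[symmetric])
      finally have *: "frag_cmul ?c (cube_boundary s) = cube_boundary s" .
      obtain l I where lI: "s = (l, I)" by (cases s)
      obtain j where j: "j \<in> I" using s Suc lI by (auto simp: full_cubes_iff card_Suc_eq)
      have corner: "corner_cube 0 l I = s" by (simp add: corner_cube_def lI)
      \<comment> \<open>A cube of positive dimension has a nonzero coefficient in its boundary,
        which allows the factor to be cancelled.\<close>
      have "poly_mapping.lookup (cube_boundary s) (corner_cube 0 l (I - {j})) \<noteq> 0"
        using lookup_boundary_corner[of I j "I - {j}" 0 l] j s lI corner by (simp add: full_cubes_iff)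
      moreover have "?c * poly_mapping.lookup (cube_boundary s) x = poly_mapping.lookup (cube_boundary s) x" for x
        using arg_cong[OF *, of "\<lambda>c. poly_mapping.lookup c x"] by simp
      ultimately show ?thesis by (metis mult_cancel_right1)
    qed
    then show "frag_extend f (g s) = frag_of s" using eq by simp
  qed

  define u where "u s = frag_extend g (f s) - frag_of s" for s
  define \<Psi> where "\<Psi> s = A (project_cube B s) (?W s)" for s
  have "\<exists>h. \<forall>q s. s \<in> full_cubes \<Lambda> q \<longrightarrow> Poly_Mapping.keys (h s) \<subseteq> full_cubes (\<Psi> s) (Suc q) \<and>
    bd (h s) = u s - frag_extend h (cube_boundary s)"
  proof (rule carrier_homotopy_exists)
    fix q s t assume s: "s \<in> full_cubes \<Lambda> q"
    show "acyclic_set (\<Psi> s)" unfolding \<Psi>_def by (rule A_acyc[OF proj_in[OF s] proj_w[OF s]])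
    show "Poly_Mapping.keys (u s) \<subseteq> full_cubes (\<Psi> s) q"
      unfolding u_def
    proof (rule keys_diff_subset)
      show "Poly_Mapping.keys (frag_extend g (f s)) \<subseteq> full_cubes (\<Psi> s) q"
      proof (cases "f s = 0")
        case False
        then have p: "f s = frag_of (project_cube B s)" "project_cube B s \<in> full_cubes \<Lambda>' q"
          using f_cases[OF s] by auto
        have "full_cubes (A (project_cube B s) (?W' (project_cube B s))) q \<subseteq> full_cubes (\<Psi> s) q"
          unfolding \<Psi>_def by (intro full_cubes_mono A_mono proj_w[OF s]) simp
        then show ?thesis using g(1)[OF p(2)] p(1) by simp
      qed simp
      have "cube_vertices s \<subseteq> \<Psi> s"
        using s cube_weight_le_iff[OF fin[OF s], of w "?W s"]
        by (auto simp: \<Psi>_def A_def full_cubes_iff vertices_project_cube)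
      then show "Poly_Mapping.keys (frag_of s) \<subseteq> full_cubes (\<Psi> s) q"
        using s by (simp add: full_cubes_iff)
    qed
    show "bd (u s) = frag_extend u (cube_boundary s)"
    proof -
      have "bd (frag_extend g (f s)) = frag_extend g (bd (f s))"
        using f_cases[OF s] g(2)[of "project_cube B s" q] by auto
      also have "\<dots> = frag_extend (\<lambda>t. frag_extend g (f t)) (cube_boundary s)"
        by (simp add: f_bd[OF s] frag_extend_frag_extend)
      finally have "bd (u s) = frag_extend (\<lambda>t. frag_extend g (f t)) (cube_boundary s) - cube_boundary s"
        by (simp add: u_def frag_extend_diff)
      then show ?thesis
        unfolding u_def frag_extend_diff_fun frag_expansion[symmetric] .
    qed
    assume t: "t \<in> Poly_Mapping.keys (cube_boundary s)"
    have "cube_vertices (project_cube B t) \<subseteq> cube_vertices (project_cube B s)"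
      using face_vertices[OF fin[OF s] t] fin[OF s] by (auto simp: vertices_project_cube)
    then show "\<Psi> t \<subseteq> \<Psi> s" unfolding \<Psi>_def using face_w[OF s t] by (rule A_mono)
  next
    fix s assume s: "s \<in> full_cubes \<Lambda> 0"
    then have "snd s = {}" by (auto simp: full_cubes_iff)
    then have "f s = frag_of (project_cube B s)"
      by (cases s) (auto simp: f_def project_map_def project_cube_def)
    then have "frag_extend g (f s) = g (project_cube B s)" "project_cube B s \<in> full_cubes \<Lambda>' 0"
      using f_cases[OF s] by (auto simp: frag_of_eq)
    then have "aug (frag_extend g (f s)) = frag_of ()" using g(3) by simp
    then show "aug (u s) = 0" by (simp add: u_def aug_def frag_extend_diff)
  qed
  then obtain h where h: "\<And>q s. s \<in> full_cubes \<Lambda> q \<Longrightarrow> Poly_Mapping.keys (h s) \<subseteq> full_cubes (\<Psi> s) (Suc q)"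
    "\<And>q s. s \<in> full_cubes \<Lambda> q \<Longrightarrow> bd (h s) = u s - frag_extend h (cube_boundary s)" by blast

  show ?thesis
  proof (rule homotopy_equivalence_imp_isomorphic[where f = f and g = g and H = h])
    fix q s t
    show "Poly_Mapping.keys (cube_boundary s) \<subseteq> cubes T q" if "s \<in> cubes T (Suc q)"
      using that full_cubes_face(1)[of "fst s" "snd s"] unfolding T by fastforce
    show "Poly_Mapping.keys (cube_boundary s) \<subseteq> cubes T' q" if "s \<in> cubes T' (Suc q)"
      using that full_cubes_face(1)[of "fst s" "snd s"] unfolding T' by fastforce
    show "?W t \<le> ?W s" if "s \<in> cubes T q" "t \<in> Poly_Mapping.keys (cube_boundary s)"
      using that face_w unfolding T by blast
    show "?W' t \<le> ?W' s" if "s \<in> cubes T' q" "t \<in> Poly_Mapping.keys (cube_boundary s)"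
      using that face_w unfolding T' by blast
    show "Poly_Mapping.keys (f s) \<subseteq> cubes T' q" if "s \<in> cubes T q"
      using f_cases[of s q] that unfolding T T' by auto
    show "?W' t \<le> ?W s" if "s \<in> cubes T q" "t \<in> Poly_Mapping.keys (f s)"
      using f_cases[of s q] proj_w[of s q] that unfolding T by auto
    show "bd (f s) = frag_extend f (cube_boundary s)" if "s \<in> cubes T q"
      using f_bd that unfolding T by blast
    show "Poly_Mapping.keys (g s) \<subseteq> cubes T q" if "s \<in> cubes T' q"
      using g(1) A_sub that unfolding T T' by blast
    show "?W t \<le> ?W' s" if "s \<in> cubes T' q" "t \<in> Poly_Mapping.keys (g s)"
      using g(1) A_weight that unfolding T' by blast
    show "bd (g s) = frag_extend g (cube_boundary s)" if "s \<in> cubes T' q"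
      using g(2) that unfolding T' by blast
    show "Poly_Mapping.keys (h s) \<subseteq> cubes T (Suc q)" if "s \<in> cubes T q"
      using h(1) A_sub that unfolding T \<Psi>_def by blast
    show "?W t \<le> ?W s" if "s \<in> cubes T q" "t \<in> Poly_Mapping.keys (h s)"
      using h(1) A_weight that unfolding T \<Psi>_def by blast
    show "bd (h s) = frag_extend g (f s) - frag_of s - frag_extend h (cube_boundary s)" if "s \<in> cubes T q"
      using h(2) that unfolding T u_def by blast
    show "frag_extend f (g s) = frag_of s" if "s \<in> cubes T' q"
      using fg that unfolding T' by blast
  qed
qed

section \<open>Negative definite lattices\<close>

text \<open>Gaussian elimination of one variable. The Schur complement \<open>M'\<close> is again
  symmetric and negative definite, so the induction hypothesis solves the reduced system.\<close>

lemma solve_negative_definite: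
  fixes M :: "'v \<Rightarrow> 'v \<Rightarrow> rat"
  assumes "finite J" and "\<And>i j. i \<in> J \<Longrightarrow> j \<in> J \<Longrightarrow> M i j = M j i"
    and "\<And>x. (\<exists>v\<in>J. x v \<noteq> 0) \<Longrightarrow> (\<Sum>i\<in>J. \<Sum>j\<in>J. x i * x j * M i j) < 0"
  shows "\<exists>x\<in>coords J. \<forall>j\<in>J. (\<Sum>i\<in>J. x i * M i j) = t j"
  using assms
proof (induction J arbitrary: M t rule: finite_induct)
  case empty
  then show ?case by (auto simp: coords_def intro!: exI[of _ 0])
next
  case (insert a J)
  define \<alpha> where "\<alpha> = M a a"
  have expand: "(\<Sum>i\<in>insert a J. \<Sum>j\<in>insert a J. x i * x j * M i j) =
     (\<Sum>i\<in>J. \<Sum>j\<in>J. x i * x j * M i j) + 2 * x a * (\<Sum>i\<in>J. x i * M i a) + x a * x a * \<alpha>" for x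
  proof -
    have "(\<Sum>j\<in>J. x a * x j * M a j) = x a * (\<Sum>i\<in>J. x i * M i a)"
      using insert.prems(1) by (auto simp: sum_distrib_left mult.assoc intro!: sum.cong)
    moreover have "(\<Sum>i\<in>J. x i * x a * M i a) = x a * (\<Sum>i\<in>J. x i * M i a)"
      by (simp add: sum_distrib_left mult_ac)
    ultimately show ?thesis
      using insert.hyps by (simp add: sum.distrib \<alpha>_def)
  qed
  have \<alpha>: "\<alpha> < 0"
  proof -
    have "(\<Sum>i\<in>insert a J. \<Sum>j\<in>insert a J. unit_vec a i * unit_vec a j * M i j) < 0"
      by (rule insert.prems(2)) (auto simp: unit_vec_def)
    moreover have "unit_vec a i = (0::rat)" if "i \<in> J" for i
      using that insert.hyps(2) by (auto simp: unit_vec_def)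
    ultimately show ?thesis unfolding expand by (simp add: unit_vec_def)
  qed
  define M' where "M' i j = M i j - M i a * M a j / \<alpha>" for i j
  have M'_sum: "(\<Sum>i\<in>J. x i * M' i j) = (\<Sum>i\<in>J. x i * M i j) - (\<Sum>i\<in>J. x i * M i a) * M a j / \<alpha>" for x j
    by (simp add: M'_def right_diff_distrib sum_subtractf sum_distrib_right sum_divide_distrib mult.assoc)
  have "\<exists>x\<in>coords J. \<forall>j\<in>J. (\<Sum>i\<in>J. x i * M' i j) = t j - t a * M a j / \<alpha>"
  proof (rule insert.IH)
    show "M' i j = M' j i" if "i \<in> J" "j \<in> J" for i j
      using insert.prems(1) that by (simp add: M'_def mult.commute)
    fix x assume x: "\<exists>v\<in>J. x v \<noteq> (0::rat)"
    define \<beta> where "\<beta> = (\<Sum>i\<in>J. x i * M i a)"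
    \<comment> \<open>This value maximizes the quadratic form over all extensions of
      \<open>x\<close> to the coordinate \<open>a\<close>, and the maximum is the form of the Schur
      complement at \<open>x\<close>.\<close>
    define y where "y = x(a := - \<beta> / \<alpha>)"
    have yJ: "y i = x i" if "i \<in> J" for i using that insert.hyps(2) by (auto simp: y_def)
    have ya: "y a = - \<beta> / \<alpha>" by (simp add: y_def)
    have "(\<Sum>i\<in>insert a J. \<Sum>j\<in>insert a J. y i * y j * M i j) < 0"
      by (rule insert.prems(2)) (use x yJ in auto)
    then have "(\<Sum>i\<in>J. \<Sum>j\<in>J. x i * x j * M i j) + 2 * y a * \<beta> + y a * y a * \<alpha> < 0"
      unfolding expand by (simp add: yJ \<beta>_def)
    also have "2 * y a * \<beta> + y a * y a * \<alpha> = - (\<beta> * \<beta> / \<alpha>)"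
      using \<alpha> by (simp add: ya field_simps)
    then have "(\<Sum>i\<in>J. \<Sum>j\<in>J. x i * x j * M i j) + 2 * y a * \<beta> + y a * y a * \<alpha> =
      (\<Sum>i\<in>J. \<Sum>j\<in>J. x i * x j * M i j) - \<beta> * \<beta> / \<alpha>" by simp
    also have "\<dots> = (\<Sum>i\<in>J. \<Sum>j\<in>J. x i * x j * M' i j)"
    proof -
      have "(\<Sum>j\<in>J. x j * M a j) = \<beta>"
        unfolding \<beta>_def using insert.prems(1) by (auto intro!: sum.cong)
      moreover have "(\<Sum>i\<in>J. \<Sum>j\<in>J. x i * M i a * (x j * M a j) / \<alpha>) = \<beta> * (\<Sum>j\<in>J. x j * M a j) / \<alpha>"
        by (simp add: \<beta>_def sum_product sum_divide_distrib)
      ultimately have "(\<Sum>i\<in>J. \<Sum>j\<in>J. x i * M i a * (x j * M a j) / \<alpha>) = \<beta> * \<beta> / \<alpha>"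
        by simp
      then show ?thesis
        by (simp add: M'_def right_diff_distrib sum_subtractf mult_ac)
    qed
    finally show "(\<Sum>i\<in>J. \<Sum>j\<in>J. x i * x j * M' i j) < 0" .
  qed
  then obtain x where x: "x \<in> coords J"
      "\<And>j. j \<in> J \<Longrightarrow> (\<Sum>i\<in>J. x i * M' i j) = t j - t a * M a j / \<alpha>" by blast
  define \<beta> where "\<beta> = (\<Sum>i\<in>J. x i * M i a)"
  \<comment> \<open>Back substitution: the new coordinate solves the \<open>a\<close>-th
    equation.\<close>
  define y where "y = x(a := (t a - \<beta>) / \<alpha>)"
  have ysum: "(\<Sum>i\<in>insert a J. y i * M i j) = (\<Sum>i\<in>J. x i * M i j) + (t a - \<beta>) / \<alpha> * M a j" for j
  proof -
    have "(\<Sum>i\<in>J. y i * M i j) = (\<Sum>i\<in>J. x i * M i j)"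
      using insert.hyps(2) by (auto simp: y_def intro!: sum.cong)
    then show ?thesis using insert.hyps by (simp add: y_def add.commute)
  qed
  show ?case
  proof (intro bexI[of _ y] ballI)
    show "y \<in> coords (insert a J)" using x(1) by (auto simp: y_def coords_def)
    fix j assume "j \<in> insert a J"
    then consider "j = a" | "j \<in> J" by blast
    then show "(\<Sum>i\<in>insert a J. y i * M i j) = t j"
    proof cases
      case 1
      then show ?thesis unfolding ysum using \<alpha> by (simp add: \<beta>_def[symmetric] \<alpha>_def[symmetric])
    next
      case 2
      have "(\<Sum>i\<in>J. x i * M i j) = t j - t a * M a j / \<alpha> + \<beta> * M a j / \<alpha>"
        using x(2)[OF 2] M'_sum[of x j] by (simp add: \<beta>_def)
      then show ?thesis unfolding ysum using \<alpha> by (simp add: field_simps)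
    qed
  qed
qed

lemma common_denominator:
  fixes x :: "'v \<Rightarrow> rat"
  assumes "finite S"
  shows "\<exists>N::int. 0 < N \<and> (\<forall>v\<in>S. of_int N * x v \<in> \<int>)"
  using assms
proof (induction S rule: finite_induct)
  case empty
  then show ?case by (intro exI[of _ 1]) simp
next
  case (insert a S)
  then obtain N where N: "0 < N" "\<forall>v\<in>S. of_int N * x v \<in> \<int>" by blast
  obtain p q :: int where pq: "x a = of_int p / of_int q" "0 < q"
    by (metis quotient_of_div quotient_of_denom_pos surj_pair)
  have "of_int (N * q) * x v \<in> \<int>" if v: "v \<in> insert a S" for v
  proof (cases "v = a")
    case True
    have "of_int (N * q) * x a = of_int (N * p)" using pq by simp
    then show ?thesis unfolding True by (metis Ints_of_int)
  next
    case False
    then have "of_int N * x v \<in> \<int>" using N(2) v by auto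
    then have "of_int q * (of_int N * x v) \<in> \<int>" by (rule Ints_mult[OF Ints_of_int])
    then show ?thesis by (simp add: mult_ac)
  qed
  then show ?case using N(1) pq(2) by (intro exI[of _ "N * q"]) auto
qed

text \<open>A least element lies below every minimal one and therefore is the only one; least
  elements thus evaluate the definite descriptions of \<open>l_min\<close> and
  \<open>x_cycle\<close>.\<close>

lemma unique_minimal_least:
  assumes "m \<in> A" "\<And>y. y \<in> A \<Longrightarrow> m \<le> y"
  shows "unique_minimal A = m"
  unfolding unique_minimal_def
proof (rule the_equality)
  show "m \<in> A \<and> (\<forall>y\<in>A. y \<le> m \<longrightarrow> y = m)" using assms by (auto intro: antisym)
  show "m' = m" if "m' \<in> A \<and> (\<forall>y\<in>A. y \<le> m' \<longrightarrow> y = m')" for m'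
    using that assms by metis
qed

text \<open>An element with smallest coordinate sum is least: its meet with an element not above it
  would have a smaller sum. The lower bound makes the sums well-founded.\<close>

lemma least_int_vector:
  fixes X :: "('v \<Rightarrow> int) set"
  assumes "finite J" "X \<subseteq> coords J" "X \<noteq> {}"
    and lb: "\<And>x v. x \<in> X \<Longrightarrow> v \<in> J \<Longrightarrow> lb v \<le> x v"
    and meet: "\<And>x y. x \<in> X \<Longrightarrow> y \<in> X \<Longrightarrow> (\<lambda>v. min (x v) (y v)) \<in> X"
  shows "\<exists>m\<in>X. \<forall>y\<in>X. m \<le> y"
proof -
  define size where "size x = nat (\<Sum>v\<in>J. x v - lb v)" for x
  obtain m where m: "m \<in> X" "\<And>y. y \<in> X \<Longrightarrow> size m \<le> size y"
    using ex_has_least_nat[of "\<lambda>x. x \<in> X" _ size] assms(3) by blast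
  have "m v \<le> y v" if y: "y \<in> X" for y v
  proof (rule ccontr)
    assume less: "\<not> m v \<le> y v"
    let ?n = "\<lambda>v. min (m v) (y v)"
    have n: "?n \<in> X" using m(1) y by (rule meet)
    have "m \<in> coords J" "y \<in> coords J" using m(1) y assms(2) by auto
    then have v: "v \<in> J" using less by (cases "v \<in> J") (auto simp: coords_def)
    have "(\<Sum>v\<in>J. ?n v - lb v) < (\<Sum>v\<in>J. m v - lb v)"
      by (rule sum_strict_mono_ex1) (use assms(1) v less in \<open>auto intro!: bexI[of _ v]\<close>)
    moreover have "0 \<le> (\<Sum>v\<in>J. ?n v - lb v)"
      using lb[OF n] by (intro sum_nonneg) simp
    ultimately have "size ?n < size m" by (simp add: size_def)
    then show False using m(2)[OF n] by simp
  qed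
  then show ?thesis using m(1) by (auto simp: le_fun_def)
qed

lemma rat_vec_add: "rat_vec (x + y) = rat_vec x + rat_vec y"
  by (auto simp: rat_vec_def)

lemma rat_vec_unit_vec: "rat_vec (unit_vec j) = unit_vec j"
  by (auto simp: rat_vec_def unit_vec_def)

section \<open>The intersection pairing of a negative definite graph\<close>

locale plumbing_lattice =
  fixes G :: "'v plumbing_graph"
  assumes finite_verts: "finite (verts G)"
    and adj_sym: "adj G i j \<Longrightarrow> adj G j i"
    and negdef: "negative_definite G"
begin

abbreviation S where "S \<equiv> verts G"

definition ip :: "('v \<Rightarrow> rat) \<Rightarrow> 'v \<Rightarrow> rat" where
  "ip x j = (\<Sum>i\<in>S. x i * of_int (form_basis G i j))"

lemma form_basis_sym: "form_basis G i j = form_basis G j i"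
  using adj_sym by (auto simp: form_basis_def)

lemma form_basis_nonneg: "i \<noteq> j \<Longrightarrow> 0 \<le> form_basis G i j"
  by (simp add: form_basis_def)

lemma form_eq: "form G x y = (\<Sum>j\<in>S. y j * ip x j)"
  unfolding form_def ip_def by (subst sum.swap) (simp add: sum_distrib_left mult_ac)

lemma form_unit_vec: "j \<in> S \<Longrightarrow> form G x (unit_vec j) = ip x j"
proof -
  assume j: "j \<in> S"
  have "form G x (unit_vec j) = (\<Sum>i\<in>S. if i = j then ip x j else 0)"
    unfolding form_eq by (rule sum.cong) (auto simp: unit_vec_def)
  then show ?thesis using j finite_verts by simp
qed

lemma form_sym: "form G x y = form G y (x :: 'v \<Rightarrow> rat)"
proof -
  have "form G x y = (\<Sum>i\<in>S. \<Sum>j\<in>S. y i * x j * of_int (form_basis G i j))"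
    unfolding form_def by (subst sum.swap) (simp add: form_basis_sym mult_ac)
  then show ?thesis by (simp add: form_def)
qed

lemma ip_add: "ip (x + y) j = ip x j + ip y j"
  by (simp add: ip_def distrib_right sum.distrib)

lemma ip_diff: "ip (x - y) j = ip x j - ip y j"
  by (simp add: ip_def left_diff_distrib sum_subtractf)

lemma ip_scale: "ip (\<lambda>v. c * x v) j = c * ip x j"
  by (simp add: ip_def sum_distrib_left mult.assoc)

lemma form_add_left: "form G (x + y) z = form G x z + form G y (z :: 'v \<Rightarrow> rat)"
  by (simp add: form_eq ip_add distrib_left sum.distrib)

lemma form_add_right: "form G z (x + y) = form G z x + form G z (y :: 'v \<Rightarrow> rat)"
  by (simp add: form_eq distrib_right sum.distrib)

lemma form_scale_left: "form G (\<lambda>v. c * x v) z = c * form G x (z :: 'v \<Rightarrow> rat)"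
  by (simp add: form_eq ip_scale sum_distrib_left mult_ac)

lemma form_scale_right: "form G z (\<lambda>v. c * x v) = c * form G z (x :: 'v \<Rightarrow> rat)"
  by (simp add: form_eq sum_distrib_left mult_ac)

text \<open>Off-diagonal entries of the form are nonnegative, so raising the other coordinates
  cannot decrease the pairing with \<open>E_j\<close>. Closure under minima and the persistence of
  slopes along cubes rest on this.\<close>

lemma ip_mono:
  assumes "\<And>i. i \<in> S \<Longrightarrow> x i \<le> y i" "x j = y j"
  shows "ip x j \<le> ip y j"
  unfolding ip_def
proof (rule sum_mono)
  fix i assume i: "i \<in> S"
  show "x i * of_int (form_basis G i j) \<le> y i * of_int (form_basis G i j)"
  proof (cases "i = j")
    case False
    then show ?thesis using assms(1)[OF i] form_basis_nonneg[OF False] by (intro mult_right_mono) auto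
  qed (simp add: assms(2))
qed

lemma form_rat_vec: "form G (rat_vec l) (rat_vec l) = of_int (form G l l)"
  by (simp add: form_def rat_vec_def)

lemma rat_vec_of_scaled:
  fixes x :: "'v \<Rightarrow> rat"
  assumes "x \<in> coords J" "\<And>v. v \<in> J \<Longrightarrow> of_int N * x v \<in> \<int>"
  obtains l where "l \<in> coords J" "\<And>v. of_int (l v) = of_int N * x v"
proof
  show "(\<lambda>v. \<lfloor>of_int N * x v\<rfloor>) \<in> coords J" using assms(1) by (auto simp: coords_def)
  show "of_int \<lfloor>of_int N * x v\<rfloor> = of_int N * x v" for v
    using assms by (cases "v \<in> J") (auto simp: coords_def)
qed

lemma rat_negative_definite:
  assumes "x \<in> coords S" "x \<noteq> (0 :: 'v \<Rightarrow> rat)"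
  shows "form G x x < 0"
proof -
  obtain N :: int where N: "0 < N" "\<forall>v\<in>S. of_int N * x v \<in> \<int>"
    using common_denominator[OF finite_verts] by blast
  obtain l where l: "l \<in> coords S" "\<And>v. of_int (l v) = of_int N * x v"
    using rat_vec_of_scaled[OF assms(1)] N(2) by blast
  have "l \<noteq> 0"
  proof
    assume "l = 0"
    then have "x v = 0" for v using l(2)[of v] N(1) by simp
    then show False using assms(2) by (auto simp: fun_eq_iff)
  qed
  then have "form G l l < 0" using negdef l(1) by (auto simp: negative_definite_def)
  moreover have "rat_vec l = (\<lambda>v. of_int N * x v)" using l(2) by (auto simp: rat_vec_def)
  then have "of_int (form G l l) = of_int N * (of_int N * form G x x)"
    by (simp add: form_rat_vec[symmetric] form_scale_left form_scale_right)
  ultimately have "of_int N * (of_int N * form G x x) < 0" by (metis of_int_less_0_iff)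
  then show ?thesis using N(1) by (simp add: mult_less_0_iff)
qed

lemma form_nonpos: "x \<in> coords S \<Longrightarrow> form G x x \<le> (0::rat)"
  using rat_negative_definite[of x] by (cases "x = 0") (auto simp: form_eq)

lemma ip_solvable:
  assumes "J \<subseteq> S"
  shows "\<exists>x\<in>coords J. \<forall>j\<in>J. ip x j = t j"
proof -
  have finJ: "finite J" using assms finite_verts finite_subset by blast
  have restrict: "(\<Sum>i\<in>S. h i) = (\<Sum>i\<in>J. h i)" if "\<And>i. i \<notin> J \<Longrightarrow> h i = 0" for h :: "'v \<Rightarrow> rat"
    by (rule sum.mono_neutral_right) (use assms finite_verts that in auto)
  have "\<exists>x\<in>coords J. \<forall>j\<in>J. (\<Sum>i\<in>J. x i * of_int (form_basis G i j)) = t j"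
  proof (rule solve_negative_definite[OF finJ])
    show "of_int (form_basis G i j) = (of_int (form_basis G j i) :: rat)" for i j
      by (simp add: form_basis_sym)
    fix x :: "'v \<Rightarrow> rat" assume x: "\<exists>v\<in>J. x v \<noteq> 0"
    define y where "y = (\<lambda>v. if v \<in> J then x v else 0)"
    have "y \<in> coords S" "y \<noteq> 0" using assms x by (auto simp: y_def coords_def fun_eq_iff)
    then have "form G y y < 0" by (rule rat_negative_definite)
    also have "form G y y = (\<Sum>i\<in>J. \<Sum>j\<in>S. y i * y j * of_int (form_basis G i j))"
      unfolding form_def by (rule restrict) (simp add: y_def)
    also have "\<dots> = (\<Sum>i\<in>J. \<Sum>j\<in>J. x i * x j * of_int (form_basis G i j))"
    proof (rule sum.cong[OF refl])
      fix i assume i: "i \<in> J"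
      have "(\<Sum>j\<in>S. y i * y j * of_int (form_basis G i j)) = (\<Sum>j\<in>J. y i * y j * of_int (form_basis G i j))"
        by (rule restrict) (simp add: y_def)
      then show "(\<Sum>j\<in>S. y i * y j * of_int (form_basis G i j)) =
          (\<Sum>j\<in>J. x i * x j * of_int (form_basis G i j))"
        using i by (simp add: y_def cong: sum.cong)
    qed
    finally show "(\<Sum>i\<in>J. \<Sum>j\<in>J. x i * x j * of_int (form_basis G i j)) < 0" .
  qed
  then obtain x where x: "x \<in> coords J" "\<forall>j\<in>J. (\<Sum>i\<in>J. x i * of_int (form_basis G i j)) = t j" by blast
  have "ip x j = (\<Sum>i\<in>J. x i * of_int (form_basis G i j))" for j
    unfolding ip_def by (rule restrict) (use x(1) in \<open>auto simp: coords_def\<close>)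
  then show ?thesis using x by (metis (no_types, lifting))
qed

text \<open>Write \<open>x = p - m\<close> with positive and negative parts. Their supports are
  disjoint, so \<open>(p, m) \<ge> 0\<close>, while \<open>(x, m) \<le> 0\<close> by hypothesis;
  hence \<open>(m, m) \<ge> 0\<close> and definiteness gives \<open>m = 0\<close>.\<close>

lemma antinef_nonneg:
  assumes "J \<subseteq> S" "x \<in> coords J" "\<And>j. j \<in> J \<Longrightarrow> ip x j \<le> 0"
  shows "0 \<le> x v"
proof -
  define p where "p = (\<lambda>v. max (x v) 0)"
  define m where "m = (\<lambda>v. max (- x v) 0)"
  have pm: "p = x + m" by (auto simp: p_def m_def)
  have mS: "m \<in> coords S" using assms(1,2) by (auto simp: m_def coords_def)
  have "form G x m \<le> 0"
    unfolding form_eq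
  proof (rule sum_nonpos)
    fix j assume "j \<in> S"
    show "m j * ip x j \<le> 0"
    proof (cases "j \<in> J")
      case True
      then show ?thesis using assms(3) by (simp add: m_def mult_nonneg_nonpos)
    next
      case False
      then show ?thesis using assms(2) by (simp add: m_def coords_def)
    qed
  qed
  moreover have "0 \<le> form G p m"
    unfolding form_def
  proof (intro sum_nonneg)
    fix i j assume "i \<in> S" "j \<in> S"
    show "0 \<le> p i * m j * of_int (form_basis G i j)"
    proof (cases "i = j")
      case True
      then have "p i * m j = 0" by (auto simp: p_def m_def max_def)
      then show ?thesis by (metis mult_zero_left order_refl)
    next
      case False
      then show ?thesis using form_basis_nonneg[OF False] by (simp add: p_def m_def)
    qed
  qed
  moreover have "form G p m = form G x m + form G m m" by (simp add: pm form_add_left)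
  ultimately have "0 \<le> form G m m" by simp
  then have "m = 0" using rat_negative_definite[OF mS] by force
  then have "max (- x v) 0 = 0" by (simp add: m_def fun_eq_iff)
  then show ?thesis by simp
qed

lemma ip_min:
  assumes "ip x j \<le> 0" "ip y j \<le> 0"
  shows "ip (\<lambda>v. min (x v) (y v)) j \<le> 0"
proof (cases "x j \<le> y j")
  case True
  then have "ip (\<lambda>v. min (x v) (y v)) j \<le> ip x j" by (intro ip_mono) auto
  then show ?thesis using assms by simp
next
  case False
  then have "ip (\<lambda>v. min (x v) (y v)) j \<le> ip y j" by (intro ip_mono) auto
  then show ?thesis using assms by simp
qed

text \<open>Common source of \<open>l_min\<close> (with \<open>J = S\<close>) and of
  \<open>x_cycle\<close> (with \<open>J = S - B\<close>, the bad coordinates being part of the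
  offset \<open>c\<close>). The solutions are closed under minima, so a lower bound and one solution
  suffice.\<close>

lemma least_antinef:
  fixes c :: "'v \<Rightarrow> rat"
  assumes J: "J \<subseteq> S"
  defines "X \<equiv> {x \<in> coords J. \<forall>j\<in>J. ip (rat_vec x + c) j \<le> 0}"
  shows "\<exists>m\<in>X. \<forall>y\<in>X. m \<le> y"
proof -
  have finJ: "finite J" using J finite_verts finite_subset by blast
  have sub: "X \<subseteq> coords J" by (auto simp: X_def)
  \<comment> \<open>The rational solution with all inequalities turned into equalities bounds every
    solution from below.\<close>
  obtain u where u: "u \<in> coords J" "\<And>j. j \<in> J \<Longrightarrow> ip u j = - ip c j"
    using ip_solvable[OF J, of "\<lambda>j. - ip c j"] by blast
  have lb: "\<lceil>u v\<rceil> \<le> x v" if x: "x \<in> X" for x v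
  proof -
    have "0 \<le> (rat_vec x - u) v"
    proof (rule antinef_nonneg[OF J])
      show "rat_vec x - u \<in> coords J" using x u(1) by (auto simp: X_def coords_def rat_vec_def)
      show "ip (rat_vec x - u) j \<le> 0" if "j \<in> J" for j
        using x u(2)[OF that] that by (simp add: X_def ip_diff ip_add)
    qed
    then show ?thesis by (simp add: rat_vec_def ceiling_le_iff)
  qed
  have meet: "(\<lambda>v. min (x v) (y v)) \<in> X" if "x \<in> X" "y \<in> X" for x y
  proof -
    have "rat_vec (\<lambda>v. min (x v) (y v)) + c = (\<lambda>v. min ((rat_vec x + c) v) ((rat_vec y + c) v))"
      by (auto simp: rat_vec_def min_def fun_eq_iff)
    then show ?thesis using that ip_min[of "rat_vec x + c" _ "rat_vec y + c"]
      by (auto simp: X_def coords_def)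
  qed
  \<comment> \<open>\<open>N\<close> times this vector is integral and pairs to \<open>- N\<close>
    with each direction of \<open>J\<close>; its multiple by \<open>K\<close> outweighs the
    contribution of \<open>c\<close>.\<close>
  obtain a where a: "a \<in> coords J" "\<And>j. j \<in> J \<Longrightarrow> ip a j = - 1"
    using ip_solvable[OF J, of "\<lambda>_. - 1"] by blast
  obtain N :: int where N: "0 < N" "\<forall>v\<in>J. of_int N * a v \<in> \<int>"
    using common_denominator[OF finJ] by blast
  obtain l where l: "l \<in> coords J" "\<And>v. of_int (l v) = of_int N * a v"
    using rat_vec_of_scaled[OF a(1)] N(2) by blast
  define K where "K = (\<Sum>j\<in>J. \<lceil>\<bar>ip c j\<bar>\<rceil>)"
  have K: "ip c j \<le> of_int K" if "j \<in> J" for j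
  proof -
    have "\<lceil>\<bar>ip c j\<bar>\<rceil> \<le> K"
      unfolding K_def by (rule member_le_sum) (use finJ that in auto)
    then show ?thesis by (simp add: ceiling_le_iff)
  qed
  have K0: "0 \<le> K" unfolding K_def by (rule sum_nonneg) simp
  have "(\<lambda>v. K * l v) \<in> X"
    unfolding X_def
  proof (intro CollectI conjI ballI)
    show "(\<lambda>v. K * l v) \<in> coords J" using l(1) by (auto simp: coords_def)
    fix j assume j: "j \<in> J"
    have "rat_vec (\<lambda>v. K * l v) = (\<lambda>v. of_int (K * N) * a v)"
      using l(2) by (auto simp: rat_vec_def)
    then have "ip (rat_vec (\<lambda>v. K * l v) + c) j = ip c j - of_int (K * N)"
      using a(2)[OF j] by (simp add: ip_add ip_scale)
    moreover have "K * 1 \<le> K * N" using K0 N(1) by (intro mult_left_mono) auto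
    then have "(of_int K :: rat) \<le> of_int (K * N)" by (simp only: of_int_le_iff)
    ultimately show "ip (rat_vec (\<lambda>v. K * l v) + c) j \<le> 0" using K[OF j] by linarith
  qed
  then have "X \<noteq> {}" by blast
  then show ?thesis
  proof (rule least_int_vector[OF finJ sub])
    show "\<lceil>u v\<rceil> \<le> x v" if "x \<in> X" "v \<in> J" for x v using that(1) by (rule lb)
    show "(\<lambda>v. min (x v) (y v)) \<in> X" if "x \<in> X" "y \<in> X" for x y using that by (rule meet)
  qed
qed

lemma dual_lattice_iff: "x \<in> dual_lattice G \<longleftrightarrow> x \<in> coords S \<and> (\<forall>j\<in>S. ip x j \<in> \<int>)"
proof
  assume x: "x \<in> dual_lattice G"
  have "ip x j \<in> \<int>" if j: "j \<in> S" for j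
  proof -
    have "unit_vec j \<in> int_lattice G" using j by (auto simp: coords_def unit_vec_def)
    then have "form G x (rat_vec (unit_vec j)) \<in> \<int>" using x by (simp add: dual_lattice_def)
    then show ?thesis using j by (simp add: rat_vec_unit_vec form_unit_vec)
  qed
  then show "x \<in> coords S \<and> (\<forall>j\<in>S. ip x j \<in> \<int>)" using x by (simp add: dual_lattice_def)
next
  assume x: "x \<in> coords S \<and> (\<forall>j\<in>S. ip x j \<in> \<int>)"
  then show "x \<in> dual_lattice G"
    by (auto simp: dual_lattice_def form_eq rat_vec_def intro!: Ints_sum Ints_mult)
qed

lemma k_can:
  shows k_can_coords: "k_can G \<in> coords S"
    and ip_k_can: "j \<in> S \<Longrightarrow> ip (k_can G) j = of_int (- dec G j - 2)"
proof -
  let ?P = "\<lambda>k. k \<in> dual_lattice G \<and> (\<forall>j\<in>S. form G k (unit_vec j) = of_int (- dec G j - 2))"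
  obtain x where x: "x \<in> coords S" "\<forall>j\<in>S. ip x j = of_int (- dec G j - 2)"
    using ip_solvable[of S "\<lambda>j. of_int (- dec G j - 2)"] by blast
  have "\<exists>!k. ?P k"
  proof (rule ex1I)
    show "?P x"
      unfolding dual_lattice_iff using x by (simp add: form_unit_vec del: of_int_diff of_int_minus)
    fix y assume y: "?P y"
    have "y - x \<in> coords S" using x y by (auto simp: dual_lattice_iff coords_def)
    moreover have "form G (y - x) (y - x) = 0"
      unfolding form_eq by (rule sum.neutral) (use x y in \<open>auto simp: form_unit_vec ip_diff\<close>)
    ultimately have "y - x = 0" using rat_negative_definite by force
    then show "y = x" by simp
  qed
  then have "?P (k_can G)" unfolding k_can_def by (rule theI')
  then show "k_can G \<in> coords S" and "j \<in> S \<Longrightarrow> ip (k_can G) j = of_int (- dec G j - 2)"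
    by (auto simp: dual_lattice_iff form_unit_vec)
qed

text \<open>The adjunction relations for \<open>k_can\<close> make \<chi> an explicit function of
  the decorations, which permits comparing two graphs that differ only there.\<close>

lemma chi_can:
  "\<chi> G (k_can G) y = - (1 / 2) * (form G (rat_vec y) (rat_vec y) - (\<Sum>j\<in>S. of_int (y j) * (of_int (dec G j) + 2)))"
proof -
  have "form G (rat_vec y) (k_can G) = form G (k_can G) (rat_vec y)"
    by (rule form_sym)
  also have "\<dots> = (\<Sum>j\<in>S. of_int (y j) * (- of_int (dec G j) - 2))"
    unfolding form_eq by (rule sum.cong) (simp_all add: ip_k_can rat_vec_def)
  also have "\<dots> = - (\<Sum>j\<in>S. of_int (y j) * (of_int (dec G j) + 2))"
    unfolding sum_negf[symmetric] by (rule sum.cong) (simp_all add: algebra_simps)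
  finally show ?thesis by (simp add: \<chi>_def form_add_right)
qed

text \<open>Completing the square with \<open>h = k / 2\<close> turns a bound on \<chi> into a bound
  on \<open>- (u, u)\<close> for \<open>u = x + h\<close>. Pairing with the dual basis vector
  \<open>e j\<close> reads off \<open>u j\<close>, and nonpositivity of the form at
  \<open>u + e j\<close> and \<open>u - e j\<close> bounds its absolute value.\<close>

lemma finite_sublevel:
  assumes "k \<in> coords S"
  shows "finite {x \<in> coords S. \<lfloor>\<chi> G k x\<rfloor> \<le> n}"
proof -
  have "\<exists>e. \<forall>j\<in>S. e j \<in> coords S \<and> (\<forall>i\<in>S. ip (e j) i = (if i = j then 1 else 0))"
  proof (intro bchoice ballI)
    fix j
    show "\<exists>y. y \<in> coords S \<and> (\<forall>i\<in>S. ip y i = (if i = j then 1 else 0))"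
      using ip_solvable[of S "\<lambda>i. if i = j then 1 else 0"] by blast
  qed
  then obtain e where e: "\<And>j. j \<in> S \<Longrightarrow> e j \<in> coords S"
      "\<And>i j. j \<in> S \<Longrightarrow> i \<in> S \<Longrightarrow> ip (e j) i = (if i = j then 1 else 0)" by blast
  define h where "h = (\<lambda>v. (1 / 2) * k v)"
  have h: "h \<in> coords S" using assms by (auto simp: h_def coords_def)
  \<comment> \<open>The summand 1 is the loss from the floor: the sublevel condition only gives
    \<chi> < \<open>n + 1\<close>.\<close>
  define N where "N = 2 * (of_int n + 1) - form G h h"
  define C where "C = (\<Sum>j\<in>S. \<lceil>\<bar>(N - form G (e j) (e j)) / 2\<bar> + \<bar>h j\<bar>\<rceil>)"
  have "\<bar>x j\<bar> \<le> C" if x: "x \<in> coords S" "\<lfloor>\<chi> G k x\<rfloor> \<le> n" and j: "j \<in> S" for x j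
  proof -
    define u where "u = rat_vec x + h"
    have u: "u \<in> coords S" using x(1) h by (auto simp: u_def coords_def rat_vec_def)
    have "\<chi> G k x < of_int n + 1" using x(2) by linarith
    moreover have "form G (rat_vec x) k = 2 * form G (rat_vec x) h"
      unfolding h_def by (simp only: form_scale_right)
    then have "form G u u = - 2 * \<chi> G k x + form G h h"
      by (simp add: u_def \<chi>_def form_add_left form_add_right form_sym[of h "rat_vec x"] field_simps)
    ultimately have uN: "- form G u u < N" by (simp add: N_def)
    have ue: "form G (e j) u = u j"
    proof -
      have "form G (e j) u = (\<Sum>i\<in>S. if i = j then u j else 0)"
        unfolding form_eq by (rule sum.cong) (simp_all add: e(2)[OF j])
      then show ?thesis using j finite_verts by simp
    qed
    have bound: "2 * t * u j \<le> N - form G (e j) (e j)" if t: "t * t = 1" for t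
    proof -
      let ?y = "u + (\<lambda>v. t * e j v)"
      have "?y \<in> coords S" using u e(1)[OF j] by (auto simp: coords_def)
      then have "form G ?y ?y \<le> 0" by (rule form_nonpos)
      moreover have "form G ?y ?y = form G u u + 2 * t * u j + (t * t) * form G (e j) (e j)"
        by (simp add: form_add_left form_add_right form_scale_left form_scale_right form_sym[of u "e j"] ue algebra_simps)
      ultimately show ?thesis using uN t by simp
    qed
    have "\<bar>u j\<bar> \<le> (N - form G (e j) (e j)) / 2" using bound[of 1] bound[of "- 1"] by auto
    then have "\<bar>of_int (x j) :: rat\<bar> \<le> \<bar>(N - form G (e j) (e j)) / 2\<bar> + \<bar>h j\<bar>"
      unfolding u_def rat_vec_def plus_fun_def by linarith
    also have "\<dots> \<le> of_int \<lceil>\<bar>(N - form G (e j) (e j)) / 2\<bar> + \<bar>h j\<bar>\<rceil>" by (rule le_of_int_ceiling)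
    also have "\<dots> \<le> of_int C"
      unfolding C_def of_int_le_iff
    proof (rule member_le_sum[OF j _ finite_verts])
      fix i
      have "- 1 < \<bar>(N - form G (e i) (e i)) / 2\<bar> + \<bar>h i\<bar>" by (rule less_le_trans[of _ 0]) simp_all
      then show "0 \<le> \<lceil>\<bar>(N - form G (e i) (e i)) / 2\<bar> + \<bar>h i\<bar>\<rceil>" by (simp add: zero_le_ceiling)
    qed
    finally show ?thesis by (metis of_int_abs of_int_le_iff)
  qed
  then have "{x \<in> coords S. \<lfloor>\<chi> G k x\<rfloor> \<le> n} \<subseteq> {x. \<forall>v. (v \<in> S \<longrightarrow> x v \<in> {- C..C}) \<and> (v \<notin> S \<longrightarrow> x v = 0)}"
    by (auto simp: coords_def abs_le_iff minus_le_iff)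
  moreover have "finite {x :: 'v \<Rightarrow> int. \<forall>v. (v \<in> S \<longrightarrow> x v \<in> {- C..C}) \<and> (v \<notin> S \<longrightarrow> x v = 0)}"
    by (rule finite_set_of_finite_funs) (use finite_verts in auto)
  ultimately show ?thesis by (rule finite_subset)
qed

end

lemma plumbing_latticeI: "is_tree G \<Longrightarrow> negative_definite G \<Longrightarrow> plumbing_lattice G"
  unfolding is_tree_def plumbing_lattice_def by blast

text \<open>Where \<open>y j\<close> is 0 or 1 it equals its square. Changing the decoration of such
  a vertex then changes \<open>(y, y)\<close> and the linear term of \<chi> by the same amount, so
  \<chi> of \<open>y\<close> is the same for the rational graph.\<close>

lemma chi_can_bad_vertices:
  assumes "is_tree G" "negative_definite G" "bad_vertices G B"
    and y: "y \<in> int_lattice G" "0 < y" "\<And>j. j \<in> B \<Longrightarrow> y j = 0 \<or> y j = 1"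
  shows "1 \<le> \<chi> G (k_can G) y"
proof -
  interpret plumbing_lattice G using assms(1,2) by (rule plumbing_latticeI)
  obtain b' where b': "\<forall>j\<in>verts G - B. b' j = dec G j" "rational_graph (G\<lparr>dec := b'\<rparr>)"
    using assms(3) by (auto simp: bad_vertices_def)
  let ?G' = "G\<lparr>dec := b'\<rparr>"
  interpret G': plumbing_lattice ?G'
    using b'(2) by (intro plumbing_latticeI) (auto simp: rational_graph_def)
  have "1 \<le> \<chi> ?G' (k_can ?G') y"
    using b'(2) y(1,2) by (simp add: rational_graph_def)
  also have "\<chi> ?G' (k_can ?G') y = \<chi> G (k_can G) y"
  proof -
    let ?d = "\<lambda>j. of_int (b' j - dec G j) :: rat"
    have diag: "form ?G' x x = form G x x + (\<Sum>i\<in>S. x i * x i * ?d i)" for x :: "'a \<Rightarrow> rat"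
    proof -
      have "(\<Sum>j\<in>S. x i * x j * of_int (form_basis ?G' i j)) =
          (\<Sum>j\<in>S. x i * x j * of_int (form_basis G i j)) + x i * x i * ?d i" if i: "i \<in> S" for i
      proof -
        have "(\<Sum>j\<in>S. x i * x j * of_int (form_basis ?G' i j)) =
          (\<Sum>j\<in>S. x i * x j * of_int (form_basis G i j) + (if j = i then x i * x i * ?d i else 0))"
          by (rule sum.cong) (auto simp: form_basis_def algebra_simps)
        then show ?thesis using i finite_verts by (simp add: sum.distrib)
      qed
      then show ?thesis by (simp add: form_def sum.distrib cong: sum.cong)
    qed
    have "(\<Sum>j\<in>S. of_int (y j) * (of_int (b' j) + 2)) =
      (\<Sum>j\<in>S. of_int (y j) * (of_int (dec G j) + 2)) + (\<Sum>j\<in>S. rat_vec y j * rat_vec y j * ?d j)"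
      unfolding sum.distrib[symmetric]
    proof (rule sum.cong[OF refl])
      fix j assume "j \<in> S"
      then show "of_int (y j) * (of_int (b' j) + 2) =
        of_int (y j) * (of_int (dec G j) + 2) + rat_vec y j * rat_vec y j * ?d j"
        using b'(1) y(3)[of j] by (cases "j \<in> B") (auto simp: rat_vec_def)
    qed
    then show ?thesis unfolding G'.chi_can chi_can diag by simp
  qed
  finally show ?thesis .
qed

section \<open>The fibres of the projection\<close>

lemma cubes_coords: "cubes (coords S) q = full_cubes (coords S) q"
proof -
  have "closed_cube (l, I) \<subseteq> coords S \<longleftrightarrow> (\<forall>J\<subseteq>I. l + ind J \<in> coords S)" for l :: "'a \<Rightarrow> int" and I
  proof
    assume sub: "closed_cube (l, I) \<subseteq> coords S"
    show "\<forall>J\<subseteq>I. l + ind J \<in> coords S"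
    proof (intro allI impI)
      fix J assume "J \<subseteq> I"
      then have "(\<lambda>v. of_int ((l + ind J) v)) \<in> closed_cube (l, I)"
        by (auto simp: closed_cube_def ind_def)
      then have "(\<lambda>v. of_int ((l + ind J) v)) \<in> (coords S :: ('a \<Rightarrow> real) set)" using sub by blast
      then show "l + ind J \<in> coords S" by (simp add: coords_def del: of_int_add)
    qed
  next
    assume V: "\<forall>J\<subseteq>I. l + ind J \<in> coords S"
    show "closed_cube (l, I) \<subseteq> coords S"
    proof
      fix x assume x: "x \<in> closed_cube (l, I)"
      have "x v = 0" if v: "v \<notin> S" for v
      proof -
        have l: "l v = 0" using V[rule_format, of "{}"] v by (simp add: coords_def)
        moreover have "v \<notin> I"
        proof
          assume "v \<in> I"
          then have "(l + ind {v}) v = 0" using V[rule_format, of "{v}"] v by (simp add: coords_def)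
          then show False using l by (simp add: ind_def)
        qed
        ultimately show ?thesis using x by (auto simp: closed_cube_def intro: antisym dest!: spec[of _ v])
      qed
      then show "x \<in> coords S" by (simp add: coords_def)
    qed
  qed
  then show ?thesis by (auto simp: cubes_def full_cubes_def)
qed

lemma cubes_first_quadrant: "cubes (first_quadrant B) q = full_cubes {i \<in> coords B. 0 \<le> i} q"
proof -
  have T: "first_quadrant B \<subseteq> coords B" by (auto simp: first_quadrant_def)
  have "s \<in> cubes (first_quadrant B) q \<longleftrightarrow> s \<in> full_cubes {i \<in> coords B. 0 \<le> i} q" for s :: "'a cube"
  proof (cases s)
    case (Pair l I)
    show ?thesis
    proof
      assume s: "s \<in> cubes (first_quadrant B) q"
      then have "s \<in> full_cubes (coords B) q" using T by (auto simp: cubes_def simp flip: cubes_coords)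
      moreover have "(\<lambda>v. of_int (l v)) \<in> closed_cube (l, I)" by (auto simp: closed_cube_def)
      then have "(\<lambda>v. of_int (l v)) \<in> first_quadrant B" using s Pair by (auto simp: cubes_def)
      then have "0 \<le> l" by (simp add: first_quadrant_def le_fun_def)
      ultimately show "s \<in> full_cubes {i \<in> coords B. 0 \<le> i} q"
        using Pair by (auto simp: full_cubes_def le_fun_def ind_def)
    next
      assume s: "s \<in> full_cubes {i \<in> coords B. 0 \<le> i} q"
      then have "s \<in> full_cubes (coords B) q" by (auto simp: full_cubes_def)
      then have "s \<in> cubes (coords B) q" by (simp add: cubes_coords)
      moreover have "l + ind {} \<in> {i \<in> coords B. 0 \<le> i}" using s Pair unfolding full_cubes_def by blast
      then have "0 \<le> l v" for v by (simp add: le_fun_def)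
      then have "0 \<le> x v" if "x \<in> closed_cube (l, I)" for x v
        using that by (auto simp: closed_cube_def intro: order_trans[of 0 "real_of_int (l v)"])
      ultimately show "s \<in> cubes (first_quadrant B) q"
        using Pair by (auto simp: cubes_def first_quadrant_def)
    qed
  qed
  then show ?thesis by blast
qed

text \<open>The bad-vertex property enters only through \<open>rationality\<close>, a statement
  about the decorations of \<open>G\<close> itself.\<close>

locale bad_vertex_lattice = plumbing_lattice G
  for G :: "('v::linorder) plumbing_graph" +
  fixes B :: "'v set" and k :: "'v \<Rightarrow> rat"
  assumes B_sub: "B \<subseteq> verts G"
    and k_char: "k \<in> characteristic_elements G"
    and rationality: "y \<in> coords (verts G) \<Longrightarrow> 0 < y \<Longrightarrow> (\<And>j. j \<in> B \<Longrightarrow> y j = 0 \<or> y j = 1) \<Longrightarrow>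
       1 \<le> \<chi> G (k_can G) y"
begin

lemma ip_rat_vec_Ints: "ip (rat_vec l) j \<in> \<int>"
  by (auto simp: ip_def rat_vec_def intro!: Ints_sum Ints_mult)

text \<open>With \<open>k = k_can + 2 l'\<close>, the coset in question is \<open>l' + L\<close>,
  and its least antinef element is \<open>l'\<close> plus the least vector \<open>m\<close> of
  \<open>least_antinef\<close>. The last claim is the minimality of \<open>l_min G k\<close>,
  translated so that it becomes a criterion for being nonnegative.\<close>

lemma l_min:
  shows l_min_coords: "l_min G k \<in> coords S"
    and ip_l_min_Ints: "j \<in> S \<Longrightarrow> ip (l_min G k) j \<in> \<int>"
    and ip_l_min_nonpos: "j \<in> S \<Longrightarrow> ip (l_min G k) j \<le> 0"
    and nonneg_if_antinef: "x \<in> coords S \<Longrightarrow> (\<And>j. j \<in> S \<Longrightarrow> ip (rat_vec x + l_min G k) j \<le> 0) \<Longrightarrow> 0 \<le> x"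
proof -
  obtain l' where l': "l' \<in> dual_lattice G" "k = (\<lambda>v. k_can G v + 2 * l' v)"
    using k_char by (auto simp: characteristic_elements_def)
  define X where "X = {x \<in> coords S. \<forall>j\<in>S. ip (rat_vec x + l') j \<le> 0}"
  obtain m where m: "m \<in> X" "\<And>y. y \<in> X \<Longrightarrow> m \<le> y"
    using least_antinef[OF order_refl, of l'] unfolding X_def by blast
  define A where "A = {m \<in> S_cone G. (\<lambda>v. k_can G v + 2 * m v) \<in> char_class G k}"
  have eq: "l_min G k = rat_vec m + l'"
    unfolding l_min_def A_def[symmetric]
  proof (rule unique_minimal_least)
    have "rat_vec m + l' \<in> dual_lattice G"
      using l'(1) m(1) ip_rat_vec_Ints
      by (auto simp: dual_lattice_iff ip_add X_def coords_def rat_vec_def intro!: Ints_add)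
    moreover have "(\<lambda>v. k_can G v + 2 * (rat_vec m + l') v) \<in> char_class G k"
      using m(1) by (auto simp: char_class_def l'(2) X_def algebra_simps intro!: exI[of _ m])
    ultimately show "rat_vec m + l' \<in> A"
      using m(1) by (auto simp: A_def S_cone_def X_def form_unit_vec)
    fix y assume y: "y \<in> A"
    then obtain l where l: "l \<in> coords S" "(\<lambda>v. k_can G v + 2 * y v) = (\<lambda>v. k v + 2 * rat_vec l v)"
      by (auto simp: A_def char_class_def)
    have yl: "y = rat_vec l + l'"
    proof
      fix v show "y v = (rat_vec l + l') v" using fun_cong[OF l(2), of v] by (simp add: l'(2))
    qed
    have "l \<in> X" using y l(1) by (auto simp: A_def S_cone_def X_def form_unit_vec yl[symmetric])
    then have "m \<le> l" by (rule m(2))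
    then show "rat_vec m + l' \<le> y" by (simp add: yl le_fun_def rat_vec_def)
  qed
  show "l_min G k \<in> coords S"
    using l'(1) m(1) by (auto simp: eq X_def dual_lattice_iff coords_def rat_vec_def)
  show "ip (l_min G k) j \<in> \<int>" if "j \<in> S"
    using l'(1) that ip_rat_vec_Ints by (auto simp: eq ip_add dual_lattice_iff intro!: Ints_add)
  show "ip (l_min G k) j \<le> 0" if "j \<in> S" using m(1) that by (simp add: eq X_def)
  show "0 \<le> x" if x: "x \<in> coords S" "\<And>j. j \<in> S \<Longrightarrow> ip (rat_vec x + l_min G k) j \<le> 0"
  proof -
    have "x + m \<in> X"
      using x m(1) by (auto simp: X_def coords_def eq rat_vec_add add.assoc)
    then have "m \<le> x + m" by (rule m(2))
    then show ?thesis by (simp add: le_fun_def)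
  qed
qed

text \<open>In the notation of the paper, \<open>(x + l'\<^bsub>[k]\<^esub>, E\<^sub>j)\<close>.\<close>

definition slope :: "'v \<Rightarrow> ('v \<Rightarrow> int) \<Rightarrow> rat" where
  "slope j x = ip (rat_vec x + l_min G k) j"

definition weight :: "('v \<Rightarrow> int) \<Rightarrow> int" where
  "weight x = \<lfloor>\<chi> G (distinguished_rep G k) x\<rfloor>"

lemma slope_Ints: "j \<in> S \<Longrightarrow> slope j x \<in> \<int>"
  by (auto simp: slope_def ip_add intro!: Ints_add ip_rat_vec_Ints ip_l_min_Ints)

lemma slope_mono:
  assumes "\<And>v. v \<in> S \<Longrightarrow> x v \<le> y v" "x j = y j"
  shows "slope j x \<le> slope j y"
  unfolding slope_def by (rule ip_mono) (use assms in \<open>auto simp: rat_vec_def\<close>)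

lemma slope_zero: "j \<in> S \<Longrightarrow> slope j 0 \<le> 0"
  using ip_l_min_nonpos[of j] by (simp add: slope_def ip_add) (simp add: ip_def rat_vec_def)

lemma ip_unit_vec: "j \<in> S \<Longrightarrow> ip (unit_vec j) j = of_int (dec G j)"
proof -
  assume j: "j \<in> S"
  have "ip (unit_vec j) j = (\<Sum>i\<in>S. if i = j then of_int (dec G j) else 0)"
    unfolding ip_def by (rule sum.cong) (auto simp: unit_vec_def form_basis_def)
  then show ?thesis using j finite_verts by simp
qed

lemma slope_add_unit_vec: "j \<in> S \<Longrightarrow> slope j (x + unit_vec j) = slope j x + of_int (dec G j)"
  by (simp add: slope_def rat_vec_add rat_vec_unit_vec ip_add ip_unit_vec)

text \<open>Polarization: the passage from \<open>k_can\<close> to the distinguished representative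
  contributes \<open>(y, l_min G k)\<close>, which combines with \<open>(y, z)\<close> to the slopes
  at \<open>z\<close>.\<close>

lemma chi_add:
  "\<chi> G (distinguished_rep G k) (z + y) = \<chi> G (distinguished_rep G k) z + \<chi> G (k_can G) y
     - (\<Sum>j\<in>S. of_int (y j) * slope j z)"
proof -
  have k: "distinguished_rep G k = k_can G + (\<lambda>v. 2 * l_min G k v)"
    by (auto simp: distinguished_rep_def)
  have "(\<Sum>j\<in>S. of_int (y j) * slope j z) = form G (rat_vec z + l_min G k) (rat_vec y)"
    by (simp add: form_eq slope_def rat_vec_def)
  also have "\<dots> = form G (rat_vec y) (rat_vec z) + form G (rat_vec y) (l_min G k)"
    by (simp add: form_sym[of _ "rat_vec y"] form_add_right)
  finally show ?thesis
    by (simp add: \<chi>_def k rat_vec_add form_add_left form_add_right form_scale_right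
        form_sym[of "rat_vec z" "rat_vec y"] field_simps)
qed

lemma chi_can_unit_vec: "j \<in> S \<Longrightarrow> \<chi> G (k_can G) (unit_vec j) = 1"
proof -
  assume j: "j \<in> S"
  have "(\<Sum>i\<in>S. of_int (unit_vec j i) * (of_int (dec G i) + 2)) =
      (\<Sum>i\<in>S. if i = j then of_int (dec G j) + (2::rat) else 0)"
    by (rule sum.cong) (auto simp: unit_vec_def)
  then have "(\<Sum>i\<in>S. of_int (unit_vec j i) * (of_int (dec G i) + 2)) = of_int (dec G j) + (2::rat)"
    using j finite_verts by simp
  moreover have "form G (unit_vec j) (unit_vec j) = (of_int (dec G j) :: rat)"
    using form_unit_vec[OF j] ip_unit_vec[OF j] by simp
  ultimately show ?thesis by (simp add: chi_can rat_vec_unit_vec)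
qed

lemma chi_add_unit_vec:
  "j \<in> S \<Longrightarrow> \<chi> G (distinguished_rep G k) (x + unit_vec j) = \<chi> G (distinguished_rep G k) x + 1 - slope j x"
proof -
  assume j: "j \<in> S"
  have "(\<Sum>i\<in>S. of_int (unit_vec j i) * slope i x) = (\<Sum>i\<in>S. if i = j then slope j x else 0)"
    by (rule sum.cong) (auto simp: unit_vec_def)
  then show ?thesis using j finite_verts by (simp add: chi_add chi_can_unit_vec)
qed

text \<open>A unit step changes \<chi> by \<open>1 - slope\<close>, and slopes are integers, so a
  positive slope is at least 1.\<close>

lemma weight_raise:
  assumes "j \<in> S" "0 < slope j x"
  shows "weight (x + unit_vec j) \<le> weight x"
proof -
  have "1 \<le> slope j x"
    using assms(2) slope_Ints[OF assms(1), of x] by (auto elim!: Ints_cases)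
  then show ?thesis
    unfolding weight_def chi_add_unit_vec[OF assms(1)] by (intro floor_mono) simp
qed

text \<open>The unit step read backwards: the slope is taken at the lower end, where the threshold
  is 1.\<close>

lemma weight_lower:
  assumes "j \<in> S" "slope j (x - unit_vec j) \<le> 1"
  shows "weight (x - unit_vec j) \<le> weight x"
  using chi_add_unit_vec[OF assms(1), of "x - unit_vec j"] assms(2)
  unfolding weight_def by (intro floor_mono) simp

lemma finite_weight_sublevel: "finite {x \<in> coords S. weight x \<le> n}"
  unfolding weight_def
  by (rule finite_sublevel)
    (use k_can_coords l_min_coords in \<open>auto simp: distinguished_rep_def coords_def\<close>)

abbreviation xc where "xc \<equiv> x_cycle G B k"

text \<open>The bad coordinates are fixed to \<open>i\<close>, so only the part supported on
  \<open>S - B\<close> varies and \<open>least_antinef\<close> applies. The last claim extends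
  minimality to all vectors whose bad coordinates are at least those of \<open>i\<close>.\<close>

lemma x_cycle:
  assumes i: "i \<in> coords B"
  shows x_cycle_coords: "xc i \<in> coords S"
    and x_cycle_eq: "j \<in> B \<Longrightarrow> xc i j = i j"
    and slope_x_cycle: "j \<in> S - B \<Longrightarrow> slope j (xc i) \<le> 0"
    and x_cycle_le: "x \<in> coords S \<Longrightarrow> (\<And>j. j \<in> B \<Longrightarrow> i j \<le> x j) \<Longrightarrow>
           (\<And>j. j \<in> S - B \<Longrightarrow> slope j x \<le> 0) \<Longrightarrow> xc i \<le> x"
proof -
  define X where "X = {x \<in> coords (S - B). \<forall>j\<in>S - B. ip (rat_vec x + (rat_vec i + l_min G k)) j \<le> 0}"
  obtain m where m: "m \<in> X" "\<And>y. y \<in> X \<Longrightarrow> m \<le> y"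
    using least_antinef[of "S - B" "rat_vec i + l_min G k"] unfolding X_def by blast
  define A where "A = {x \<in> int_lattice G. (\<forall>j\<in>B. x j = i j) \<and>
     (\<forall>j\<in>verts G - B. form G (rat_vec x + l_min G k) (unit_vec j) \<le> 0)}"
  have A: "x \<in> A \<longleftrightarrow> x \<in> coords S \<and> (\<forall>j\<in>B. x j = i j) \<and> (\<forall>j\<in>S - B. slope j x \<le> 0)" for x
    by (auto simp: A_def slope_def form_unit_vec)
  have m_in: "m + i \<in> A"
    using m(1) i B_sub by (auto simp: A X_def coords_def slope_def rat_vec_add add.assoc)
  have least: "m + i \<le> y" if y: "y \<in> A" for y
  proof -
    have "y - i \<in> coords (S - B)" using y i by (auto simp: A coords_def)
    moreover have "ip (rat_vec (y - i) + (rat_vec i + l_min G k)) j = slope j y" for j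
      unfolding slope_def by (rule arg_cong[of _ _ "\<lambda>x. ip x j"]) (auto simp: rat_vec_def)
    ultimately have "y - i \<in> X" using y by (auto simp: X_def A)
    then have "m \<le> y - i" by (rule m(2))
    then show ?thesis by (simp add: le_fun_def algebra_simps)
  qed
  have eq: "xc i = m + i"
    unfolding x_cycle_def A_def[symmetric] using m_in least by (rule unique_minimal_least)
  show "xc i \<in> coords S" "j \<in> B \<Longrightarrow> xc i j = i j" "j \<in> S - B \<Longrightarrow> slope j (xc i) \<le> 0"
    using m_in unfolding eq A by blast+
  show "xc i \<le> x" if x: "x \<in> coords S" "\<And>j. j \<in> B \<Longrightarrow> i j \<le> x j" "\<And>j. j \<in> S - B \<Longrightarrow> slope j x \<le> 0"
  proof -
    \<comment> \<open>The minimum with \<open>x(i)\<close> has bad coordinates exactly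
      \<open>i\<close> and inherits the slope conditions, so it competes in the definition of
      \<open>x(i)\<close>.\<close>
    let ?y = "\<lambda>v. min (x v) ((m + i) v)"
    have "slope j ?y \<le> 0" if j: "j \<in> S - B" for j
    proof (cases "x j \<le> (m + i) j")
      case True
      then have "slope j ?y \<le> slope j x" by (intro slope_mono) auto
      then show ?thesis using x(3)[OF j] by simp
    next
      case False
      then have "slope j ?y \<le> slope j (m + i)" by (intro slope_mono) auto
      also have "\<dots> \<le> 0" using m_in j by (simp add: A)
      finally show ?thesis .
    qed
    moreover have "?y \<in> coords S" using x(1) m_in by (auto simp: A coords_def)
    moreover have "?y j = i j" if "j \<in> B" for j using x(2)[OF that] m_in that by (auto simp: A)
    ultimately have "?y \<in> A" by (auto simp: A)
    then have "m + i \<le> ?y" by (rule least)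
    then show ?thesis unfolding eq by (simp add: le_fun_def)
  qed
qed

text \<open>The part of the preimage of a quadrant cube without negative bad coordinates: the
  conditions are on the coordinates themselves rather than on their positive parts.\<close>

definition fibre :: "('v \<Rightarrow> int) \<Rightarrow> 'v set \<Rightarrow> int \<Rightarrow> ('v \<Rightarrow> int) set" where
  "fibre i I n = {x \<in> coords S. (\<forall>b\<in>B. x b = i b \<or> (b \<in> I \<and> x b = i b + 1)) \<and> weight x \<le> n}"

lemma finite_fibre: "finite (fibre i I n)"
  by (rule finite_subset[OF _ finite_weight_sublevel[of n]]) (auto simp: fibre_def)

text \<open>
  The argument behind Laufer's rationality criterion: if no coordinate in which \<open>x\<close> exceeds \<open>z\<close>
  could be lowered, summing the slopes over the excess \<open>(x - z)\<^sup>+\<close> would contradict \<open>\<chi> \<ge> 1\<close>.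
\<close>

lemma lowering_direction:
  assumes z: "z \<in> coords S" and x: "x \<in> coords S" "\<not> x \<le> z"
    and B: "\<And>b. b \<in> B \<Longrightarrow> x b \<le> z b + 1"
    and slope: "\<And>j. j \<in> S \<Longrightarrow> z j < x j \<Longrightarrow> slope j z \<le> 0"
  shows "\<exists>j\<in>S. z j < x j \<and> slope j (x - unit_vec j) \<le> 1"
proof (rule ccontr)
  assume neg: "\<not> ?thesis"
  define p where "p = (\<lambda>v. max (x v - z v) 0)"
  have pS: "p \<in> coords S" using x(1) z by (auto simp: p_def coords_def)
  obtain v where v: "z v < x v" using x(2) by (auto simp: le_fun_def not_le)
  have "0 \<le> p" by (simp add: p_def le_fun_def)
  moreover have "p \<noteq> 0"
  proof
    assume "p = 0"
    then have "p v = 0" by simp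
    then show False using v by (simp add: p_def)
  qed
  ultimately have "0 < p" by (simp add: less_le)
  moreover have "p j = 0 \<or> p j = 1" if "j \<in> B" for j using B[OF that] by (auto simp: p_def)
  ultimately have chi: "1 \<le> \<chi> G (k_can G) p" using pS by (intro rationality) auto
  \<comment> \<open>If \<open>j\<close> cannot be lowered, the integral slope at
    \<open>x - unit_vec j\<close> is at least 2, so the slope at \<open>x\<close> is at least
    \<open>dec G j + 2\<close>. As \<open>z + p\<close> is the maximum of \<open>z\<close> and
    \<open>x\<close>, it agrees with \<open>x\<close> at \<open>j\<close> and its slope there is no
    smaller. Summation contradicts \<chi> \<ge> 1 at \<open>p\<close>.\<close>
  have "of_int (p j) * (of_int (dec G j) + 2) \<le> of_int (p j) * slope j (z + p)" if j: "j \<in> S" for j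
  proof (cases "z j < x j")
    case False
    then have "p j = 0" by (simp add: p_def)
    then show ?thesis by simp
  next
    case True
    have "1 < slope j (x - unit_vec j)" using neg j True by force
    moreover have "slope j (x - unit_vec j) \<in> \<int>" by (rule slope_Ints[OF j])
    ultimately have "2 \<le> slope j (x - unit_vec j)" by (auto elim!: Ints_cases)
    then have "of_int (dec G j) + 2 \<le> slope j x"
      using slope_add_unit_vec[OF j, of "x - unit_vec j"] by simp
    also have "\<dots> \<le> slope j (z + p)" by (rule slope_mono) (use True in \<open>auto simp: p_def\<close>)
    finally show ?thesis by (intro mult_left_mono) (auto simp: p_def)
  qed
  then have "(\<Sum>j\<in>S. of_int (p j) * (of_int (dec G j) + 2)) \<le> (\<Sum>j\<in>S. of_int (p j) * slope j (z + p))"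
    by (rule sum_mono)
  also have "\<dots> = (\<Sum>j\<in>S. of_int (p j) * slope j z) + form G (rat_vec p) (rat_vec p)"
  proof -
    have "slope j (z + p) = slope j z + ip (rat_vec p) j" for j
      by (simp add: slope_def rat_vec_add ip_add)
    then show ?thesis
      by (simp add: form_eq distrib_left sum.distrib) (simp add: rat_vec_def)
  qed
  also have "(\<Sum>j\<in>S. of_int (p j) * slope j z) \<le> 0"
  proof (rule sum_nonpos)
    fix j assume j: "j \<in> S"
    show "of_int (p j) * slope j z \<le> 0"
    proof (cases "z j < x j")
      case True
      then show ?thesis using slope[OF j] by (simp add: p_def mult_nonneg_nonpos)
    qed (simp add: p_def)
  qed
  finally show False using chi unfolding chi_can by simp
qed

text \<open>Points not below \<open>x(i)\<close> are lowered; the slope condition on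
  \<open>I\<close> covers the bad coordinates that can exceed those of \<open>x(i)\<close>. What
  remains has bad coordinates \<open>i\<close> and is raised to \<open>x(i)\<close>. Intersecting
  with \<open>{xc i}\<close> allows for \<open>x(i)\<close> being too heavy, and the nonemptiness
  claim then says that any point of the fibre forces \<open>x(i)\<close> into it.\<close>

lemma collapse_fibre_to_x_cycle:
  assumes i: "i \<in> coords B" and slope: "\<And>b. b \<in> I \<Longrightarrow> b \<in> B \<Longrightarrow> slope b (xc i) \<le> 0"
  shows "(acyclic_set (fibre i I n \<inter> {xc i}) \<longrightarrow> acyclic_set (fibre i I n)) \<and>
     (fibre i I n \<noteq> {} \<longrightarrow> fibre i I n \<inter> {xc i} \<noteq> {})"
proof -
  let ?V = "fibre i I n" and ?z = "xc i"
  note zS = x_cycle_coords[OF i] and zB = x_cycle_eq[OF i] and zslope = slope_x_cycle[OF i]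
  define D where "D = {x \<in> ?V. \<not> x \<le> ?z}"
  have above: "(acyclic_set (?V - D) \<longrightarrow> acyclic_set ?V) \<and> (?V \<noteq> {} \<longrightarrow> ?V - D \<noteq> {})"
  proof (rule collapse_above[OF finite_fibre])
    show "D \<subseteq> ?V" by (auto simp: D_def)
    show "y \<in> D" if "x \<in> D" "y \<in> ?V" "x \<le> y" for x y
      using that by (auto simp: D_def dest: order_trans)
    fix x assume "x \<in> D"
    then have x: "x \<in> coords S" "\<not> x \<le> ?z" and xB: "\<And>b. b \<in> B \<Longrightarrow> x b = i b \<or> (b \<in> I \<and> x b = i b + 1)"
      by (auto simp: D_def fibre_def)
    have "\<exists>j\<in>S. ?z j < x j \<and> slope j (x - unit_vec j) \<le> 1"
    proof (rule lowering_direction[OF zS x])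
      show "x b \<le> ?z b + 1" if "b \<in> B" for b using xB[OF that] zB[OF that] by auto
      show "slope j ?z \<le> 0" if "j \<in> S" "?z j < x j" for j
        using that xB[of j] zB[of j] zslope[of j] slope[of j] by (cases "j \<in> B") auto
    qed
    then obtain j where j: "j \<in> S" "?z j < x j" "slope j (x - unit_vec j) \<le> 1" by blast
    show "\<exists>j. \<forall>J. finite J \<longrightarrow> j \<notin> J \<longrightarrow> x - ind J \<in> ?V \<longrightarrow> x - ind J - unit_vec j \<in> ?V"
    proof (intro exI allI impI)
      fix J assume J: "finite J" "j \<notin> J" "x - ind J \<in> ?V"
      have "slope j (x - ind J - unit_vec j) \<le> slope j (x - unit_vec j)"
        using J(2) by (intro slope_mono) (auto simp: ind_def unit_vec_def)
      then have "weight (x - ind J - unit_vec j) \<le> weight (x - ind J)"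
        using j by (intro weight_lower) auto
      \<comment> \<open>A bad coordinate exceeding that of \<open>x(i)\<close> is the upper end of
        the cube, so lowering it stays in the fibre.\<close>
      moreover have "x j = i j + 1" if "j \<in> B" using xB[OF that] zB[OF that] j(2) by auto
      ultimately show "x - ind J - unit_vec j \<in> ?V"
        using J j(1) by (auto simp: fibre_def coords_def unit_vec_def ind_def)
    qed
  qed
  define V1 where "V1 = ?V - D"
  have V1: "x \<in> V1 \<longleftrightarrow> x \<in> ?V \<and> x \<le> ?z" for x by (auto simp: V1_def D_def)
  have below: "(acyclic_set (V1 - (V1 - {?z})) \<longrightarrow> acyclic_set V1) \<and> (V1 \<noteq> {} \<longrightarrow> V1 - (V1 - {?z}) \<noteq> {})"
  proof (rule collapse_below)
    show "finite V1" by (simp add: V1_def finite_fibre)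
    show "y \<in> V1 - {?z}" if "x \<in> V1 - {?z}" "y \<in> V1" "y \<le> x" for x y
      using that by (auto simp: V1)
    fix x assume "x \<in> V1 - {?z}"
    then have x: "x \<in> coords S" "x \<le> ?z" "x \<noteq> ?z" and xB: "\<And>b. b \<in> B \<Longrightarrow> i b \<le> x b"
      by (auto simp: V1 fibre_def)
    have "\<not> ?z \<le> x" using x by auto
    then obtain j where j: "j \<in> S - B" "0 < slope j x"
      using x_cycle_le[OF i x(1) xB] by (meson not_le)
    have "x j \<noteq> ?z j"
    proof
      assume "x j = ?z j"
      then have "slope j x \<le> slope j ?z" using x(2) by (intro slope_mono) (auto simp: le_fun_def)
      then show False using j zslope[OF j(1)] by simp
    qed
    then have less: "x j < ?z j" using x(2) by (simp add: le_fun_def less_le)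
    show "\<exists>j. \<forall>J. finite J \<longrightarrow> j \<notin> J \<longrightarrow> x + ind J \<in> V1 \<longrightarrow> x + ind J + unit_vec j \<in> V1"
    proof (intro exI allI impI)
      fix J assume J: "finite J" "j \<notin> J" "x + ind J \<in> V1"
      have "slope j x \<le> slope j (x + ind J)"
        using J(2) by (intro slope_mono) (auto simp: ind_def)
      then have "weight (x + ind J + unit_vec j) \<le> weight (x + ind J)"
        using j by (intro weight_raise) auto
      then have "x + ind J + unit_vec j \<in> ?V"
        using J j(1) by (auto simp: V1 fibre_def coords_def unit_vec_def)
      moreover have "x + ind J + unit_vec j \<le> ?z"
        using J(2,3) less by (auto simp: V1 le_fun_def unit_vec_def ind_def)
      ultimately show "x + ind J + unit_vec j \<in> V1" by (simp add: V1)
    qed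
  qed auto
  have "V1 - (V1 - {?z}) = ?V \<inter> {?z}" by (auto simp: V1)
  then show ?thesis using above below by (simp add: V1_def[symmetric])
qed

text \<open>
  If some direction \<open>b\<close> of the cube satisfies \<open>(x(i) + l'\<^bsub>[k]\<^esub>, E\<^sub>b) > 0\<close>, the fibre collapses onto the part over
  the face \<open>x\<^sub>b = i\<^sub>b + 1\<close>; otherwise it collapses onto the single point \<open>x(i)\<close>.
\<close>

lemma acyclic_fibre:
  assumes "finite I" "I \<subseteq> B" "i \<in> coords B" "\<And>J. J \<subseteq> I \<Longrightarrow> weight (xc (i + ind J)) \<le> n"
  shows "acyclic_set (fibre i I n)"
  using assms
proof (induction "card I" arbitrary: i I)
  case (0 I i)
  then have "I = {}" by simp
  have "xc i \<in> fibre i I n"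
    using x_cycle_coords[OF 0(4)] x_cycle_eq[OF 0(4)] 0(5)[of "{}"] by (simp add: fibre_def)
  then have "fibre i I n \<inter> {xc i} = {xc i}" by auto
  then show ?case
    using collapse_fibre_to_x_cycle[OF 0(4), of I n] \<open>I = {}\<close> acyclic_set_singleton[of "xc i"] by simp
next
  case (Suc m I i)
  note fin = Suc.prems(1) and IB = Suc.prems(2) and i = Suc.prems(3) and wn = Suc.prems(4)
  show ?case
  proof (cases "\<exists>b\<in>I. 0 < slope b (xc i)")
    case False
    have "xc i \<in> fibre i I n"
      using x_cycle_coords[OF i] x_cycle_eq[OF i] wn[of "{}"] by (simp add: fibre_def)
    then have "fibre i I n \<inter> {xc i} = {xc i}" by auto
    then show ?thesis
      using collapse_fibre_to_x_cycle[OF i, of I n] False acyclic_set_singleton[of "xc i"]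
      by (auto simp: not_less)
  next
    case True
    then obtain b where b: "b \<in> I" "0 < slope b (xc i)" by blast
    have bB: "b \<in> B" and bS: "b \<in> S" using b(1) IB B_sub by auto
    let ?V = "fibre i I n"
    define D where "D = {x \<in> ?V. x b = i b}"
    have "acyclic_set (?V - D) \<longrightarrow> acyclic_set ?V"
    proof (rule conjunct1[OF collapse_below[OF finite_fibre]])
      show "D \<subseteq> ?V" by (auto simp: D_def)
      show "y \<in> D" if "x \<in> D" "y \<in> ?V" "y \<le> x" for x y
      proof -
        have "y b \<le> i b" using that(1,3) by (auto simp: D_def le_fun_def) metis
        then show ?thesis using that(2) bB by (auto simp: D_def fibre_def)
      qed
      fix x assume "x \<in> D"
      then have x: "x \<in> coords S" "x b = i b" and xB: "\<And>c. c \<in> B \<Longrightarrow> i c \<le> x c"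
        by (auto simp: D_def fibre_def)
      \<comment> \<open>If no direction outside \<open>B\<close> has positive slope, minimality
        gives \<open>x(i) \<le> x\<close> with equality at \<open>b\<close>, and the positive slope
        at \<open>x(i)\<close> passes to \<open>x\<close>.\<close>
      have "\<exists>j\<in>S. 0 < slope j x \<and> (j \<in> B \<longrightarrow> j = b)"
      proof (cases "\<exists>j\<in>S - B. 0 < slope j x")
        case False
        then have "xc i \<le> x" using x_cycle_le[OF i x(1) xB] by (meson not_le)
        then have "slope b (xc i) \<le> slope b x"
          using x_cycle_eq[OF i bB] x(2) by (intro slope_mono) (auto simp: le_fun_def)
        then show ?thesis using b(2) bS by force
      qed blast
      then obtain j where j: "j \<in> S" "0 < slope j x" "j \<in> B \<Longrightarrow> j = b" by blast
      show "\<exists>j. \<forall>J. finite J \<longrightarrow> j \<notin> J \<longrightarrow> x + ind J \<in> ?V \<longrightarrow> x + ind J + unit_vec j \<in> ?V"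
      proof (intro exI allI impI)
        fix J assume J: "finite J" "j \<notin> J" "x + ind J \<in> ?V"
        have "slope j x \<le> slope j (x + ind J)"
          using J(2) by (intro slope_mono) (auto simp: ind_def)
        then have "weight (x + ind J + unit_vec j) \<le> weight (x + ind J)"
          using j by (intro weight_raise) auto
        moreover have "x + ind J + unit_vec j \<in> coords S"
          using J(3) j(1) by (auto simp: fibre_def coords_def unit_vec_def)
        moreover have "(x + ind J + unit_vec j) c = i c \<or> (c \<in> I \<and> (x + ind J + unit_vec j) c = i c + 1)"
          if c: "c \<in> B" for c
        proof (cases "c = j")
          case True
          then show ?thesis using j(3) c J(2) x(2) b(1) by (auto simp: unit_vec_def ind_def)
        next
          case False
          then show ?thesis using J(3) c by (auto simp: fibre_def unit_vec_def)
        qed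
        ultimately show "x + ind J + unit_vec j \<in> ?V" using J(3) by (auto simp: fibre_def)
      qed
    qed
    \<comment> \<open>What is left after removing the layer is the fibre over the opposite face, a
      cube of one dimension less.\<close>
    moreover have "?V - D = fibre (i + unit_vec b) (I - {b}) n"
    proof -
      have "(\<forall>c\<in>B. x c = i c \<or> c \<in> I \<and> x c = i c + 1) \<and> x b \<noteq> i b \<longleftrightarrow>
        (\<forall>c\<in>B. x c = (i + unit_vec b) c \<or> c \<in> I - {b} \<and> x c = (i + unit_vec b) c + 1)" for x
        using b(1) bB by (auto simp: unit_vec_def)
      then show ?thesis unfolding fibre_def D_def by blast
    qed
    moreover have "acyclic_set (fibre (i + unit_vec b) (I - {b}) n)"
    proof (rule Suc.hyps(1))
      show "m = card (I - {b})" using Suc.hyps(2) fin b(1) by simp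
      show "i + unit_vec b \<in> coords B" using i bB by (auto simp: coords_def unit_vec_def)
      fix J assume J: "J \<subseteq> I - {b}"
      then have "i + unit_vec b + ind J = i + ind (insert b J)"
        by (subst ind_insert) (auto simp: add.assoc)
      moreover have "insert b J \<subseteq> I" using J b(1) by auto
      ultimately show "weight (xc (i + unit_vec b + ind J)) \<le> n" using wn by metis
    qed (use fin IB in auto)
    ultimately show ?thesis by simp
  qed
qed

text \<open>If \<open>x\<close> has a negative bad coordinate, then \<open>min x 0\<close> is not
  nonnegative, so minimality of \<open>l_min G k\<close> gives a direction of positive slope there.
  All slopes at 0 are nonpositive, which forces \<open>x\<close> to be negative in that direction,
  and the slope at \<open>x\<close> is positive as well. Raising a negative coordinate leaves the
  projection unchanged.\<close>

lemma collapse_negative_part: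
  fixes n :: int
  assumes I: "finite I" "I \<subseteq> B" and i: "i \<in> coords B" "0 \<le> i"
  defines "V \<equiv> {x \<in> coords S. project B x \<in> cube_vertices (i, I) \<and> weight x \<le> n}"
  shows "(acyclic_set (fibre i I n) \<longrightarrow> acyclic_set V) \<and> (V \<noteq> {} \<longrightarrow> fibre i I n \<noteq> {})"
proof -
  define D where "D = {x \<in> V. \<exists>b\<in>B. x b < 0}"
  have "(acyclic_set (V - D) \<longrightarrow> acyclic_set V) \<and> (V \<noteq> {} \<longrightarrow> V - D \<noteq> {})"
  proof (rule collapse_below)
    show "finite V" by (rule finite_subset[OF _ finite_weight_sublevel[of n]]) (auto simp: V_def)
    show "D \<subseteq> V" by (auto simp: D_def)
    show "y \<in> D" if "x \<in> D" "y \<in> V" "y \<le> x" for x y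
      using that by (auto simp: D_def le_fun_def intro: le_less_trans)
    fix x assume "x \<in> D"
    then obtain b where b: "x \<in> coords S" "b \<in> B" "x b < 0" by (auto simp: D_def V_def)
    let ?x = "\<lambda>v. min (x v) 0"
    have xS: "?x \<in> coords S" using b(1) by (auto simp: coords_def)
    have "\<not> 0 \<le> ?x" using b(3) by (auto simp: le_fun_def intro!: exI[of _ b])
    then obtain j where j: "j \<in> S" "0 < slope j ?x"
      using nonneg_if_antinef[OF xS] unfolding slope_def by (meson not_le)
    have neg: "x j < 0"
    proof (rule ccontr)
      assume "\<not> x j < 0"
      then have "slope j ?x \<le> slope j 0" by (intro slope_mono) auto
      then show False using slope_zero[OF j(1)] j(2) by simp
    qed
    have jx: "0 < slope j x"
      using j(2) neg slope_mono[of ?x x j] by auto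
    show "\<exists>j. \<forall>J. finite J \<longrightarrow> j \<notin> J \<longrightarrow> x + ind J \<in> V \<longrightarrow> x + ind J + unit_vec j \<in> V"
    proof (intro exI allI impI)
      fix J assume J: "finite J" "j \<notin> J" "x + ind J \<in> V"
      have "slope j x \<le> slope j (x + ind J)"
        using J(2) by (intro slope_mono) (auto simp: ind_def)
      then have "weight (x + ind J + unit_vec j) \<le> weight (x + ind J)"
        using j(1) jx by (intro weight_raise) auto
      moreover have "project B (x + ind J + unit_vec j) = project B (x + ind J)"
        using J(2) neg by (auto simp: project_def ind_def unit_vec_def fun_eq_iff)
      moreover have "x + ind J + unit_vec j \<in> coords S"
        using J(3) j(1) by (auto simp: V_def coords_def unit_vec_def)
      ultimately show "x + ind J + unit_vec j \<in> V" using J(3) by (auto simp: V_def)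
    qed
  qed
  moreover have "V - D = fibre i I n"
  proof -
    have "project B x \<in> cube_vertices (i, I) \<and> \<not> (\<exists>b\<in>B. x b < 0) \<longleftrightarrow>
        (\<forall>b\<in>B. x b = i b \<or> (b \<in> I \<and> x b = i b + 1))" (is "?L \<longleftrightarrow> ?R") for x
    proof
      assume L: ?L
      then obtain J where J: "J \<subseteq> I" "project B x = i + ind J" by (auto simp: cube_vertices_eq[OF I(1)])
      show ?R
      proof
        fix b assume "b \<in> B"
        then have "x b = i b + ind J b" using L fun_cong[OF J(2), of b] by (auto simp: project_def max_def split: if_splits)
        then show "x b = i b \<or> (b \<in> I \<and> x b = i b + 1)" using J(1) by (auto simp: ind_def split: if_splits)
      qed
    next
      assume R: ?R
      have "0 \<le> x b" if "b \<in> B" for b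
        using R i(2) that by (auto simp: le_fun_def dest!: bspec[OF _ that] spec[of _ b])
      moreover from this have "project B x = i + ind {b \<in> I. x b = i b + 1}"
        using R i(1) I(2) by (auto simp: project_def ind_def fun_eq_iff coords_def)
      then have "project B x \<in> cube_vertices (i, I)"
        unfolding cube_vertices_eq[OF I(1)] by (intro image_eqI) auto
      ultimately show ?L by (auto simp: not_less)
    qed
    then show ?thesis unfolding V_def D_def fibre_def by blast
  qed
  ultimately show ?thesis by simp
qed

lemma isomorphic:
  "graded_isomorphic ZU (lattice_cohomology (coords S) weight q)
     (lattice_cohomology (first_quadrant B) (\<lambda>i. weight (xc i)) q)"
proof (rule projection_isomorphism[where \<Lambda> = "coords S" and B = B])
  show "cubes (coords S) q = full_cubes (coords S) q" for q by (rule cubes_coords)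
  show "cubes (first_quadrant B) q = full_cubes {i \<in> coords B. 0 \<le> i} q" for q
    by (rule cubes_first_quadrant)
  show "weight (xc (project B x)) \<le> weight x" if x: "x \<in> coords S" for x
  proof -
    let ?i = "project B x" and ?n = "weight x"
    have i: "?i \<in> coords B" "0 \<le> ?i" by (auto simp: project_def coords_def le_fun_def)
    \<comment> \<open>Over the single vertex \<open>?i\<close> and at level \<open>weight x\<close>
      the preimage contains \<open>x\<close>. Following nonemptiness through both collapses puts
      \<open>x(i)\<close> at that level.\<close>
    have "x \<in> {y \<in> coords S. project B y \<in> cube_vertices (?i, {}) \<and> weight y \<le> ?n}"
      using x by (simp add: cube_vertices_eq)
    then have "fibre ?i {} ?n \<noteq> {}"
      using collapse_negative_part[of "{}" ?i ?n] i by auto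
    then have "xc ?i \<in> fibre ?i {} ?n"
      using collapse_fibre_to_x_cycle[OF i(1), of "{}" ?n] by auto
    then show ?thesis by (simp add: fibre_def)
  qed
  fix i I n
  assume I: "finite I" and sub: "cube_vertices (i, I) \<subseteq> {i \<in> coords B. 0 \<le> i}"
    and w: "\<And>v. v \<in> cube_vertices (i, I) \<Longrightarrow> weight (xc v) \<le> n"
  have v: "i + ind J \<in> cube_vertices (i, I)" if "J \<subseteq> I" for J
    using that by (auto simp: cube_vertices_eq[OF I])
  have i: "i \<in> coords B" "0 \<le> i" using v[of "{}"] sub by auto
  have "I \<subseteq> B"
  proof
    fix b assume b: "b \<in> I"
    then have "i + ind {b} \<in> coords B" using v[of "{b}"] sub by auto
    then show "b \<in> B" using i(1) by (cases "b \<in> B") (auto simp: coords_def ind_def dest!: spec[of _ b])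
  qed
  moreover have "acyclic_set (fibre i I n)"
    using I \<open>I \<subseteq> B\<close> i(1) by (rule acyclic_fibre) (use v w in blast)
  ultimately show "acyclic_set {x \<in> coords S. project B x \<in> cube_vertices (i, I) \<and> weight x \<le> n}"
    using collapse_negative_part[OF I _ i] by blast
qed

end

theorem theorem3p3p2p2:
  fixes G :: "('v::linorder) plumbing_graph" and B :: "'v set" and k :: "'v \<Rightarrow> rat"
  assumes "is_tree G"
    and "negative_definite G"
    and "k \<in> characteristic_elements G"
    and "bad_vertices G B"
  shows "\<forall>q. graded_isomorphic ZU
           (graph_lattice_cohomology G (distinguished_rep G k) q)
           (reduced_lattice_cohomology G B k q)"
proof -
  interpret plumbing_lattice G
    using assms(1,2) by (rule plumbing_latticeI)
  interpret bad_vertex_lattice G B k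
    using assms(3,4) chi_can_bad_vertices[OF assms(1,2,4)]
    by unfold_locales (auto simp: bad_vertices_def)
  have "weight = (\<lambda>l. \<lfloor>\<chi> G (distinguished_rep G k) l\<rfloor>)" "(\<lambda>i. weight (xc i)) = reduced_weight G B k"
    by (auto simp: weight_def reduced_weight_def)
  then show ?thesis
    using isomorphic unfolding graph_lattice_cohomology_def reduced_lattice_cohomology_def by simp
qed

end
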